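(* Let $2\le k\le n$ be integers. Let $\varphi:(0,\infty)\to(0,\infty)$ be a continuous function satisfying $$\left(s\,\varphi^{\frac1k}(s)-t\,\varphi^{\frac1k}(t)\right)\left(\varphi^{\frac{k-1}{k}}(s)-\varphi^{\frac{k-1}{k}}(t)\right)<0\qquad\text{for all } t>s>0 .$$ Then, for any positive function $f\in C(\mathbb{S}^n)$, the smooth admissible solution $u$ to $$\varphi(u)\,P_k(\nabla^2u+u g_0)=f\quad\text{on }\mathbb{S}^n$$ is unique (i.e. there is at most one smooth admissible solution).
   Context: $(\mathbb{S}^n,g_0,\nabla)$ is the unit sphere in $\mathbb{R}^{n+1}$ with its standard round metric and Levi-Civita connection. For a symmetric $n\times n$ matrix $A$ (or a symmetric 2-tensor on $\mathbb{S}^n$ with respect to $g_0$) with eigenvalues $\lambda_1,\dots,\lambda_n$, $P_i(A)=\binom{n}{i}^{-1}\sum_{j_1<\cdots<j_i}\lambda_{j_1}\cdots\lambda_{j_i}$ is the normalized $i$-th elementary symmetric function of the eigenvalues. $\Gamma_k=\{A\in\mathrm{Sym}(n): P_i(A)>0,\ i=1,\dots,k\}$. A smooth admissible solution is a smooth function $u:\mathbb{S}^n\to(0,\infty)$ satisfying the equation and such that $W=\nabla^2u+u g_0\in\Gamma_k$ at every point of $\mathbb{S}^n$. *)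

theory Defs
  imports "HOL-Analysis.Analysis"
begin

section \<open>Smooth functions on the unit sphere\<close>

text \<open>
  For open \<open>U\<close>, \<open>Ck_on m F U\<close> says that \<open>F\<close> is \<open>m\<close> times continuously differentiable on \<open>U\<close>.
\<close>

primrec Ck_on :: "nat \<Rightarrow> ('a::euclidean_space \<Rightarrow> real) \<Rightarrow> 'a set \<Rightarrow> bool" where
  "Ck_on 0 F U \<longleftrightarrow> continuous_on U F"
| "Ck_on (Suc m) F U \<longleftrightarrow>
     F differentiable_on U \<and> (\<forall>v. Ck_on m (\<lambda>x. frechet_derivative F (at x) v) U)"

text \<open>
  A function on the embedded submanifold \<open>sphere 0 1\<close> is smooth iff it is locally the restriction
  of a smooth function on an open subset of the ambient space.  Functions on the sphere are total
  functions on the ambient space whose values off the sphere are irrelevant.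
\<close>

definition smooth_on_sphere :: "('a::euclidean_space \<Rightarrow> real) \<Rightarrow> bool" where
  "smooth_on_sphere u \<longleftrightarrow>
     (\<forall>x\<in>sphere 0 1. \<exists>U F. open U \<and> x \<in> U \<and> (\<forall>m. Ck_on m F U) \<and>
        (\<forall>y\<in>U \<inter> sphere 0 1. F y = u y))"

section \<open>Levi-Civita connection and Hessian of the round metric\<close>

text \<open>
  The round metric is the restriction of the inner product to the tangent spaces.
\<close>

definition tangent_space :: "'a::euclidean_space \<Rightarrow> 'a set" where
  "tangent_space x = {v. v \<bullet> x = 0}"

text \<open>
  The derivative at \<open>x\<close> within the sphere is determined on \<open>tangent_space x\<close> only; in the normal
  direction it can be changed arbitrarily.  Hence there is exactly one tangential gradient.
\<close>

definition sphere_grad :: "('a::euclidean_space \<Rightarrow> real) \<Rightarrow> 'a \<Rightarrow> 'a" where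
  "sphere_grad u x =
     (THE g. g \<in> tangent_space x \<and> (u has_derivative (\<lambda>v. g \<bullet> v)) (at x within sphere 0 1))"

text \<open>
  The Levi-Civita connection of the induced metric: \<open>\<nabla>\<^sub>v Y\<close> is the orthogonal projection to
  \<open>tangent_space x\<close> of the Euclidean derivative of the vector field \<open>Y\<close> in the direction \<open>v\<close>.
  It is meaningful for \<open>x\<close> on the sphere and \<open>v \<in> tangent_space x\<close>.
\<close>

definition sphere_connection ::
    "('a::euclidean_space \<Rightarrow> 'a) \<Rightarrow> 'a \<Rightarrow> 'a \<Rightarrow> 'a" where
  "sphere_connection Y x v =
     (let D = frechet_derivative Y (at x within sphere 0 1) v in D - (D \<bullet> x) *\<^sub>R x)"

definition sphere_hessian ::
    "('a::euclidean_space \<Rightarrow> real) \<Rightarrow> 'a \<Rightarrow> 'a \<Rightarrow> 'a \<Rightarrow> real" where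
  "sphere_hessian u x v w = sphere_connection (sphere_grad u) x v \<bullet> w"

definition W_tensor ::
    "('a::euclidean_space \<Rightarrow> real) \<Rightarrow> 'a \<Rightarrow> 'a \<Rightarrow> 'a \<Rightarrow> real" where
  "W_tensor u x v w = sphere_hessian u x v w + u x * (v \<bullet> w)"

section \<open>Symmetric functions of the eigenvalues\<close>

text \<open>
  Here \<open>T\<close> is a subspace and \<open>B\<close> a bilinear form, of which only the values on \<open>T\<close> are used.
  Eigenvalues of \<open>B\<close> are taken with respect to the inner product on \<open>T\<close>.
\<close>

definition eigenspace_on ::
    "'a::euclidean_space set \<Rightarrow> ('a \<Rightarrow> 'a \<Rightarrow> real) \<Rightarrow> real \<Rightarrow> 'a set" where
  "eigenspace_on T B l = {v\<in>T. \<forall>w\<in>T. B v w = l * (v \<bullet> w)}"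

text \<open>
  The eigenvalues listed with multiplicity: \<open>(l, j)\<close> stands for the \<open>j\<close>-th copy of the
  eigenvalue \<open>l\<close>.  If \<open>B\<close> is symmetric on \<open>T\<close>, this set has exactly \<open>dim T\<close> elements.
\<close>

definition eigenvalues_on ::
    "'a::euclidean_space set \<Rightarrow> ('a \<Rightarrow> 'a \<Rightarrow> real) \<Rightarrow> (real \<times> nat) set" where
  "eigenvalues_on T B = {(l, j). j < dim (eigenspace_on T B l)}"

definition P_on ::
    "'a::euclidean_space set \<Rightarrow> nat \<Rightarrow> ('a \<Rightarrow> 'a \<Rightarrow> real) \<Rightarrow> real" where
  "P_on T i B =
     (\<Sum>J | J \<subseteq> eigenvalues_on T B \<and> card J = i. \<Prod>(l, j)\<in>J. l) / real (dim T choose i)"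

definition Gamma_on ::
    "'a::euclidean_space set \<Rightarrow> nat \<Rightarrow> ('a \<Rightarrow> 'a \<Rightarrow> real) set" where
  "Gamma_on T k =
     {B. bilinear B \<and> (\<forall>v\<in>T. \<forall>w\<in>T. B v w = B w v) \<and> (\<forall>i\<in>{1..k}. P_on T i B > 0)}"

definition smooth_admissible_solution ::
    "nat \<Rightarrow> (real \<Rightarrow> real) \<Rightarrow> ('a::euclidean_space \<Rightarrow> real) \<Rightarrow> ('a \<Rightarrow> real) \<Rightarrow> bool" where
  "smooth_admissible_solution k \<phi> f u \<longleftrightarrow>
     smooth_on_sphere u \<and>
     (\<forall>x\<in>sphere 0 1. u x > 0) \<and>
     (\<forall>x\<in>sphere 0 1. W_tensor u x \<in> Gamma_on (tangent_space x) k) \<and>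
     (\<forall>x\<in>sphere 0 1. \<phi> (u x) * P_on (tangent_space x) k (W_tensor u x) = f x)"

end

theory Submission imports Defs begin

text \<open>
  Put \<open>W\<^sub>i = \<nabla>\<^sup>2 u\<^sub>i + u\<^sub>i g\<^sub>0\<close>, and let \<open>P\<^sub>k(W\<^sub>1, \<dots>, W\<^sub>1, W\<^sub>2)\<close> be the polarization of \<open>P\<^sub>k\<close>.  Since the
  Newton tensor of \<open>W\<^sub>1\<close> is divergence free, \<open>\<integral> u\<^sub>2 P\<^sub>k(W\<^sub>1) = \<integral> u\<^sub>1 P\<^sub>k(W\<^sub>1, \<dots>, W\<^sub>1, W\<^sub>2)\<close>, and Garding's
  inequality bounds the right-hand side from below by \<open>\<integral> u\<^sub>1 P\<^sub>k(W\<^sub>1)\<^bsup>(k-1)/k\<^esup> P\<^sub>k(W\<^sub>2)\<^bsup>1/k\<^esup>\<close>.  Inserting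
  the equation and adding the inequality with the roles of \<open>u\<^sub>1\<close> and \<open>u\<^sub>2\<close> exchanged, one obtains that
  the integral of \<open>f / (\<phi>(u\<^sub>1) \<phi>(u\<^sub>2))\<close> times the product in the hypothesis on \<open>\<phi>\<close>
  (with \<open>s = u\<^sub>1\<close>, \<open>t = u\<^sub>2\<close>) is nonnegative.  Its integrand is negative wherever \<open>u\<^sub>1 \<noteq> u\<^sub>2\<close>.

  All this is carried out in the ambient space: if \<open>U\<close> is the extension of \<open>u\<close> that is homogeneous of
  degree one, then \<open>D\<^sup>2U\<close> annihilates the radial direction and restricts to \<open>\<nabla>\<^sup>2 u + u g\<^sub>0\<close> on tangent
  spaces, so integrals over the sphere become integrals against a radial cutoff.
\<close>

section \<open>Elementary symmetric functions and the Garding cone\<close>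

text \<open>The obstacle in Garding's inequality is that the two Hessians need not commute. For
  vectors of eigenvalues it follows from the concavity of successive quotients of elementary
  symmetric functions. For matrices \<open>M\<close>, \<open>N\<close>, the Newton tensor
  \<open>T\<close> of \<open>M\<close> is diagonal in an eigenframe of \<open>M\<close>, and an
  eigenframe of \<open>N\<close> is found by a minimization that bounds tr(T N) from below by a
  pairing of the eigenvalues of \<open>N\<close> with those of \<open>T\<close>. No eigenvalue is
  ever differentiated: the symmetric functions and \<open>T\<close> are polynomials in the matrix
  entries, and their derivatives at a point are evaluated in an eigenframe at that point alone. No
  surface measure occurs either. The integral identity is that of a compactly supported divergence
  on the whole space. Up to the cutoff its integrand is homogeneous, so the sign found on the unit
  sphere holds throughout the shell, and a continuous nonpositive function with integral zero
  vanishes pointwise.\<close>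

definition esym :: "nat \<Rightarrow> 'i set \<Rightarrow> ('i \<Rightarrow> real) \<Rightarrow> real" where
  "esym k I x = (\<Sum>J | J \<subseteq> I \<and> card J = k. \<Prod>i\<in>J. x i)"

lemma esym_0 [simp]: "finite I \<Longrightarrow> esym 0 I x = 1"
proof -
  assume "finite I"
  then have "{J. J \<subseteq> I \<and> card J = 0} = {{}}"
    by (auto dest: finite_subset)
  then show ?thesis by (simp add: esym_def)
qed

lemma esym_empty_Suc [simp]: "esym (Suc k) {} x = 0"
  unfolding esym_def by (rule sum.neutral) auto

lemma esym_cong: "(\<And>i. i \<in> I \<Longrightarrow> x i = y i) \<Longrightarrow> esym k I x = esym k I y"
  unfolding esym_def by (intro sum.cong prod.cong) auto

lemma esym_insert:
  assumes "finite I" "a \<notin> I"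
  shows "esym (Suc k) (insert a I) x = esym (Suc k) I x + x a * esym k I x"
proof -
  let ?P = "\<lambda>k I. {J. J \<subseteq> I \<and> card J = k}"
  have fin: "finite (?P k I)" for k using assms by simp
  have "?P (Suc k) (insert a I) = ?P (Suc k) I \<union> insert a ` ?P k I"
  proof (intro equalityI subsetI)
    fix J assume J: "J \<in> ?P (Suc k) (insert a I)"
    show "J \<in> ?P (Suc k) I \<union> insert a ` ?P k I"
    proof (cases "a \<in> J")
      case True
      have "finite J" using J assms finite_subset by fastforce
      then have "J - {a} \<in> ?P k I" "J = insert a (J - {a})" using J True by auto
      then show ?thesis by blast
    qed (use J in auto)
  next
    fix J assume "J \<in> ?P (Suc k) I \<union> insert a ` ?P k I"
    then show "J \<in> ?P (Suc k) (insert a I)"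
    proof
      assume "J \<in> insert a ` ?P k I"
      then obtain L where L: "J = insert a L" "L \<subseteq> I" "card L = k" by auto
      then have "finite L" "a \<notin> L" using assms finite_subset by auto
      then show ?thesis using L by auto
    qed auto
  qed
  moreover have "?P (Suc k) I \<inter> insert a ` ?P k I = {}" using assms by auto
  moreover have "inj_on (insert a) (?P k I)" using assms by (auto simp: inj_on_def)
  moreover have "(\<Prod>i\<in>insert a L. x i) = x a * (\<Prod>i\<in>L. x i)" if "L \<in> ?P k I" for L
  proof -
    have "finite L" "a \<notin> L" using that assms finite_subset by auto
    then show ?thesis by simp
  qed
  ultimately show ?thesis
    using fin by (simp add: esym_def sum.union_disjoint sum.reindex sum_distrib_left)
qed

lemma esym_remove:
  assumes "finite I" "a \<in> I"
  shows "esym (Suc k) I x = esym (Suc k) (I - {a}) x + x a * esym k (I - {a}) x"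
  using esym_insert[of "I - {a}" a k x] assms by (simp add: insert_absorb)

lemma esym_gt_card: "finite I \<Longrightarrow> card I < k \<Longrightarrow> esym k I x = 0"
  unfolding esym_def by (rule sum.neutral) (metis (mono_tags, lifting) card_mono mem_Collect_eq not_le)

lemma esym_pos:
  assumes "finite I" "k \<le> card I" "\<And>i. i \<in> I \<Longrightarrow> x i > 0"
  shows "esym k I x > 0"
  unfolding esym_def
proof (rule sum_pos)
  show "finite {J. J \<subseteq> I \<and> card J = k}" using assms by simp
  show "{J. J \<subseteq> I \<and> card J = k} \<noteq> {}"
    using obtain_subset_with_card_n[OF assms(2)] by blast
qed (use assms in \<open>auto intro!: prod_pos\<close>)

lemma esym_1: "finite I \<Longrightarrow> esym (Suc 0) I x = sum x I"
  by (induction I rule: finite_induct) (auto simp: esym_insert)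

text \<open>Euler's identity for a homogeneous polynomial: \<open>esym k (I - {i})\<close> is the
  partial derivative of \<open>esym (Suc k) I\<close> in the variable \<open>i\<close>.\<close>

lemma sum_mult_esym_remove:
  assumes "finite I"
  shows "(\<Sum>i\<in>I. x i * esym k (I - {i}) x) = real (Suc k) * esym (Suc k) I x"
  using assms
proof (induction I arbitrary: k rule: finite_induct)
  case empty
  then show ?case by simp
next
  case (insert a I)
  have r: "insert a I - {i} = insert a (I - {i})" if "i \<in> I" for i using that insert by auto
  show ?case
  proof (cases k)
    case 0
    then show ?thesis using insert by (simp add: esym_1)
  next
    case (Suc m)
    have "(\<Sum>i\<in>I. x i * esym k (insert a I - {i}) x)
        = (\<Sum>i\<in>I. x i * esym k (I - {i}) x) + x a * (\<Sum>i\<in>I. x i * esym m (I - {i}) x)"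
      unfolding sum_distrib_left sum.distrib[symmetric]
      by (intro sum.cong refl) (use insert in \<open>simp add: r Suc esym_insert algebra_simps\<close>)
    then show ?thesis using insert by (simp add: Suc esym_insert algebra_simps)
  qed
qed

lemma DERIV_esym_line:
  assumes "finite I"
  shows "((\<lambda>t. esym (Suc k) I (\<lambda>i. x i + t * y i)) has_real_derivative
           (\<Sum>i\<in>I. y i * esym k (I - {i}) (\<lambda>i. x i + t * y i))) (at t)"
  using assms
proof (induction I arbitrary: k rule: finite_induct)
  case empty
  then show ?case by simp
next
  case (insert a I)
  have r: "insert a I - {i} = insert a (I - {i})" if "i \<in> I" for i using that insert by auto
  let ?z = "\<lambda>i. x i + t * y i"
  show ?case
  proof (cases k)
    case 0
    have "((\<lambda>t. \<Sum>i\<in>insert a I. x i + t * y i) has_real_derivative (\<Sum>i\<in>insert a I. y i)) (at t)"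
      by (auto intro!: derivative_eq_intros)
    then show ?thesis using insert by (simp add: 0 esym_1)
  next
    case (Suc m)
    have "(\<Sum>i\<in>I. y i * esym k (insert a I - {i}) ?z)
        = (\<Sum>i\<in>I. y i * esym k (I - {i}) ?z) + ?z a * (\<Sum>i\<in>I. y i * esym m (I - {i}) ?z)"
      unfolding sum_distrib_left sum.distrib[symmetric]
      by (intro sum.cong refl) (use insert in \<open>simp add: r Suc esym_insert algebra_simps\<close>)
    moreover have "((\<lambda>t. esym (Suc k) I (\<lambda>i. x i + t * y i) + (x a + t * y a) * esym (Suc m) I (\<lambda>i. x i + t * y i))
       has_real_derivative (\<Sum>i\<in>I. y i * esym k (I - {i}) ?z) +
         ((0 + 1 * y a) * esym (Suc m) I ?z + (\<Sum>i\<in>I. y i * esym m (I - {i}) ?z) * ?z a)) (at t)"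
      by (intro derivative_intros insert.IH)
         (auto intro!: derivative_eq_intros)
    ultimately show ?thesis using insert by (simp add: Suc esym_insert algebra_simps)
  qed
qed

section \<open>The Garding cone: stability under shifts and under removal of a variable\<close>

definition Gcone :: "nat \<Rightarrow> 'i set \<Rightarrow> ('i \<Rightarrow> real) set" where
  "Gcone k I = {x. \<forall>j\<in>{1..k}. esym j I x > 0}"

lemma GconeD: "x \<in> Gcone k I \<Longrightarrow> finite I \<Longrightarrow> j \<le> k \<Longrightarrow> esym j I x > 0"
  by (cases j) (auto simp: Gcone_def)

lemma Gcone_mono: "j \<le> k \<Longrightarrow> Gcone k I \<subseteq> Gcone j I"
  by (auto simp: Gcone_def)

lemma Gcone_card: "x \<in> Gcone k I \<Longrightarrow> finite I \<Longrightarrow> k \<le> card I"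
  using GconeD[of x k I k] esym_gt_card[of I k x] by (force simp: not_le)

lemma sum_esym_remove:
  assumes "finite I"
  shows "(\<Sum>i\<in>I. esym k (I - {i}) x) = (real (card I) - real k) * esym k I x"
proof (cases k)
  case 0
  then show ?thesis using assms by simp
next
  case (Suc m)
  have "(\<Sum>i\<in>I. esym k (I - {i}) x) = (\<Sum>i\<in>I. esym k I x - x i * esym m (I - {i}) x)"
    by (intro sum.cong refl) (use esym_remove[OF assms] in \<open>simp add: Suc\<close>)
  then show ?thesis
    by (simp add: sum_subtractf sum_mult_esym_remove[OF assms] Suc algebra_simps)
qed

lemma DERIV_esym_shift:
  assumes "finite I"
  shows "((\<lambda>t. esym (Suc k) I (\<lambda>i. x i + t)) has_real_derivative
           (real (card I) - real k) * esym k I (\<lambda>i. x i + t)) (at t)"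
  using DERIV_esym_line[OF assms, of k x "\<lambda>_. 1" t] by (simp add: sum_esym_remove[OF assms])

lemma continuous_esym_shift: "finite I \<Longrightarrow> isCont (\<lambda>t. esym k I (\<lambda>i. x i + t)) s"
  by (cases k) (auto intro: DERIV_isCont DERIV_esym_shift)

lemma esym_shift_increasing:
  assumes "finite I" "\<And>s. 0 \<le> s \<Longrightarrow> (\<lambda>i. x i + s) \<in> Gcone k I" "k < card I" "0 < s"
  shows "esym (Suc k) I x < esym (Suc k) I (\<lambda>i. x i + s)"
proof -
  have "\<exists>y. ((\<lambda>t. esym (Suc k) I (\<lambda>i. x i + t)) has_real_derivative y) (at t) \<and> 0 < y"
    if "0 \<le> t" for t
    using DERIV_esym_shift[OF assms(1), of k x t] GconeD[OF assms(2)[OF that] assms(1)] assms(3)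
    by (intro exI conjI) auto
  from DERIV_pos_imp_increasing[OF \<open>0 < s\<close> this] show ?thesis by simp
qed

text \<open>Along the direction (1, ..., 1) the derivative of \<open>esym (Suc k)\<close> is a
  positive multiple of \<open>esym k\<close>, so positivity propagates from each order to the
  next.\<close>

lemma Gcone_shift:
  assumes "finite I" "x \<in> Gcone k I" "0 \<le> s"
  shows "(\<lambda>i. x i + s) \<in> Gcone k I"
  using assms(2,3)
proof (induction k arbitrary: s)
  case 0
  then show ?case by (simp add: Gcone_def)
next
  case (Suc k)
  have x: "x \<in> Gcone k I" using Suc.prems Gcone_mono[of k "Suc k" I] by auto
  have "esym (Suc k) I x > 0" using GconeD[OF Suc.prems(1) assms(1)] by blast
  moreover have "k < card I" using Gcone_card[OF Suc.prems(1) assms(1)] by simp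
  ultimately have "esym (Suc k) I (\<lambda>i. x i + s) > 0"
    using esym_shift_increasing[OF assms(1) Suc.IH[OF x], where s = s] Suc.prems(2)
    by (cases "s = 0") auto
  moreover have "(\<lambda>i. x i + s) \<in> Gcone k I" using Suc.IH[OF x Suc.prems(2)] .
  ultimately show ?case by (auto simp: Gcone_def le_Suc_eq)
qed

text \<open>If the value on \<open>I - {a}\<close> were nonpositive, some shift \<open>y\<close> of
  \<open>x\<close>, still in the cone of \<open>I\<close>, would make it zero. At such a
  \<open>y\<close> the order \<open>Suc k\<close> function on \<open>I - {a}\<close> is nonpositive,
  and since the term carrying \<open>y a\<close> vanishes, so is the one on
  \<open>I\<close>.\<close>

lemma esym_remove_pos:
  assumes "finite I" "x \<in> Gcone (Suc k) I" "a \<in> I"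
  shows "esym k (I - {a}) x > 0"
  using assms
proof (induction k arbitrary: I x a rule: less_induct)
  case (less k)
  note fin = \<open>finite I\<close>
  show ?case
  proof (cases k)
    case 0
    then show ?thesis using fin by simp
  next
    case (Suc m)
    define J where "J = I - {a}"
    have J: "finite J" "Suc m \<le> card J"
      using Gcone_card[OF less.prems(2) fin] fin less.prems(3) by (auto simp: J_def Suc)
    let ?g = "\<lambda>s. esym k J (\<lambda>i. x i + s)"
    show ?thesis
    proof (rule ccontr)
      assume "\<not> ?thesis"
      then have g0: "?g 0 \<le> 0" by (simp add: J_def)
      \<comment> \<open>A shift so large that all entries become positive; the zero lies between
        \<open>0\<close> and \<open>s1\<close>.\<close>
      define s1 where "s1 = 1 + (\<Sum>i\<in>J. \<bar>x i\<bar>)"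
      have s1: "x i + s1 > 0" if "i \<in> J" for i
        using member_le_sum[of i J "\<lambda>i. \<bar>x i\<bar>"] that J by (auto simp: s1_def)
      have "s1 \<ge> 0" unfolding s1_def by (simp add: sum_nonneg)
      have "?g s1 > 0" using s1 J by (intro esym_pos) (auto simp: Suc)
      then obtain s where s: "0 \<le> s" "?g s = 0"
        using IVT[of ?g 0 0 s1] g0 \<open>s1 \<ge> 0\<close> J by (auto simp: continuous_esym_shift)
      define y where "y = (\<lambda>i. x i + s)"
      have y: "y \<in> Gcone (Suc k) I" unfolding y_def using Gcone_shift fin less.prems(2) s by blast
      have yJ: "y \<in> Gcone m J"
        unfolding Gcone_def J_def
      proof (intro CollectI ballI)
        fix j assume j: "j \<in> {1..m}"
        show "0 < esym j (I - {a}) y"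
        proof (rule less.IH[OF _ fin _ less.prems(3)])
          show "j < k" using j Suc by simp
          then show "y \<in> Gcone (Suc j) I" using y Gcone_mono[of "Suc j" "Suc k" I] by auto
        qed
      qed
      \<comment> \<open>Here \<open>y\<close> lies on the boundary of the cone of order
        \<open>Suc m\<close> on \<open>J\<close>, where the induction hypothesis does not apply. It
        applies to \<open>y + t\<close> for small positive \<open>t\<close>, and the limit keeps a
        weak inequality.\<close>
      have "esym m (J - {b}) y \<ge> 0" if b: "b \<in> J" for b
      proof (rule tendsto_lowerbound)
        show "((\<lambda>t. esym m (J - {b}) (\<lambda>i. y i + t)) \<longlongrightarrow> esym m (J - {b}) y) (at_right 0)"
          using continuous_esym_shift[where I = "J - {b}" and k = m and x = y and s = 0] J
          by (auto simp: isCont_def intro: tendsto_within_subset)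
        show "eventually (\<lambda>t. 0 \<le> esym m (J - {b}) (\<lambda>i. y i + t)) (at_right 0)"
          unfolding eventually_at_right_field
        proof (intro exI conjI allI impI)
          fix t :: real assume t: "0 < t" "t < 1"
          have "(\<lambda>i. y i + t) \<in> Gcone m J" using Gcone_shift[OF J(1) yJ, of t] t by auto
          moreover have "esym (Suc m) J (\<lambda>i. y i + t) > 0"
            using esym_shift_increasing[OF J(1) Gcone_shift[OF J(1) yJ], of t] J t s
            by (simp add: y_def Suc)
          ultimately have "(\<lambda>i. y i + t) \<in> Gcone (Suc m) J" by (auto simp: Gcone_def le_Suc_eq)
          then show "0 \<le> esym m (J - {b}) (\<lambda>i. y i + t)"
            by (intro less_imp_le less.IH[OF _ J(1) _ b]) (use Suc in auto)
        qed simp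
      qed simp
      moreover have "esym (Suc m) (J - {b}) y = - y b * esym m (J - {b}) y" if b: "b \<in> J" for b
      proof -
        have "esym (Suc m) J y = 0" using s by (simp add: y_def Suc)
        then show ?thesis using esym_remove[OF J(1) b, of m y] by simp
      qed
      ultimately have "(\<Sum>b\<in>J. y b * esym (Suc m) (J - {b}) y) \<le> 0"
        by (intro sum_nonpos) (simp add: mult_nonneg_nonneg mult.assoc[symmetric])
      then have "esym (Suc (Suc m)) J y \<le> 0"
        using sum_mult_esym_remove[OF J(1), of y "Suc m"] by (auto simp: mult_le_0_iff)
      moreover have "esym (Suc k) I y > 0" using GconeD[OF y fin] by blast
      ultimately show False
        using esym_remove[OF fin less.prems(3), of k y] s by (simp add: y_def Suc J_def)
    qed
  qed
qed

lemma Gcone_remove: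
  assumes "finite I" "x \<in> Gcone (Suc k) I" "a \<in> I"
  shows "x \<in> Gcone k (I - {a})"
  unfolding Gcone_def
proof (intro CollectI ballI)
  fix j assume "j \<in> {1..k}"
  then have "x \<in> Gcone (Suc j) I" using assms(2) Gcone_mono[of "Suc j" "Suc k" I] by auto
  then show "0 < esym j (I - {a}) x" by (rule esym_remove_pos[OF assms(1) _ assms(3)])
qed

section \<open>Concavity of quotients and Garding's inequality for vectors\<close>

lemma square_div_add_le:
  fixes a b z w :: real
  assumes "z > 0" "w > 0"
  shows "(a + b)\<^sup>2 / (z + w) \<le> a\<^sup>2 / z + b\<^sup>2 / w"
proof -
  define p q where "p = a / z" and "q = b / w"
  have ab: "a = p * z" "b = q * w" using assms by (auto simp: p_def q_def)
  have eq: "(a\<^sup>2 / z + b\<^sup>2 / w) * (z + w) - (a + b)\<^sup>2 = z * w * (p - q)\<^sup>2"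
    using assms unfolding ab by (simp add: power2_eq_square) (simp add: algebra_simps)
  have "(a + b)\<^sup>2 \<le> (a\<^sup>2 / z + b\<^sup>2 / w) * (z + w)"
    using assms mult_nonneg_nonneg[of "z * w" "(p - q)\<^sup>2"] unfolding eq[symmetric] by simp
  then show ?thesis using assms by (simp add: pos_divide_le_eq)
qed

text \<open>Marcus--Lopes: this expression for the quotient \<open>e\<^sub>k / e\<^sub>k\<^sub>-\<^sub>1\<close> exhibits it as concave,
  given that the quotient of one order less is.\<close>

lemma esym_quotient:
  assumes fin: "finite I" and x: "x \<in> Gcone (Suc k) I"
    and pos: "\<forall>i\<in>I. x \<in> Gcone k (I - {i})"
  shows "real (Suc (Suc k)) * (esym (Suc (Suc k)) I x / esym (Suc k) I x) =
    (\<Sum>i\<in>I. x i - (x i)\<^sup>2 / (x i + esym (Suc k) (I - {i}) x / esym k (I - {i}) x))"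
    and "\<And>i. i \<in> I \<Longrightarrow> x i + esym (Suc k) (I - {i}) x / esym k (I - {i}) x > 0"
proof -
  let ?E = "esym (Suc k) I x"
  have E: "?E > 0" using GconeD[OF x fin] by blast
  have p: "esym k (I - {i}) x > 0" if "i \<in> I" for i using GconeD[of x k "I - {i}" k] pos that fin by auto
  have eq: "x i + esym (Suc k) (I - {i}) x / esym k (I - {i}) x = ?E / esym k (I - {i}) x" if "i \<in> I" for i
    using p[OF that] esym_remove[OF fin that, of k x] by (simp add: field_simps)
  show "x i + esym (Suc k) (I - {i}) x / esym k (I - {i}) x > 0" if "i \<in> I" for i
    using eq p E that by simp
  have "real (Suc (Suc k)) * (esym (Suc (Suc k)) I x / ?E) = (\<Sum>i\<in>I. x i * esym (Suc k) (I - {i}) x) / ?E"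
    by (simp add: sum_mult_esym_remove[OF fin])
  also have "\<dots> = (\<Sum>i\<in>I. x i - (x i)\<^sup>2 / (x i + esym (Suc k) (I - {i}) x / esym k (I - {i}) x))"
    unfolding sum_divide_distrib
  proof (intro sum.cong refl)
    fix i assume i: "i \<in> I"
    have *: "esym (Suc k) (I - {i}) x = ?E - x i * esym k (I - {i}) x" using esym_remove[OF fin i, of k x] by simp
    show "x i * esym (Suc k) (I - {i}) x / ?E =
        x i - (x i)\<^sup>2 / (x i + esym (Suc k) (I - {i}) x / esym k (I - {i}) x)"
      unfolding eq[OF i] unfolding * using E p[OF i] by (simp add: field_simps power2_eq_square)
  qed
  finally show "real (Suc (Suc k)) * (esym (Suc (Suc k)) I x / ?E) = \<dots>" .
qed

text \<open>The quotient is homogeneous of degree one, so superadditivity is concavity. In the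
  Marcus-Lopes formula each subtracted fraction is subadditive by Cauchy-Schwarz once its
  denominator is superadditive, which is the previous order. Membership of the sum is proved along
  with it, because positivity of the next quotient is what enlarges the order of the cone.\<close>

lemma esym_quotient_superadditive:
  assumes "finite I" "x \<in> Gcone (Suc k) I" "y \<in> Gcone (Suc k) I"
  shows "(\<lambda>i. x i + y i) \<in> Gcone (Suc k) I \<and>
    esym (Suc k) I x / esym k I x + esym (Suc k) I y / esym k I y
      \<le> esym (Suc k) I (\<lambda>i. x i + y i) / esym k I (\<lambda>i. x i + y i)"
  using assms
proof (induction k arbitrary: I)
  case 0
  then show ?case by (simp add: Gcone_def esym_1 sum.distrib)
next
  case (Suc k)
  note fin = \<open>finite I\<close>
  let ?z = "\<lambda>i. x i + y i"
  let ?q = "\<lambda>k I x. esym (Suc k) I x / esym k I x"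
  have x': "x \<in> Gcone (Suc k) I" and y': "y \<in> Gcone (Suc k) I"
    using Suc.prems Gcone_mono[of "Suc k" "Suc (Suc k)" I] by auto
  have z: "?z \<in> Gcone (Suc k) I" using Suc.IH[OF fin x' y'] by blast
  have xr: "x \<in> Gcone (Suc k) (I - {i})" and yr: "y \<in> Gcone (Suc k) (I - {i})" if "i \<in> I" for i
    using Gcone_remove[OF fin _ that] Suc.prems by auto
  have r: "?z \<in> Gcone (Suc k) (I - {i})" "?q k (I - {i}) x + ?q k (I - {i}) y \<le> ?q k (I - {i}) ?z"
    if "i \<in> I" for i using Suc.IH[OF _ xr[OF that] yr[OF that]] fin by auto
  have "\<forall>i\<in>I. x \<in> Gcone k (I - {i})" "\<forall>i\<in>I. y \<in> Gcone k (I - {i})" "\<forall>i\<in>I. ?z \<in> Gcone k (I - {i})"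
    using Gcone_mono[of k "Suc k"] xr yr r(1) by fastforce+
  note qx = esym_quotient[OF fin x' this(1)] and qy = esym_quotient[OF fin y' this(2)]
    and qz = esym_quotient[OF fin z this(3)]
  have "real (Suc (Suc k)) * (?q (Suc k) I x + ?q (Suc k) I y) \<le> real (Suc (Suc k)) * ?q (Suc k) I ?z"
    unfolding distrib_left qx(1) qy(1) qz(1) sum.distrib[symmetric]
  proof (rule sum_mono)
    fix i assume i: "i \<in> I"
    let ?a = "x i + ?q k (I - {i}) x" and ?b = "y i + ?q k (I - {i}) y"
    have "(x i + y i)\<^sup>2 / (?z i + ?q k (I - {i}) ?z) \<le> (x i + y i)\<^sup>2 / (?a + ?b)"
      using qx(2)[OF i] qy(2)[OF i] r(2)[OF i] by (intro divide_left_mono) (auto intro!: mult_pos_pos)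
    also have "\<dots> \<le> (x i)\<^sup>2 / ?a + (y i)\<^sup>2 / ?b"
      using qx(2)[OF i] qy(2)[OF i] by (rule square_div_add_le)
    finally show "x i - (x i)\<^sup>2 / ?a + (y i - (y i)\<^sup>2 / ?b) \<le> ?z i - (?z i)\<^sup>2 / (?z i + ?q k (I - {i}) ?z)"
      by simp
  qed
  then have le: "?q (Suc k) I x + ?q (Suc k) I y \<le> ?q (Suc k) I ?z"
    by (rule mult_left_le_imp_le) simp
  have "?q (Suc k) I x > 0" "?q (Suc k) I y > 0"
    using GconeD[OF Suc.prems(2) fin] GconeD[OF Suc.prems(3) fin] by auto
  then have "?q (Suc k) I ?z > 0" using le by linarith
  then have "esym (Suc (Suc k)) I ?z > 0"
    using GconeD[OF z fin, of "Suc k"] by (simp add: zero_less_divide_iff)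
  then have "?z \<in> Gcone (Suc (Suc k)) I" using z by (auto simp: Gcone_def le_Suc_eq)
  then show ?case using le by blast
qed

lemma esym_scale: "esym j I (\<lambda>i. t * x i) = t ^ j * esym j I x"
  unfolding esym_def sum_distrib_left by (intro sum.cong refl) (auto simp: prod.distrib)

lemma Gcone_scale: "x \<in> Gcone k I \<Longrightarrow> t > 0 \<Longrightarrow> (\<lambda>i. t * x i) \<in> Gcone k I"
  by (simp add: Gcone_def esym_scale)

lemma prod_one_add_ge:
  fixes r :: "nat \<Rightarrow> real"
  assumes "\<And>j. r j \<ge> 0"
  shows "(\<Prod>j<k. 1 + r j) \<ge> 1 + (\<Sum>j<k. r j)"
proof (induction k)
  case (Suc k)
  have "(\<Sum>j<k. r j) \<ge> 0" using assms by (simp add: sum_nonneg)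
  then have "1 + (\<Sum>j<k. r j) + r k \<le> (1 + (\<Sum>j<k. r j)) * (1 + r k)"
    using assms[of k] by (simp add: algebra_simps)
  also have "\<dots> \<le> (\<Prod>j<k. 1 + r j) * (1 + r k)"
    using Suc assms[of k] by (intro mult_right_mono) auto
  finally show ?case by simp
qed simp

lemma esym_eq_prod_quotient:
  assumes "finite I" "x \<in> Gcone k I"
  shows "esym k I x = (\<Prod>j<k. esym (Suc j) I x / esym j I x)"
  using assms(2)
proof (induction k)
  case (Suc k)
  have "x \<in> Gcone k I" using Suc.prems Gcone_mono[of k "Suc k"] by fastforce
  then have "esym k I x = (\<Prod>j<k. esym (Suc j) I x / esym j I x)" by (rule Suc.IH)
  moreover have "esym k I x \<noteq> 0" using GconeD[OF Suc.prems assms(1), of k] by simp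
  ultimately show ?case unfolding prod.lessThan_Suc by (metis nonzero_mult_div_cancel_left times_divide_eq_right)
qed (simp add: assms)

text \<open>Writing \<open>esym k\<close> as a telescoping product of superadditive quotients bounds
  its growth from \<open>x\<close> towards \<open>y\<close>. The right-hand side is the derivative
  at \<open>0\<close> in the direction \<open>y\<close>, hence at least \<open>esym k I x\<close>
  times the sum of the ratios of quotients; the arithmetic-geometric mean inequality for these
  ratios finishes the proof.\<close>

theorem garding_esym:
  assumes fin: "finite I" and k: "k > 0" and x: "x \<in> Gcone k I" and y: "y \<in> Gcone k I"
  shows "real k * (esym k I x powr ((real k - 1) / real k) * esym k I y powr (1 / real k))
    \<le> (\<Sum>i\<in>I. y i * esym (k - 1) (I - {i}) x)"
proof -
  let ?q = "\<lambda>j x. esym (Suc j) I x / esym j I x"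
  have pos: "esym j I x > 0" "esym j I y > 0" if "j \<le> k" for j
    using GconeD[OF x fin that] GconeD[OF y fin that] by auto
  have qpos: "?q j x > 0" "?q j y > 0" if "j < k" for j using pos that by auto
  \<comment> \<open>The value \<open>0\<close> beyond \<open>k\<close> makes \<open>r\<close>
    nonnegative everywhere, as the product estimate asks.\<close>
  define r where "r j = (if j < k then ?q j y / ?q j x else 0)" for j
  have r: "r j \<ge> 0" for j unfolding r_def using qpos[of j] by (cases "j < k") (simp_all only: if_True if_False order.refl divide_nonneg_nonneg less_imp_le)
  define C where "C = esym k I x * (\<Sum>j<k. r j)"
  have lower: "esym k I x + t * C \<le> esym k I (\<lambda>i. x i + t * y i)" if t: "t > 0" for t
  proof -
    let ?z = "\<lambda>i. x i + t * y i"
    have ty: "(\<lambda>i. t * y i) \<in> Gcone k I" using Gcone_scale[OF y t] .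
    have z: "?z \<in> Gcone k I"
      using esym_quotient_superadditive[of I x "k - 1" "\<lambda>i. t * y i"] x ty k fin by simp
    have qz: "?q j x * (1 + t * r j) \<le> ?q j ?z" if "j < k" for j
    proof -
      have m: "w \<in> Gcone k I \<Longrightarrow> w \<in> Gcone (Suc j) I" for w
        using Gcone_mono[of "Suc j" k I] that by fastforce
      have "?q j x + ?q j (\<lambda>i. t * y i) \<le> ?q j ?z"
        using esym_quotient_superadditive[OF fin m[OF x] m[OF ty]] by blast
      moreover have "?q j (\<lambda>i. t * y i) = t * ?q j y"
        using t by (simp add: esym_scale)
      moreover have "?q j x * r j = ?q j y"
      proof -
        have "a * (b / a) = b" if "a > 0" for a b :: real using that by simp
        from this[OF qpos(1)[OF that]] show ?thesis using that by (simp only: r_def if_True)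
      qed
      moreover have "?q j x * (1 + t * r j) = ?q j x + t * (?q j x * r j)"
        by (simp only: distrib_left mult_1_right mult.left_commute)
      ultimately show ?thesis by simp
    qed
    have "esym k I x + t * C = esym k I x * (1 + (\<Sum>j<k. t * r j))"
      by (simp add: C_def sum_distrib_left[symmetric] distrib_left mult.left_commute)
    also have "\<dots> \<le> esym k I x * (\<Prod>j<k. 1 + t * r j)"
      using prod_one_add_ge[of "\<lambda>j. t * r j" k] r t pos(1)[of k] by (intro mult_left_mono) auto
    also have "\<dots> = (\<Prod>j<k. ?q j x * (1 + t * r j))"
      unfolding esym_eq_prod_quotient[OF fin x] prod.distrib ..
    also have "\<dots> \<le> (\<Prod>j<k. ?q j ?z)"
    proof (intro prod_mono conjI)
      fix j assume "j \<in> {..<k}"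
      then have "j < k" by simp
      show "0 \<le> ?q j x * (1 + t * r j)"
        by (intro mult_nonneg_nonneg add_nonneg_nonneg less_imp_le[OF qpos(1)[OF \<open>j < k\<close>]] less_imp_le[OF t] r zero_le_one)
      show "?q j x * (1 + t * r j) \<le> ?q j ?z" by (rule qz) fact
    qed
    also have "\<dots> = esym k I ?z" by (rule esym_eq_prod_quotient[OF fin z, symmetric])
    finally show ?thesis .
  qed
  have der: "((\<lambda>t. (esym k I (\<lambda>i. x i + t * y i) - esym k I x) / t) \<longlongrightarrow> (\<Sum>i\<in>I. y i * esym (k - 1) (I - {i}) x)) (at_right 0)"
    using DERIV_esym_line[OF fin, of "k - 1" x y 0] k
    by (auto simp: DERIV_def intro: tendsto_within_subset)
  have "C \<le> (\<Sum>i\<in>I. y i * esym (k - 1) (I - {i}) x)"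
  proof (rule tendsto_lowerbound[OF der])
    show "\<forall>\<^sub>F t in at_right 0. C \<le> (esym k I (\<lambda>i. x i + t * y i) - esym k I x) / t"
      unfolding eventually_at_right_field
      by (rule exI[of _ 1]) (use lower in \<open>auto simp: field_simps\<close>)
  qed simp
  moreover have "real k * (esym k I x powr ((real k - 1) / real k) * esym k I y powr (1 / real k)) \<le> C"
  proof -
    have "(\<Prod>j<k. r j) = esym k I y / esym k I x"
      by (simp only: r_def prod_dividef[symmetric] esym_eq_prod_quotient[OF fin y] esym_eq_prod_quotient[OF fin x])
        (rule prod.cong, auto)
    moreover have "(\<Prod>j<k. r j) powr (1 / real k) \<le> (\<Sum>j<k. r j / real k)"
      using arith_geom_mean[of "{..<k}" r] k r by auto
    moreover have "(\<Sum>j<k. r j / real k) = (\<Sum>j<k. r j) / real k"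
      by (rule sum_divide_distrib[symmetric])
    ultimately have "(esym k I y / esym k I x) powr (1 / real k) \<le> (\<Sum>j<k. r j) / real k"
      by simp
    then have "real k * (esym k I y / esym k I x) powr (1 / real k) \<le> (\<Sum>j<k. r j)"
      using k by (simp add: pos_le_divide_eq mult.commute)
    then have "esym k I x * (real k * (esym k I y / esym k I x) powr (1 / real k)) \<le> C"
      unfolding C_def using pos(1)[of k] by (intro mult_left_mono) auto
    moreover have "esym k I x * (esym k I y / esym k I x) powr (1 / real k)
      = esym k I x powr ((real k - 1) / real k) * esym k I y powr (1 / real k)"
    proof -
      have e: "(real k - 1) / real k = 1 - 1 / real k" using k by (simp add: diff_divide_distrib)
      show ?thesis unfolding e powr_diff using pos[of k] by (simp add: powr_divide)
    qed
    ultimately show ?thesis by (simp add: algebra_simps)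
  qed
  ultimately show ?thesis by linarith
qed

section \<open>Newton tensors\<close>

text \<open>The recursion T_0 = 1, T_(m+1) = sigma_(m+1) 1 - T_m M with sigma_(m+1) = tr(T_m M) /
  (m+1). The trace replaces eigenvalues, so all entries are polynomials in those of \<open>M\<close>
  and inherit its smoothness.\<close>

primrec newton_tensor :: "'i set \<Rightarrow> ('i \<Rightarrow> 'i \<Rightarrow> real) \<Rightarrow> nat \<Rightarrow> 'i \<Rightarrow> 'i \<Rightarrow> real" where
  "newton_tensor I M 0 = (\<lambda>i j. if i = j then 1 else 0)"
| "newton_tensor I M (Suc m) = (\<lambda>i j.
     (if i = j then (\<Sum>a\<in>I. \<Sum>l\<in>I. newton_tensor I M m a l * M l a) / real (Suc m) else 0)
     - (\<Sum>l\<in>I. newton_tensor I M m i l * M l j))"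

fun esigma :: "'i set \<Rightarrow> ('i \<Rightarrow> 'i \<Rightarrow> real) \<Rightarrow> nat \<Rightarrow> real" where
  "esigma I M 0 = 1"
| "esigma I M (Suc m) = (\<Sum>a\<in>I. \<Sum>l\<in>I. newton_tensor I M m a l * M l a) / real (Suc m)"

lemma newton_tensor_Suc:
  "newton_tensor I M (Suc m) i j =
     (if i = j then esigma I M (Suc m) else 0) - (\<Sum>l\<in>I. newton_tensor I M m i l * M l j)"
  by simp

declare newton_tensor.simps(2) [simp del] esigma.simps(2) [simp del]

section \<open>Newton tensors in an eigenframe\<close>

definition orthonormal_frame :: "'i set \<Rightarrow> ('i \<Rightarrow> 'i \<Rightarrow> real) \<Rightarrow> bool" where
  "orthonormal_frame I q \<longleftrightarrow>
     (\<forall>b\<in>I. \<forall>c\<in>I. (\<Sum>i\<in>I. q b i * q c i) = (if b = c then 1 else 0)) \<and>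
     (\<forall>i\<in>I. \<forall>j\<in>I. (\<Sum>b\<in>I. q b i * q b j) = (if i = j then 1 else 0))"

definition diagonalized ::
    "'i set \<Rightarrow> ('i \<Rightarrow> 'i \<Rightarrow> real) \<Rightarrow> ('i \<Rightarrow> real) \<Rightarrow> ('i \<Rightarrow> 'i \<Rightarrow> real) \<Rightarrow> bool" where
  "diagonalized I q \<mu> M \<longleftrightarrow> (\<forall>i\<in>I. \<forall>j\<in>I. M i j = (\<Sum>b\<in>I. \<mu> b * (q b i * q b j)))"

definition quad :: "'i set \<Rightarrow> ('i \<Rightarrow> 'i \<Rightarrow> real) \<Rightarrow> ('i \<Rightarrow> real) \<Rightarrow> real" where
  "quad I N v = (\<Sum>i\<in>I. \<Sum>j\<in>I. v i * N i j * v j)"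

lemma diagonalized_sym: "diagonalized I q \<mu> M \<Longrightarrow> i \<in> I \<Longrightarrow> j \<in> I \<Longrightarrow> M i j = M j i"
  by (auto simp: diagonalized_def mult.commute[of "q _ i"])

lemma diagonalized_eigen:
  assumes "finite I" "orthonormal_frame I q" "diagonalized I q \<mu> M" "b \<in> I" "i \<in> I"
  shows "(\<Sum>j\<in>I. M i j * q b j) = \<mu> b * q b i" "(\<Sum>j\<in>I. q b j * M j i) = \<mu> b * q b i"
proof -
  have "(\<Sum>j\<in>I. M i j * q b j) = (\<Sum>j\<in>I. \<Sum>c\<in>I. \<mu> c * q c i * (q c j * q b j))"
    using assms by (intro sum.cong refl) (auto simp: diagonalized_def sum_distrib_right sum_distrib_left algebra_simps)
  also have "\<dots> = (\<Sum>c\<in>I. \<mu> c * q c i * (\<Sum>j\<in>I. q c j * q b j))"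
    by (subst sum.swap) (simp add: sum_distrib_left)
  also have "\<dots> = (\<Sum>c\<in>I. if c = b then \<mu> c * q c i else 0)"
    using assms by (intro sum.cong refl) (auto simp: orthonormal_frame_def)
  also have "\<dots> = \<mu> b * q b i" using assms by simp
  finally show *: "(\<Sum>j\<in>I. M i j * q b j) = \<mu> b * q b i" .
  have "(\<Sum>j\<in>I. q b j * M j i) = (\<Sum>j\<in>I. M i j * q b j)"
    by (intro sum.cong refl) (simp add: diagonalized_sym[OF assms(3) _ assms(5)] mult.commute)
  then show "(\<Sum>j\<in>I. q b j * M j i) = \<mu> b * q b i" using * by simp
qed

lemma diagonalized_mult:
  assumes fin: "finite I" and q: "orthonormal_frame I q"
    and T: "diagonalized I q \<tau> T" and M: "diagonalized I q \<mu> M"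
  shows "diagonalized I q (\<lambda>b. \<tau> b * \<mu> b) (\<lambda>i j. \<Sum>l\<in>I. T i l * M l j)"
  unfolding diagonalized_def
proof (intro ballI)
  fix i j assume ij: "i \<in> I" "j \<in> I"
  have "(\<Sum>l\<in>I. T i l * M l j) = (\<Sum>l\<in>I. \<Sum>b\<in>I. \<mu> b * q b j * (T i l * q b l))"
    using M ij by (intro sum.cong refl) (auto simp: diagonalized_def sum_distrib_left algebra_simps)
  also have "\<dots> = (\<Sum>b\<in>I. \<mu> b * q b j * (\<Sum>l\<in>I. T i l * q b l))"
    by (subst sum.swap) (simp add: sum_distrib_left)
  also have "\<dots> = (\<Sum>b\<in>I. \<tau> b * \<mu> b * (q b i * q b j))"
    using diagonalized_eigen(1)[OF fin q T _ ij(1)] by (intro sum.cong refl) (simp add: algebra_simps)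
  finally show "(\<Sum>l\<in>I. T i l * M l j) = (\<Sum>b\<in>I. \<tau> b * \<mu> b * (q b i * q b j))" .
qed

lemma diagonalized_trace:
  assumes "diagonalized I q \<tau> T"
  shows "(\<Sum>a\<in>I. \<Sum>l\<in>I. T a l * N l a) = (\<Sum>b\<in>I. \<tau> b * quad I N (q b))"
proof -
  have "(\<Sum>a\<in>I. \<Sum>l\<in>I. T a l * N l a) = (\<Sum>a\<in>I. \<Sum>l\<in>I. \<Sum>b\<in>I. \<tau> b * (q b l * N l a * q b a))"
    using assms by (intro sum.cong refl) (auto simp: diagonalized_def sum_distrib_left algebra_simps)
  also have "\<dots> = (\<Sum>a\<in>I. \<Sum>b\<in>I. \<Sum>l\<in>I. \<tau> b * (q b l * N l a * q b a))"
    by (rule sum.cong[OF refl], rule sum.swap)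
  also have "\<dots> = (\<Sum>b\<in>I. \<Sum>a\<in>I. \<Sum>l\<in>I. \<tau> b * (q b l * N l a * q b a))" by (rule sum.swap)
  also have "\<dots> = (\<Sum>b\<in>I. \<Sum>l\<in>I. \<Sum>a\<in>I. \<tau> b * (q b l * N l a * q b a))"
    by (rule sum.cong[OF refl], rule sum.swap)
  finally show ?thesis by (simp add: quad_def sum_distrib_left)
qed

lemma quad_diagonalized:
  assumes "finite I" "orthonormal_frame I q" "diagonalized I q \<mu> M" "b \<in> I"
  shows "quad I M (q b) = \<mu> b"
proof -
  have "quad I M (q b) = (\<Sum>i\<in>I. q b i * (\<Sum>j\<in>I. M i j * q b j))"
    by (simp add: quad_def sum_distrib_left algebra_simps)
  also have "\<dots> = (\<Sum>i\<in>I. \<mu> b * (q b i * q b i))"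
    using diagonalized_eigen(1)[OF assms] by (intro sum.cong refl) simp
  also have "\<dots> = \<mu> b" using assms by (simp add: sum_distrib_left[symmetric] orthonormal_frame_def)
  finally show ?thesis .
qed

text \<open>On the eigenvector \<open>b\<close> the recursion reads
  \<open>esym (Suc m) I \<mu> - \<mu> b * esym m (I - {b}) \<mu>\<close>, which deletes the variable
  \<open>b\<close>. Euler's identity evaluates the trace and explains the division by
  \<open>Suc m\<close> in its definition.\<close>

lemma newton_tensor_diagonalized:
  assumes fin: "finite I" and q: "orthonormal_frame I q" and M: "diagonalized I q \<mu> M"
  shows "diagonalized I q (\<lambda>b. esym m (I - {b}) \<mu>) (newton_tensor I M m)" (is "?D m")
    and "esigma I M m = esym m I \<mu>"
proof -
  have sig: "esigma I M (Suc m) = esym (Suc m) I \<mu>" if "?D m" for m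
    using diagonalized_trace[OF that, of M] sum_mult_esym_remove[OF fin, of \<mu> m]
    by (simp add: esigma.simps quad_diagonalized[OF fin q M] mult.commute)
  show D: "?D m" for m
  proof (induction m)
    case 0
    then show ?case using fin q by (auto simp: diagonalized_def orthonormal_frame_def)
  next
    case (Suc m)
    show ?case unfolding diagonalized_def
    proof (intro ballI)
      fix i j assume ij: "i \<in> I" "j \<in> I"
      have "newton_tensor I M (Suc m) i j = esym (Suc m) I \<mu> * (\<Sum>b\<in>I. q b i * q b j)
          - (\<Sum>b\<in>I. esym m (I - {b}) \<mu> * \<mu> b * (q b i * q b j))"
        unfolding newton_tensor_Suc sig[OF Suc]
        using diagonalized_mult[OF fin q Suc M] ij q
        by (auto simp: diagonalized_def orthonormal_frame_def)
      also have "\<dots> = (\<Sum>b\<in>I. (esym (Suc m) I \<mu> - \<mu> b * esym m (I - {b}) \<mu>) * (q b i * q b j))"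
        by (simp add: sum_distrib_left sum_subtractf algebra_simps)
      also have "\<dots> = (\<Sum>b\<in>I. esym (Suc m) (I - {b}) \<mu> * (q b i * q b j))"
        by (intro sum.cong refl) (use esym_remove[OF fin, of _ m \<mu>] in simp)
      finally show "newton_tensor I M (Suc m) i j = \<dots>" .
    qed
  qed
  show "esigma I M m = esym m I \<mu>" using sig[OF D] fin by (cases m) auto
qed

lemma newton_tensor_sym:
  assumes "finite I" "orthonormal_frame I q" "diagonalized I q \<mu> M" "i \<in> I" "j \<in> I"
  shows "newton_tensor I M m i j = newton_tensor I M m j i"
  using diagonalized_sym[OF newton_tensor_diagonalized(1)[OF assms(1-3)] assms(4,5)] .

section \<open>Derivatives and divergence of Newton tensors\<close>

lemma sum_remove_swap:
  fixes F :: "'i \<Rightarrow> 'i \<Rightarrow> real"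
  assumes "finite I"
  shows "(\<Sum>b\<in>I. \<Sum>c\<in>I - {b}. F b c) = (\<Sum>c\<in>I. \<Sum>b\<in>I - {c}. F b c)"
proof -
  have "(\<Sum>b\<in>I. \<Sum>c\<in>I - {b}. F b c) = (\<Sum>b\<in>I. (\<Sum>c\<in>I. F b c) - F b b)"
    using assms by (intro sum.cong refl) (simp add: sum_diff1)
  also have "\<dots> = (\<Sum>c\<in>I. (\<Sum>b\<in>I. F b c) - F c c)"
    unfolding sum_subtractf by (subst sum.swap) simp
  also have "\<dots> = (\<Sum>c\<in>I. \<Sum>b\<in>I - {c}. F b c)"
    using assms by (intro sum.cong refl) (simp add: sum_diff1)
  finally show ?thesis .
qed

text \<open>The recursion for the derivative of the Newton tensor does not close up, but its diagonal part
  in a frame diagonalizing \<open>M t\<close> does, and only that part enters the derivative of \<open>esigma\<close>.\<close>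

lemma DERIV_newton_tensor_aux:
  fixes M :: "real \<Rightarrow> 'i \<Rightarrow> 'i \<Rightarrow> real"
  assumes fin: "finite I" and q: "orthonormal_frame I q" and M: "diagonalized I q \<mu> (M t)"
    and M': "\<And>i j. i \<in> I \<Longrightarrow> j \<in> I \<Longrightarrow> ((\<lambda>s. M s i j) has_real_derivative M' i j) (at t)"
  shows "\<exists>D. (\<forall>i\<in>I. \<forall>j\<in>I. ((\<lambda>s. newton_tensor I (M s) m i j) has_real_derivative D i j) (at t)) \<and>
     (\<forall>b\<in>I. quad I D (q b) = (\<Sum>c\<in>I - {b}.
        (case m of 0 \<Rightarrow> 0 | Suc n \<Rightarrow> esym n (I - {b} - {c}) \<mu>) * quad I M' (q c)))"
    and "((\<lambda>s. esigma I (M s) (Suc m)) has_real_derivative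
           (\<Sum>c\<in>I. esym m (I - {c}) \<mu> * quad I M' (q c))) (at t)"
proof -
  \<comment> \<open>The partial derivative of the diagonal entry
    \<open>esym m (I - {b}) \<mu>\<close> in \<open>\<mu> c\<close>; it is \<open>0\<close> for the
    constant tensor of order \<open>0\<close>.\<close>
  let ?E = "\<lambda>m b c. case m of 0 \<Rightarrow> 0 | Suc n \<Rightarrow> esym n (I - {b} - {c}) \<mu>"
  let ?P = "\<lambda>m D. (\<forall>i\<in>I. \<forall>j\<in>I. ((\<lambda>s. newton_tensor I (M s) m i j) has_real_derivative D i j) (at t)) \<and>
     (\<forall>b\<in>I. quad I D (q b) = (\<Sum>c\<in>I - {b}. ?E m b c * quad I M' (q c)))"
  let ?S = "\<lambda>m. \<Sum>c\<in>I. esym m (I - {c}) \<mu> * quad I M' (q c)"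
  let ?N = "newton_tensor I (M t)"
  note ND = newton_tensor_diagonalized[OF fin q M]
  have sig: "((\<lambda>s. esigma I (M s) (Suc m)) has_real_derivative ?S m) (at t)" if D: "?P m D" for m D
  proof -
    have "((\<lambda>s. esigma I (M s) (Suc m)) has_real_derivative
        (\<Sum>a\<in>I. \<Sum>l\<in>I. D a l * M t l a + M' l a * ?N m a l) / real (Suc m)) (at t)"
      unfolding esigma.simps
      by (intro DERIV_cdivide DERIV_sum DERIV_mult) (use D M' in auto)
    \<comment> \<open>Differentiating the tensor contributes \<open>m\<close> copies of
      \<open>?S m\<close>, differentiating the matrix contributes one more; together they cancel the
      division by \<open>Suc m\<close>.\<close>
    moreover have "(\<Sum>a\<in>I. \<Sum>l\<in>I. D a l * M t l a + M' l a * ?N m a l) = real (Suc m) * ?S m"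
    proof -
      have "(\<Sum>a\<in>I. \<Sum>l\<in>I. D a l * M t l a) = (\<Sum>l\<in>I. \<Sum>a\<in>I. M t l a * D a l)"
        by (subst sum.swap) (simp add: mult.commute)
      also have "\<dots> = (\<Sum>b\<in>I. \<mu> b * (\<Sum>c\<in>I - {b}. ?E m b c * quad I M' (q c)))"
        unfolding diagonalized_trace[OF M] using D by (intro sum.cong refl) auto
      also have "\<dots> = (\<Sum>c\<in>I. \<Sum>b\<in>I - {c}. \<mu> b * ?E m b c * quad I M' (q c))"
        unfolding sum_distrib_left mult.assoc[symmetric] by (rule sum_remove_swap[OF fin])
      also have "\<dots> = (\<Sum>c\<in>I. real m * esym m (I - {c}) \<mu> * quad I M' (q c))"
      proof (intro sum.cong refl)
        fix c assume "c \<in> I"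
        have "(\<Sum>b\<in>I - {c}. \<mu> b * ?E m b c) = real m * esym m (I - {c}) \<mu>"
        proof (cases m)
          case (Suc n)
          have "I - {b} - {c} = I - {c} - {b}" for b by auto
          then show ?thesis using sum_mult_esym_remove[of "I - {c}" \<mu> n] fin by (simp add: Suc)
        qed simp
        then show "(\<Sum>b\<in>I - {c}. \<mu> b * ?E m b c * quad I M' (q c)) = real m * esym m (I - {c}) \<mu> * quad I M' (q c)"
          by (simp add: sum_distrib_right[symmetric])
      qed
      finally have 1: "(\<Sum>a\<in>I. \<Sum>l\<in>I. D a l * M t l a) = real m * ?S m"
        by (simp add: sum_distrib_left mult.assoc)
      have 2: "(\<Sum>a\<in>I. \<Sum>l\<in>I. M' l a * ?N m a l) = ?S m"
        using diagonalized_trace[OF ND(1), of m M'] by (simp add: mult.commute)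
      show ?thesis unfolding sum.distrib 1 2 by (simp add: algebra_simps)
    qed
    ultimately show ?thesis by simp
  qed
  have ex: "\<exists>D. ?P m D" for m
  proof (induction m)
    case 0
    show ?case by (rule exI[of _ "\<lambda>i j. 0"]) (auto simp: quad_def)
  next
    case (Suc m)
    then obtain D where D: "?P m D" by blast
    define D' where "D' i j = (if i = j then ?S m else 0) - (\<Sum>l\<in>I. D i l * M t l j + M' l j * ?N m i l)" for i j
    have "((\<lambda>s. newton_tensor I (M s) (Suc m) i j) has_real_derivative D' i j) (at t)" if "i \<in> I" "j \<in> I" for i j
      unfolding newton_tensor_Suc D'_def
      by (intro DERIV_diff DERIV_sum DERIV_mult) (use D M' that sig[OF D] in auto)
    moreover have "quad I D' (q b) = (\<Sum>c\<in>I - {b}. ?E (Suc m) b c * quad I M' (q c))" if b: "b \<in> I" for b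
    proof -
      have "quad I D' (q b) = (\<Sum>i\<in>I. \<Sum>j\<in>I. q b i * (if i = j then ?S m else 0) * q b j)
         - (\<Sum>i\<in>I. \<Sum>j\<in>I. \<Sum>l\<in>I. q b i * D i l * (M t l j * q b j))
         - (\<Sum>i\<in>I. \<Sum>j\<in>I. \<Sum>l\<in>I. M' l j * q b j * (q b i * ?N m i l))"
        unfolding quad_def D'_def sum.distrib
        by (simp add: sum_subtractf[symmetric] sum_distrib_left sum_distrib_right algebra_simps sum.distrib)
      moreover have "(\<Sum>i\<in>I. \<Sum>j\<in>I. q b i * (if i = j then ?S m else 0) * q b j) = ?S m"
      proof -
        have "(\<Sum>i\<in>I. \<Sum>j\<in>I. q b i * (if i = j then ?S m else 0) * q b j) = (\<Sum>i\<in>I. ?S m * (q b i * q b i))"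
        proof (intro sum.cong refl)
          fix i assume i: "i \<in> I"
          have "(\<Sum>j\<in>I. q b i * (if i = j then ?S m else 0) * q b j) = (\<Sum>j\<in>I. if i = j then ?S m * (q b i * q b j) else 0)"
            by (intro sum.cong refl) (simp add: algebra_simps)
          then show "(\<Sum>j\<in>I. q b i * (if i = j then ?S m else 0) * q b j) = ?S m * (q b i * q b i)"
            using fin i by simp
        qed
        also have "\<dots> = ?S m * (\<Sum>i\<in>I. q b i * q b i)" by (rule sum_distrib_left[symmetric])
        finally show ?thesis using q b by (simp add: orthonormal_frame_def)
      qed
      moreover have "(\<Sum>i\<in>I. \<Sum>j\<in>I. \<Sum>l\<in>I. q b i * D i l * (M t l j * q b j)) = \<mu> b * quad I D (q b)"
      proof -
        have "(\<Sum>i\<in>I. \<Sum>j\<in>I. \<Sum>l\<in>I. q b i * D i l * (M t l j * q b j))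
           = (\<Sum>i\<in>I. \<Sum>l\<in>I. q b i * D i l * (\<Sum>j\<in>I. M t l j * q b j))"
          unfolding sum_distrib_left by (rule sum.cong[OF refl], rule sum.swap)
        also have "\<dots> = (\<Sum>i\<in>I. \<Sum>l\<in>I. q b i * D i l * (\<mu> b * q b l))"
          using diagonalized_eigen(1)[OF fin q M b] by simp
        finally show ?thesis by (simp add: quad_def sum_distrib_left mult_ac)
      qed
      moreover have "(\<Sum>i\<in>I. \<Sum>j\<in>I. \<Sum>l\<in>I. M' l j * q b j * (q b i * ?N m i l)) = esym m (I - {b}) \<mu> * quad I M' (q b)"
      proof -
        have "(\<Sum>i\<in>I. \<Sum>j\<in>I. \<Sum>l\<in>I. M' l j * q b j * (q b i * ?N m i l))
           = (\<Sum>j\<in>I. \<Sum>l\<in>I. M' l j * q b j * (\<Sum>i\<in>I. q b i * ?N m i l))"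
          unfolding sum_distrib_left by (subst sum.swap) (rule sum.cong[OF refl], rule sum.swap)
        also have "\<dots> = (\<Sum>l\<in>I. \<Sum>j\<in>I. M' l j * q b j * (\<Sum>i\<in>I. q b i * ?N m i l))" by (rule sum.swap)
        also have "\<dots> = (\<Sum>l\<in>I. \<Sum>j\<in>I. M' l j * q b j * (esym m (I - {b}) \<mu> * q b l))"
          using diagonalized_eigen(2)[OF fin q ND(1) b] by simp
        finally show ?thesis by (simp add: quad_def sum_distrib_left mult_ac)
      qed
      moreover have "?S m = esym m (I - {b}) \<mu> * quad I M' (q b) + (\<Sum>c\<in>I - {b}. esym m (I - {c}) \<mu> * quad I M' (q c))"
        using fin b by (rule sum.remove)
      moreover have "\<mu> b * quad I D (q b) = (\<Sum>c\<in>I - {b}. \<mu> b * ?E m b c * quad I M' (q c))"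
        using D b by (simp add: sum_distrib_left mult.assoc)
      moreover have "esym m (I - {c}) \<mu> * quad I M' (q c) - \<mu> b * ?E m b c * quad I M' (q c)
         = ?E (Suc m) b c * quad I M' (q c)" if c: "c \<in> I - {b}" for c
      proof (cases m)
        case 0
        then show ?thesis using fin by simp
      next
        case (Suc n)
        have "I - {b} - {c} = I - {c} - {b}" by auto
        moreover have "esym (Suc n) (I - {c}) \<mu> = esym (Suc n) (I - {c} - {b}) \<mu> + \<mu> b * esym n (I - {c} - {b}) \<mu>"
          using esym_remove[of "I - {c}" b n \<mu>] fin b c by blast
        ultimately show ?thesis by (simp add: Suc ring_distribs)
      qed
      ultimately show ?thesis by (simp add: sum_subtractf[symmetric])
    qed
    ultimately show ?case by blast
  qed
  show "\<exists>D. ?P m D" by (rule ex)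
  show "((\<lambda>s. esigma I (M s) (Suc m)) has_real_derivative ?S m) (at t)"
    using ex sig by blast
qed

text \<open>The Newton tensor is the gradient of the symmetric function of the next order. A
  diagonalization is asked for at the parameter \<open>t\<close> only, so eigenvectors need not
  depend differentiably on the parameter.\<close>

lemma DERIV_esigma:
  fixes M :: "real \<Rightarrow> 'i \<Rightarrow> 'i \<Rightarrow> real"
  assumes fin: "finite I" and q: "orthonormal_frame I q" and M: "diagonalized I q \<mu> (M t)"
    and M': "\<And>i j. i \<in> I \<Longrightarrow> j \<in> I \<Longrightarrow> ((\<lambda>s. M s i j) has_real_derivative M' i j) (at t)"
  shows "((\<lambda>s. esigma I (M s) (Suc m)) has_real_derivative
           (\<Sum>a\<in>I. \<Sum>l\<in>I. newton_tensor I (M t) m a l * M' l a)) (at t)"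
  unfolding diagonalized_trace[OF newton_tensor_diagonalized(1)[OF fin q M]]
  by (rule DERIV_newton_tensor_aux(2)[where M = M, OF assms])

text \<open>If \<open>M\<close> is the Hessian of a function, \<open>D e\<close> its derivative in the \<open>e\<close>-th coordinate direction,
  then \<open>D\<close> is totally symmetric, and the conclusion says that the Newton tensor of \<open>M\<close> is
  divergence free.\<close>

lemma newton_tensor_divergence_free:
  fixes M :: "'i \<Rightarrow> real \<Rightarrow> 'i \<Rightarrow> 'i \<Rightarrow> real"
  assumes fin: "finite I" and q: "orthonormal_frame I q" and M: "diagonalized I q \<mu> M0"
    and M0: "\<And>e. e \<in> I \<Longrightarrow> M e 0 = M0"
    and D: "\<And>e i j. e \<in> I \<Longrightarrow> i \<in> I \<Longrightarrow> j \<in> I \<Longrightarrow> ((\<lambda>s. M e s i j) has_real_derivative D e i j) (at 0)"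
    and sym: "\<And>e i j. e \<in> I \<Longrightarrow> i \<in> I \<Longrightarrow> j \<in> I \<Longrightarrow> D e i j = D j i e"
  shows "\<exists>DT. (\<forall>e\<in>I. \<forall>i\<in>I. \<forall>j\<in>I.
      ((\<lambda>s. newton_tensor I (M e s) m i j) has_real_derivative DT e i j) (at 0)) \<and>
      (\<forall>j\<in>I. (\<Sum>e\<in>I. DT e e j) = 0)"
proof (induction m)
  case 0
  show ?case by (rule exI[of _ "\<lambda>e i j. 0"]) auto
next
  case (Suc m)
  let ?N = "newton_tensor I M0 m"
  obtain DT where DT: "\<And>e i j. e \<in> I \<Longrightarrow> i \<in> I \<Longrightarrow> j \<in> I \<Longrightarrow>
      ((\<lambda>s. newton_tensor I (M e s) m i j) has_real_derivative DT e i j) (at 0)"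
    and div: "\<And>j. j \<in> I \<Longrightarrow> (\<Sum>e\<in>I. DT e e j) = 0" using Suc by blast
  define S where "S e = (\<Sum>a\<in>I. \<Sum>l\<in>I. ?N a l * D e l a)" for e
  have S: "((\<lambda>s. esigma I (M e s) (Suc m)) has_real_derivative S e) (at 0)" if "e \<in> I" for e
  proof -
    have "diagonalized I q \<mu> (M e 0)" using M M0[OF that] by simp
    from DERIV_esigma[OF fin q this D[OF that], of m] show ?thesis
      using M0[OF that] by (simp add: S_def)
  qed
  define DT' where "DT' e i j = (if i = j then S e else 0) - (\<Sum>l\<in>I. DT e i l * M0 l j + D e l j * ?N i l)" for e i j
  have "((\<lambda>s. newton_tensor I (M e s) (Suc m) i j) has_real_derivative DT' e i j) (at 0)"
    if e: "e \<in> I" and ij: "i \<in> I" "j \<in> I" for e i j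
    unfolding newton_tensor_Suc DT'_def M0[OF e, symmetric]
    by (intro DERIV_diff DERIV_sum DERIV_mult) (use DT D e ij S in auto)
  moreover have "(\<Sum>e\<in>I. DT' e e j) = 0" if j: "j \<in> I" for j
  proof -
    have "(\<Sum>e\<in>I. \<Sum>l\<in>I. DT e e l * M0 l j) = (\<Sum>l\<in>I. (\<Sum>e\<in>I. DT e e l) * M0 l j)"
      unfolding sum_distrib_right by (rule sum.swap)
    also have "\<dots> = 0" using div by simp
    finally have 1: "(\<Sum>e\<in>I. \<Sum>l\<in>I. DT e e l * M0 l j) = 0" .
    \<comment> \<open>Total symmetry moves the free index into the position of differentiation. The
      sum becomes the derivative of \<open>esigma\<close>, which cancels against the one from the
      diagonal term.\<close>
    have 2: "(\<Sum>e\<in>I. \<Sum>l\<in>I. D e l j * ?N e l) = S j"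
      unfolding S_def using sym[OF _ _ j] by (intro sum.cong refl) (simp add: mult.commute)
    have 3: "(\<Sum>e\<in>I. if e = j then S e else 0) = S j" using fin j by simp
    show ?thesis unfolding DT'_def sum_subtractf sum.distrib 1 2 3 by simp
  qed
  ultimately show ?case by blast
qed

lemma newton_tensor_scale:
  "newton_tensor I (\<lambda>i j. c * M i j) m i j = c ^ m * newton_tensor I M m i j"
proof (induction m arbitrary: i j)
  case (Suc m)
  then show ?case
    by (simp add: newton_tensor.simps(2) sum_distrib_left right_diff_distrib mult_ac)
qed simp

text \<open>Every term of the recursion ending in a factor \<open>M\<close> dies on
  \<open>x\<close>, so only the multiple of the identity survives. For Hessians of homogeneous
  extensions \<open>x\<close> is the radial direction.\<close>

lemma newton_tensor_kernel:
  assumes "finite I" "\<And>j. j \<in> I \<Longrightarrow> (\<Sum>i\<in>I. x i * M i j) = 0" "j \<in> I"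
  shows "(\<Sum>i\<in>I. x i * newton_tensor I M m i j) = esigma I M m * x j"
proof -
  have delta: "(\<Sum>i\<in>I. x i * (if i = j then c else 0)) = c * x j" if "j \<in> I" for c j
  proof -
    have "(\<Sum>i\<in>I. x i * (if i = j then c else 0)) = (\<Sum>i\<in>I. if i = j then c * x i else 0)"
      by (intro sum.cong refl) simp
    then show ?thesis using that assms(1) by simp
  qed
  show ?thesis using assms(3)
  proof (induction m arbitrary: j)
    case 0
    then show ?case using delta[OF 0, of 1] by simp
  next
    case (Suc m)
    have "(\<Sum>i\<in>I. x i * (\<Sum>l\<in>I. newton_tensor I M m i l * M l j))
       = (\<Sum>l\<in>I. (\<Sum>i\<in>I. x i * newton_tensor I M m i l) * M l j)"
      unfolding sum_distrib_left sum_distrib_right mult.assoc by (rule sum.swap)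
    also have "\<dots> = (\<Sum>l\<in>I. esigma I M m * (x l * M l j))"
      using Suc.IH by (intro sum.cong refl) simp
    also have "\<dots> = 0" using assms(2)[OF Suc.prems] by (simp add: sum_distrib_left[symmetric])
    finally show ?case
      unfolding newton_tensor_Suc right_diff_distrib sum_subtractf using delta[OF Suc.prems] by simp
  qed
qed

section \<open>Garding's inequality for symmetric matrices\<close>

lemma blinfun_on_Basis:
  fixes f :: "'a::euclidean_space \<Rightarrow> 'b::real_normed_vector"
  shows "\<exists>A :: 'a \<Rightarrow>\<^sub>L 'b. \<forall>b\<in>Basis. blinfun_apply A b = f b"
proof -
  let ?L = "\<lambda>v. \<Sum>b\<in>Basis. (v \<bullet> b) *\<^sub>R f b"
  have "linear ?L"
    by (intro linearI) (simp_all add: inner_add_left scaleR_add_left sum.distrib scaleR_sum_right)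
  then have bl: "bounded_linear ?L" by (rule linear_conv_bounded_linear[THEN iffD1])
  have "blinfun_apply (Blinfun ?L) b = f b" if b: "b \<in> Basis" for b
  proof -
    have "?L b = (\<Sum>c\<in>Basis. if c = b then f c else 0)"
      using b by (intro sum.cong refl) (simp add: inner_Basis)
    then show ?thesis using b bl by (simp add: bounded_linear_Blinfun_apply)
  qed
  then show ?thesis by blast
qed

lemma blinfun_preserves_inner:
  fixes A :: "'a::euclidean_space \<Rightarrow>\<^sub>L 'a"
  assumes "\<forall>b\<in>Basis. \<forall>c\<in>Basis. blinfun_apply A b \<bullet> blinfun_apply A c = b \<bullet> c"
  shows "blinfun_apply A v \<bullet> blinfun_apply A w = v \<bullet> w"
proof -
  have e: "blinfun_apply A v = (\<Sum>b\<in>Basis. (v \<bullet> b) *\<^sub>R blinfun_apply A b)" for v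
    by (subst euclidean_representation[of v, symmetric])
       (simp only: blinfun.sum_right blinfun.scaleR_right)
  have "blinfun_apply A v \<bullet> blinfun_apply A w
     = (\<Sum>b\<in>Basis. \<Sum>c\<in>Basis. (v \<bullet> b) * ((w \<bullet> c) * (blinfun_apply A b \<bullet> blinfun_apply A c)))"
    unfolding e[of v] e[of w] inner_sum_left by (simp add: inner_sum_right mult.left_commute)
  also have "\<dots> = (\<Sum>b\<in>Basis. \<Sum>c\<in>Basis. (v \<bullet> b) * ((w \<bullet> c) * (b \<bullet> c)))"
    using assms by (intro sum.cong refl) simp
  also have "\<dots> = (\<Sum>b\<in>Basis. (v \<bullet> b) *\<^sub>R b) \<bullet> (\<Sum>c\<in>Basis. (w \<bullet> c) *\<^sub>R c)"
    unfolding inner_sum_left by (simp add: inner_sum_right mult.left_commute)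
  finally show ?thesis by (simp add: euclidean_representation)
qed

text \<open>The orthogonal group, taken inside the finite-dimensional normed space of linear maps so
  that its compactness is closedness plus boundedness.\<close>

definition isometries :: "('a::euclidean_space \<Rightarrow>\<^sub>L 'a) set" where
  "isometries = {A. \<forall>b\<in>Basis. \<forall>c\<in>Basis. blinfun_apply A b \<bullet> blinfun_apply A c = b \<bullet> c}"

lemma compact_isometries: "compact (isometries :: ('a::euclidean_space \<Rightarrow>\<^sub>L 'a) set)"
  unfolding compact_eq_bounded_closed
proof
  show "bounded (isometries :: ('a \<Rightarrow>\<^sub>L 'a) set)"
    unfolding bounded_iff
  proof (intro exI[of _ 1] ballI)
    fix A :: "'a \<Rightarrow>\<^sub>L 'a" assume "A \<in> isometries"
    then have "norm (blinfun_apply A v) = norm v" for v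
      using blinfun_preserves_inner[of A v v] by (simp add: isometries_def norm_eq_sqrt_inner)
    then show "norm A \<le> 1" by (intro norm_blinfun_bound) auto
  qed
  have eq: "isometries = (\<Inter>b\<in>Basis. \<Inter>c\<in>Basis. {A :: 'a \<Rightarrow>\<^sub>L 'a. blinfun_apply A b \<bullet> blinfun_apply A c = b \<bullet> c})"
    by (auto simp: isometries_def)
  show "closed (isometries :: ('a \<Rightarrow>\<^sub>L 'a) set)"
    unfolding eq by (intro closed_INT ballI closed_Collect_eq continuous_intros)
qed

lemma sum_update_two:
  fixes g g' :: "'i \<Rightarrow> real"
  assumes "finite I" "i \<in> I" "j \<in> I" "i \<noteq> j" "\<And>b. b \<in> I \<Longrightarrow> b \<noteq> i \<Longrightarrow> b \<noteq> j \<Longrightarrow> g' b = g b"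
  shows "sum g' I = sum g I + (g' i - g i) + (g' j - g j)"
proof -
  have *: "sum h I = h i + h j + sum h (I - {i} - {j})" for h :: "'i \<Rightarrow> real"
    using sum.remove[of I i h] sum.remove[of "I - {i}" j h] assms(1-4) by simp
  have "sum g' (I - {i} - {j}) = sum g (I - {i} - {j})" using assms by (intro sum.cong) auto
  then show ?thesis unfolding *[of g'] *[of g] by simp
qed

text \<open>Minimizing \<open>\<Sum>b. c b * B (r b) (r b)\<close> over all orthonormal frames kills \<open>B (r i) (r j)\<close> whenever
  \<open>c i \<noteq> c j\<close>; among the minimizers, one maximizing \<open>\<Sum>b. (B (r b) (r b))\<^sup>2\<close> kills the other
  off-diagonal entries as well (Jacobi rotations).\<close>

lemma minimizing_eigenframe:
  fixes B :: "'a::euclidean_space \<Rightarrow> 'a \<Rightarrow> real" and c :: "'a \<Rightarrow> real"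
  assumes B: "bounded_bilinear B" and sym: "\<And>v w. B v w = B w v"
    and q: "\<And>b d. b \<in> Basis \<Longrightarrow> d \<in> Basis \<Longrightarrow> q b \<bullet> q d = b \<bullet> d"
  obtains r where "\<And>b d. b \<in> Basis \<Longrightarrow> d \<in> Basis \<Longrightarrow> r b \<bullet> r d = b \<bullet> d"
    "\<And>b d. b \<in> Basis \<Longrightarrow> d \<in> Basis \<Longrightarrow> b \<noteq> d \<Longrightarrow> B (r b) (r d) = 0"
    "(\<Sum>b\<in>Basis. c b * B (r b) (r b)) \<le> (\<Sum>b\<in>Basis. c b * B (q b) (q b))"
proof -
  interpret B: bounded_bilinear B by (rule B)
  define F where "F A = (\<Sum>b\<in>Basis. c b * B (blinfun_apply A b) (blinfun_apply A b))" for A :: "'a \<Rightarrow>\<^sub>L 'a"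
  define G where "G A = (\<Sum>b\<in>Basis. (B (blinfun_apply A b) (blinfun_apply A b))\<^sup>2)" for A :: "'a \<Rightarrow>\<^sub>L 'a"
  have cB: "continuous_on S (\<lambda>A :: 'a \<Rightarrow>\<^sub>L 'a. B (blinfun_apply A b) (blinfun_apply A b))" for S b
    by (intro B.continuous_on continuous_intros)
  have cF: "continuous_on S F" for S unfolding F_def by (intro continuous_intros cB)
  have cG: "continuous_on S G" for S unfolding G_def by (intro continuous_intros cB)
  obtain Q :: "'a \<Rightarrow>\<^sub>L 'a" where Q: "\<And>b. b \<in> Basis \<Longrightarrow> blinfun_apply Q b = q b"
    using blinfun_on_Basis by blast
  have QK: "Q \<in> isometries" using q Q by (simp add: isometries_def)
  obtain R0 where R0: "R0 \<in> isometries" "\<And>A. A \<in> isometries \<Longrightarrow> F R0 \<le> F A"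
    using continuous_attains_inf[OF compact_isometries _ cF] QK by blast
  \<comment> \<open>The minimizers of \<open>F\<close>, a compact set on which the second functional
    attains its maximum.\<close>
  define K where "K = isometries \<inter> {A. F A \<le> F R0}"
  have "closed {A. F A \<le> F R0}" by (intro closed_Collect_le cF continuous_intros)
  then have cK: "compact K" unfolding K_def by (intro compact_Int_closed compact_isometries)
  have "R0 \<in> K" using R0 by (simp add: K_def)
  then obtain R where R: "R \<in> K" "\<And>A. A \<in> K \<Longrightarrow> G A \<le> G R"
    using continuous_attains_sup[OF cK _ cG] by blast
  let ?r = "blinfun_apply R"
  have RI: "?r b \<bullet> ?r d = b \<bullet> d" if "b \<in> Basis" "d \<in> Basis" for b d
    using R(1) that by (auto simp: K_def isometries_def)
  have Rmin: "F R \<le> F A" if "A \<in> isometries" for A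
    using R(1) R0(2)[OF that] by (auto simp: K_def)
  have "B (?r i) (?r j) = 0" if i: "i \<in> Basis" and j: "j \<in> Basis" and ij: "i \<noteq> j" for i j
  proof -
    let ?bi = "B (?r i) (?r i)" and ?bj = "B (?r j) (?r j)" and ?b = "B (?r i) (?r j)"
    \<comment> \<open>The frame rotated by the angle \<open>\<theta>\<close> in the plane of its
      vectors \<open>i\<close> and \<open>j\<close>.\<close>
    define f where "f \<theta> b = (if b = i then cos \<theta> *\<^sub>R ?r i + sin \<theta> *\<^sub>R ?r j
        else if b = j then cos \<theta> *\<^sub>R ?r j - sin \<theta> *\<^sub>R ?r i else ?r b)" for \<theta> b
    have cs: "cos \<theta> * cos \<theta> + sin \<theta> * sin \<theta> = 1" for \<theta> :: real
      by (simp add: power2_eq_square[symmetric])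
    have fO: "f \<theta> b \<bullet> f \<theta> d = b \<bullet> d" if "b \<in> Basis" "d \<in> Basis" for \<theta> b d
    proof -
      have n: "?r e \<bullet> ?r e = 1" "e \<bullet> e = 1" if "e \<in> Basis" for e using that RI by (auto simp: inner_Basis)
      have o: "?r e \<bullet> ?r e' = 0" "e \<bullet> e' = 0" if "e \<in> Basis" "e' \<in> Basis" "e \<noteq> e'" for e e'
        using that RI by (auto simp: inner_Basis)
      consider "b = i" | "b = j" "b \<noteq> i" | "b \<noteq> i" "b \<noteq> j" by blast
      then show ?thesis
      proof cases
        case 1
        consider "d = i" | "d = j" | "d \<noteq> i" "d \<noteq> j" by blast
        then show ?thesis using 1 i j ij that cs[of \<theta>]
          by cases (simp_all add: f_def n o inner_add_left inner_add_right inner_diff_left inner_diff_right)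
      next
        case 2
        consider "d = i" | "d = j" | "d \<noteq> i" "d \<noteq> j" by blast
        then show ?thesis using 2 i j ij that cs[of \<theta>]
          by cases (simp_all add: f_def n o inner_add_left inner_add_right inner_diff_left inner_diff_right)
      next
        case 3
        consider "d = i" | "d = j" | "d \<noteq> i" "d \<noteq> j" by blast
        then show ?thesis using 3 i j ij that RI
          by cases (simp_all add: f_def n o inner_add_left inner_add_right inner_diff_left inner_diff_right)
      qed
    qed
    have fi: "B (f \<theta> i) (f \<theta> i) = (cos \<theta>)\<^sup>2 * ?bi + 2 * (cos \<theta> * sin \<theta>) * ?b + (sin \<theta>)\<^sup>2 * ?bj" for \<theta>
      by (simp add: f_def B.add_left B.add_right B.scaleR_left B.scaleR_right sym[of "?r j" "?r i"] power2_eq_square algebra_simps)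
    have fj: "B (f \<theta> j) (f \<theta> j) = (sin \<theta>)\<^sup>2 * ?bi - 2 * (cos \<theta> * sin \<theta>) * ?b + (cos \<theta>)\<^sup>2 * ?bj" for \<theta>
      using ij by (simp add: f_def B.diff_left B.diff_right B.scaleR_left B.scaleR_right sym[of "?r j" "?r i"] power2_eq_square algebra_simps)
    define P where "P \<theta> = (SOME A. \<forall>b\<in>Basis. blinfun_apply A b = f \<theta> b)" for \<theta>
    have P: "blinfun_apply (P \<theta>) b = f \<theta> b" if "b \<in> Basis" for \<theta> b
    proof -
      from someI_ex[OF blinfun_on_Basis[of "f \<theta>"]] show ?thesis using that by (simp add: P_def)
    qed
    have PK: "P \<theta> \<in> isometries" for \<theta> using fO P by (simp add: isometries_def)
    have FP: "F (P \<theta>) = F R + c i * (B (f \<theta> i) (f \<theta> i) - ?bi) + c j * (B (f \<theta> j) (f \<theta> j) - ?bj)" for \<theta>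
    proof -
      have "F (P \<theta>) = F R + (c i * B (f \<theta> i) (f \<theta> i) - c i * ?bi) + (c j * B (f \<theta> j) (f \<theta> j) - c j * ?bj)"
        unfolding F_def P[OF i, symmetric] P[OF j, symmetric]
        by (rule sum_update_two[OF finite_Basis i j ij]) (simp add: P f_def)
      then show ?thesis by (simp add: right_diff_distrib)
    qed
    have GP: "G (P \<theta>) = G R + ((B (f \<theta> i) (f \<theta> i))\<^sup>2 - ?bi\<^sup>2) + ((B (f \<theta> j) (f \<theta> j))\<^sup>2 - ?bj\<^sup>2)" for \<theta>
      unfolding G_def P[OF i, symmetric] P[OF j, symmetric]
      by (rule sum_update_two[OF finite_Basis i j ij]) (simp add: P f_def)
    have c2: "(cos \<theta>)\<^sup>2 = 1 - (sin \<theta>)\<^sup>2" for \<theta> :: real by (simp add: cos_squared_eq)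
    have F2: "F (P \<theta>) = F R + (c i - c j) * ((sin \<theta>)\<^sup>2 * (?bj - ?bi) + 2 * (cos \<theta> * sin \<theta>) * ?b)" for \<theta>
      unfolding FP fi fj c2 by (simp add: algebra_simps)
    show ?thesis
    proof (cases "c i = c j")
      case False
      \<comment> \<open>The change of \<open>F\<close> along the rotations is minimal at angle
        \<open>0\<close>, so its derivative there vanishes.\<close>
      let ?h = "\<lambda>\<theta>. (c i - c j) * ((sin \<theta>)\<^sup>2 * (?bj - ?bi) + 2 * (cos \<theta> * sin \<theta>) * ?b)"
      have der: "(?h has_real_derivative (c i - c j) * (2 * ?b)) (at 0)"
        by (auto intro!: derivative_eq_intros)
      have "?h 0 \<le> ?h \<theta>" for \<theta> using Rmin[OF PK[of \<theta>]] F2[of \<theta>] by simp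
      then have "(c i - c j) * (2 * ?b) = 0"
        by (intro DERIV_local_min[OF der zero_less_one]) blast
      then show ?thesis using False by simp
    next
      case True
      show ?thesis
      proof (rule ccontr)
        assume b: "?b \<noteq> 0"
        \<comment> \<open>The rotation keeps the sum of the two diagonal entries. The angle, half
          that of the vector \<open>(d, 2 * ?b)\<close>, stretches their difference from
          \<open>d\<close> to \<open>\<rho>\<close>, so the sum of squares would grow although
          \<open>F\<close> is unchanged.\<close>
        define d where "d = ?bi - ?bj"
        define \<rho> where "\<rho> = sqrt (d\<^sup>2 + (2 * ?b)\<^sup>2)"
        have \<rho>: "\<rho>\<^sup>2 = d\<^sup>2 + (2 * ?b)\<^sup>2" "\<rho> > 0"
          using b by (auto simp: \<rho>_def intro!: add_nonneg_pos)
        have "(d / \<rho>)\<^sup>2 + (2 * ?b / \<rho>)\<^sup>2 = 1"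
          unfolding power_divide add_divide_distrib[symmetric] \<rho>(1)[symmetric] using \<rho>(2) by simp
        then obtain t where t: "d / \<rho> = cos t" "2 * ?b / \<rho> = sin t" using sincos_total_2pi by metis
        define \<theta> where "\<theta> = t / 2"
        have t': "cos t = (cos \<theta>)\<^sup>2 - (sin \<theta>)\<^sup>2" "sin t = 2 * sin \<theta> * cos \<theta>"
          using cos_double[of \<theta>] sin_double[of \<theta>] by (auto simp: \<theta>_def)
        let ?x = "B (f \<theta> i) (f \<theta> i)" and ?y = "B (f \<theta> j) (f \<theta> j)"
        have "?x - ?y = ((cos \<theta>)\<^sup>2 - (sin \<theta>)\<^sup>2) * d + (2 * sin \<theta> * cos \<theta>) * (2 * ?b)"
          unfolding fi fj d_def by (simp add: algebra_simps)
        also have "\<dots> = (d\<^sup>2 + (2 * ?b)\<^sup>2) / \<rho>"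
          unfolding t'[symmetric] t[symmetric] by (simp add: power2_eq_square add_divide_distrib)
        also have "\<dots> = \<rho>" unfolding \<rho>(1)[symmetric] using \<rho>(2) by (simp add: power2_eq_square)
        finally have xy: "?x - ?y = \<rho>" .
        have s: "?x + ?y = ?bi + ?bj" unfolding fi fj c2 by (simp add: algebra_simps)
        have "F (P \<theta>) = F R" using F2[of \<theta>] True by simp
        then have "P \<theta> \<in> K" using PK R(1) by (auto simp: K_def)
        then have "G (P \<theta>) \<le> G R" by (rule R(2))
        then have "?x\<^sup>2 + ?y\<^sup>2 \<le> ?bi\<^sup>2 + ?bj\<^sup>2" unfolding GP by simp
        moreover have "2 * (?x\<^sup>2 + ?y\<^sup>2) = (?x + ?y)\<^sup>2 + (?x - ?y)\<^sup>2"
          "2 * (?bi\<^sup>2 + ?bj\<^sup>2) = (?bi + ?bj)\<^sup>2 + (?bi - ?bj)\<^sup>2"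
          by (simp_all add: power2_eq_square algebra_simps)
        moreover have "r \<le> e" if "x \<le> y" "2 * x = z + r" "2 * y = z + e" for x y z r e :: real
          using that by linarith
        ultimately have "\<rho>\<^sup>2 \<le> d\<^sup>2" unfolding s xy d_def by blast
        then show False using \<rho>(1) b by simp
      qed
    qed
  qed
  moreover have "F R \<le> F Q" by (rule Rmin[OF QK])
  ultimately show ?thesis using that[of ?r] RI Q by (simp add: F_def)
qed


lemma orthonormal_frame_inner:
  fixes r :: "'a::euclidean_space \<Rightarrow> 'a"
  assumes r: "\<And>b d. b \<in> Basis \<Longrightarrow> d \<in> Basis \<Longrightarrow> r b \<bullet> r d = b \<bullet> d"
  shows "orthonormal_frame Basis (\<lambda>b i. r b \<bullet> i)"
  unfolding orthonormal_frame_def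
proof (intro conjI ballI)
  fix b d :: 'a assume bd: "b \<in> Basis" "d \<in> Basis"
  show "(\<Sum>i\<in>Basis. (r b \<bullet> i) * (r d \<bullet> i)) = (if b = d then 1 else 0)"
    using r[OF bd] bd by (simp add: euclidean_inner[symmetric] inner_Basis)
  obtain A :: "'a \<Rightarrow>\<^sub>L 'a" where A: "\<forall>b\<in>Basis. blinfun_apply A b = r b" using blinfun_on_Basis by blast
  have AI: "blinfun_apply A v \<bullet> blinfun_apply A w = v \<bullet> w" for v w
    by (rule blinfun_preserves_inner) (use A r in auto)
  have lin: "linear (blinfun_apply A)" by (intro bounded_linear.linear blinfun.bounded_linear_right)
  have "inj (blinfun_apply A)"
    unfolding linear_injective_0[OF lin] using AI by (metis inner_eq_zero_iff)
  then have "surj (blinfun_apply A)" using lin by (simp add: linear_injective_imp_surjective)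
  then obtain v w where vw: "b = blinfun_apply A v" "d = blinfun_apply A w" by (meson surjD)
  have "(\<Sum>e\<in>Basis. (r e \<bullet> b) * (r e \<bullet> d)) = (\<Sum>e\<in>Basis. (v \<bullet> e) * (w \<bullet> e))"
    by (intro sum.cong refl) (use A AI in \<open>metis vw inner_commute\<close>)
  also have "\<dots> = b \<bullet> d" using AI[of v w] vw by (simp add: euclidean_inner[symmetric])
  finally show "(\<Sum>e\<in>Basis. (r e \<bullet> b) * (r e \<bullet> d)) = (if b = d then 1 else 0)"
    using bd by (simp add: inner_Basis)
qed

text \<open>The spectral theorem with a rearrangement clause: weights \<open>c\<close> sitting on an
  arbitrary frame \<open>q\<close> can be carried to an eigenframe without increasing the weighted
  sum of diagonal entries. With \<open>c = 0\<close> it is the plain spectral theorem.\<close>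

lemma exists_diagonalizing_frame:
  fixes M :: "'a::euclidean_space \<Rightarrow> 'a \<Rightarrow> real"
  assumes sym: "\<forall>i\<in>Basis. \<forall>j\<in>Basis. M i j = M j i"
    and q: "orthonormal_frame Basis q"
  obtains r \<mu> where "orthonormal_frame Basis r" "diagonalized Basis r \<mu> M"
    "(\<Sum>b\<in>Basis. c b * \<mu> b) \<le> (\<Sum>b\<in>Basis. c b * quad Basis M (q b))"
proof -
  define B where "B v w = (\<Sum>i\<in>Basis. \<Sum>j\<in>Basis. (v \<bullet> i) * M i j * (w \<bullet> j))" for v w
  have "bilinear B" unfolding bilinear_def
    by (intro conjI allI linearI)
       (simp_all add: B_def sum.distrib sum_distrib_left algebra_simps)
  then have B: "bounded_bilinear B" by (simp add: bilinear_conv_bounded_bilinear)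
  have Bsym: "B v w = B w v" for v w
    unfolding B_def using sym by (subst sum.swap) (intro sum.cong refl, simp add: mult_ac)
  define qv where "qv b = (\<Sum>i\<in>Basis. q b i *\<^sub>R i)" for b
  have qvi: "qv b \<bullet> i = q b i" if "i \<in> Basis" for b i
    using that by (simp add: qv_def inner_sum_left inner_Basis if_distrib cong: if_cong)
  have "qv b \<bullet> qv d = b \<bullet> d" if "b \<in> Basis" "d \<in> Basis" for b d
    unfolding euclidean_inner[of "qv b" "qv d"] using q that
    by (simp add: qvi orthonormal_frame_def inner_Basis)
  from minimizing_eigenframe[OF B Bsym this, of c] obtain r
    where r: "\<And>b d. b \<in> Basis \<Longrightarrow> d \<in> Basis \<Longrightarrow> r b \<bullet> r d = b \<bullet> d"
      and off: "\<And>b d. b \<in> Basis \<Longrightarrow> d \<in> Basis \<Longrightarrow> b \<noteq> d \<Longrightarrow> B (r b) (r d) = 0"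
      and le: "(\<Sum>b\<in>Basis. c b * B (r b) (r b)) \<le> (\<Sum>b\<in>Basis. c b * B (qv b) (qv b))" by blast
  interpret B: bounded_bilinear B by (rule B)
  have fr: "orthonormal_frame Basis (\<lambda>b i. r b \<bullet> i)" by (rule orthonormal_frame_inner) (rule r)
  have rep: "i = (\<Sum>b\<in>Basis. (r b \<bullet> i) *\<^sub>R r b)" if "i \<in> Basis" for i
    by (rule euclidean_eqI) (use fr that in \<open>simp add: inner_sum_left orthonormal_frame_def inner_Basis\<close>)
  have BB: "B i j = M i j" if "i \<in> Basis" "j \<in> Basis" for i j
  proof -
    have "B i j = (\<Sum>k\<in>Basis. \<Sum>l\<in>Basis. if k = i \<and> l = j then M k l else 0)"
      unfolding B_def using that by (intro sum.cong refl) (auto simp: inner_Basis)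
    also have "\<dots> = (\<Sum>k\<in>Basis. if k = i then M k j else 0)"
      using that by (intro sum.cong refl) auto
    finally show ?thesis using that by simp
  qed
  have "diagonalized Basis (\<lambda>b i. r b \<bullet> i) (\<lambda>b. B (r b) (r b)) M"
    unfolding diagonalized_def
  proof (intro ballI)
    fix i j :: 'a assume ij: "i \<in> Basis" "j \<in> Basis"
    have "M i j = B (\<Sum>b\<in>Basis. (r b \<bullet> i) *\<^sub>R r b) (\<Sum>d\<in>Basis. (r d \<bullet> j) *\<^sub>R r d)"
      using BB[OF ij] rep ij by metis
    also have "\<dots> = (\<Sum>b\<in>Basis. \<Sum>d\<in>Basis. (r b \<bullet> i) * ((r d \<bullet> j) * B (r b) (r d)))"
      unfolding B.sum_left unfolding B.sum_right
      by (simp add: B.scaleR_left B.scaleR_right mult_ac)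
    also have "\<dots> = (\<Sum>b\<in>Basis. \<Sum>d\<in>Basis. if d = b then (r b \<bullet> i) * ((r b \<bullet> j) * B (r b) (r b)) else 0)"
      by (intro sum.cong refl) (use off in auto)
    also have "\<dots> = (\<Sum>b\<in>Basis. B (r b) (r b) * ((r b \<bullet> i) * (r b \<bullet> j)))"
      by (intro sum.cong refl) (simp add: mult_ac)
    finally show "M i j = (\<Sum>b\<in>Basis. B (r b) (r b) * ((r b \<bullet> i) * (r b \<bullet> j)))" .
  qed
  moreover have "B (qv b) (qv b) = quad Basis M (q b)" for b
    by (simp add: B_def quad_def qvi)
  ultimately show ?thesis using that[OF fr] le by simp
qed

lemma orthonormal_frame_Basis: "orthonormal_frame Basis (\<lambda>b i :: 'a::euclidean_space. b \<bullet> i)"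
  by (rule orthonormal_frame_inner) simp

text \<open>The trace is a weighted sum of the diagonal entries of \<open>N\<close> in an eigenframe
  of \<open>M\<close>. The rearrangement clause replaces these entries by eigenvalues of
  \<open>N\<close>, which leaves the inequality for two vectors in the cone.\<close>

theorem garding_newton_tensor:
  fixes M N :: "'a::euclidean_space \<Rightarrow> 'a \<Rightarrow> real"
  assumes symM: "\<forall>i\<in>Basis. \<forall>j\<in>Basis. M i j = M j i"
    and symN: "\<forall>i\<in>Basis. \<forall>j\<in>Basis. N i j = N j i"
    and posM: "\<And>j. j \<in> {1..k} \<Longrightarrow> esigma Basis M j > 0"
    and posN: "\<And>j. j \<in> {1..k} \<Longrightarrow> esigma Basis N j > 0"
    and k: "k > 0"
  shows "real k * (esigma Basis M k powr ((real k - 1) / real k) * esigma Basis N k powr (1 / real k))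
    \<le> (\<Sum>a\<in>Basis. \<Sum>l\<in>Basis. newton_tensor Basis M (k - 1) a l * N l a)"
proof -
  obtain q \<mu> where q: "orthonormal_frame Basis q" and M: "diagonalized Basis q \<mu> M"
    using exists_diagonalizing_frame[OF symM orthonormal_frame_Basis, where c = "\<lambda>_. 0"] by blast
  note DM = newton_tensor_diagonalized[OF finite_Basis q M]
  let ?c = "\<lambda>b. esym (k - 1) (Basis - {b}) \<mu>"
  obtain r \<nu> where r: "orthonormal_frame Basis r" and N: "diagonalized Basis r \<nu> N"
    and le: "(\<Sum>b\<in>Basis. ?c b * \<nu> b) \<le> (\<Sum>b\<in>Basis. ?c b * quad Basis N (q b))"
    using exists_diagonalizing_frame[OF symN q, where c = ?c] by blast
  note DN = newton_tensor_diagonalized[OF finite_Basis r N]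
  have "\<mu> \<in> Gcone k Basis" "\<nu> \<in> Gcone k Basis"
    using posM posN DM(2) DN(2) by (auto simp: Gcone_def)
  from garding_esym[OF finite_Basis k this] show ?thesis
    using le unfolding DM(2) DN(2) diagonalized_trace[OF DM(1)] by (simp add: mult.commute)
qed

section \<open>Symmetric functions of the eigenvalues on a tangent space\<close>

lemma esym_image:
  assumes "finite I" "inj_on h I"
  shows "esym k (h ` I) x = esym k I (x \<circ> h)"
  using assms
proof (induction I arbitrary: k rule: finite_induct)
  case empty
  then show ?case by (cases k) auto
next
  case (insert a I)
  then show ?case by (cases k) (auto simp: esym_insert)
qed

lemma esym_insert_zero: "finite I \<Longrightarrow> a \<notin> I \<Longrightarrow> x a = 0 \<Longrightarrow> esym k (insert a I) x = esym k I x"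
  by (cases k) (auto simp: esym_insert)

text \<open>Numbering each fibre of \<open>\<mu>\<close> separately turns eigenvalues indexed by a
  basis into the pairs (eigenvalue, copy) that encode multiplicity in
  \<open>eigenvalues_on\<close>.\<close>

lemma bij_betw_multiplicities:
  assumes "finite I"
  shows "\<exists>h. bij_betw h I {(l, j). j < card {b\<in>I. \<mu> b = l}} \<and> (\<forall>b\<in>I. fst (h b) = \<mu> b)"
proof -
  define g where "g l = (SOME g. bij_betw g {b\<in>I. \<mu> b = l} {0..<card {b\<in>I. \<mu> b = l}})" for l
  have g: "bij_betw (g l) {b\<in>I. \<mu> b = l} {0..<card {b\<in>I. \<mu> b = l}}" for l
    unfolding g_def by (rule someI_ex[OF ex_bij_betw_finite_nat]) (use assms in simp)
  define h where "h b = (\<mu> b, g (\<mu> b) b)" for b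
  have "inj_on h I"
  proof (rule inj_onI)
    fix a b assume ab: "a \<in> I" "b \<in> I" "h a = h b"
    then have "\<mu> a = \<mu> b" "g (\<mu> b) a = g (\<mu> b) b" by (auto simp: h_def)
    then show "a = b" using bij_betw_imp_inj_on[OF g[of "\<mu> b"]] ab by (auto dest: inj_onD)
  qed
  moreover have "h ` I = {(l, j). j < card {b\<in>I. \<mu> b = l}}"
  proof (intro equalityI subsetI)
    fix p assume "p \<in> h ` I"
    then obtain b where b: "b \<in> I" "p = h b" by auto
    then have "g (\<mu> b) b \<in> {0..<card {a\<in>I. \<mu> a = \<mu> b}}" by (intro bij_betw_apply[OF g]) auto
    then show "p \<in> {(l, j). j < card {b\<in>I. \<mu> b = l}}" using b by (auto simp: h_def)
  next
    fix p assume "p \<in> {(l, j). j < card {b\<in>I. \<mu> b = l}}"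
    then obtain l j where p: "p = (l, j)" "j \<in> {0..<card {b\<in>I. \<mu> b = l}}" by auto
    then have "j \<in> g l ` {b\<in>I. \<mu> b = l}" using bij_betw_imp_surj_on[OF g[of l]] by auto
    then show "p \<in> h ` I" using p by (auto simp: h_def)
  qed
  ultimately show ?thesis by (intro exI[of _ h]) (auto simp: bij_betw_def h_def)
qed

text \<open>The radial direction \<open>x\<close> contributes one more eigenvalue \<open>0\<close> to \<open>M\<close>, which does not affect the
  elementary symmetric functions.\<close>

lemma P_on_tangent_space:
  fixes M :: "'a::euclidean_space \<Rightarrow> 'a \<Rightarrow> real" and x :: 'a
  assumes sym: "\<forall>i\<in>Basis. \<forall>j\<in>Basis. M i j = M j i"
    and x: "norm x = 1" and ker: "\<And>i. i \<in> Basis \<Longrightarrow> (\<Sum>j\<in>Basis. M i j * (x \<bullet> j)) = 0"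
    and W: "\<And>v w. v \<in> tangent_space x \<Longrightarrow> w \<in> tangent_space x \<Longrightarrow>
      W v w = (\<Sum>i\<in>Basis. \<Sum>j\<in>Basis. (w \<bullet> i) * (M i j * (v \<bullet> j)))"
  shows "P_on (tangent_space x) k W = esigma Basis M k / real ((DIM('a) - 1) choose k)"
proof -
  let ?T = "tangent_space x"
  have xx: "x \<bullet> x = 1" using x by (simp add: norm_eq_1)
  have dimT: "dim ?T = DIM('a) - 1"
  proof -
    have "x \<noteq> 0" using x by auto
    then show ?thesis using dim_hyperplane[of x] by (simp add: tangent_space_def inner_commute)
  qed
  obtain r \<mu> where r: "orthonormal_frame Basis r" and D: "diagonalized Basis r \<mu> M"
    using exists_diagonalizing_frame[OF sym orthonormal_frame_Basis, where c = "\<lambda>_. 0"] by blast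
  define e where "e b = (\<Sum>i\<in>Basis. r b i *\<^sub>R i)" for b
  have ei: "e b \<bullet> i = r b i" if "i \<in> Basis" for b i
    using that by (simp add: e_def inner_sum_left inner_Basis if_distrib cong: if_cong)
  have ee: "e b \<bullet> e d = (if b = d then 1 else 0)" if "b \<in> Basis" "d \<in> Basis" for b d
    unfolding euclidean_inner[of "e b" "e d"] using r that by (simp add: ei orthonormal_frame_def)
  have rep: "v = (\<Sum>b\<in>Basis. (v \<bullet> e b) *\<^sub>R e b)" for v
  proof (rule euclidean_eqI)
    fix i :: 'a assume i: "i \<in> Basis"
    have "(\<Sum>b\<in>Basis. (v \<bullet> e b) *\<^sub>R e b) \<bullet> i = (\<Sum>b\<in>Basis. \<Sum>k\<in>Basis. (v \<bullet> k) * (r b k * r b i))"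
      using i by (simp add: inner_sum_left ei) (simp add: euclidean_inner[of v "e _"] ei sum_distrib_left mult_ac)
    also have "\<dots> = (\<Sum>k\<in>Basis. (v \<bullet> k) * (\<Sum>b\<in>Basis. r b k * r b i))"
      by (subst sum.swap) (simp add: sum_distrib_left)
    also have "\<dots> = (\<Sum>k\<in>Basis. if k = i then v \<bullet> k else 0)"
      using r i by (intro sum.cong refl) (simp add: orthonormal_frame_def)
    finally show "v \<bullet> i = (\<Sum>b\<in>Basis. (v \<bullet> e b) *\<^sub>R e b) \<bullet> i" using i by simp
  qed
  define A where "A v = (\<Sum>i\<in>Basis. (\<Sum>j\<in>Basis. M i j * (v \<bullet> j)) *\<^sub>R i)" for v
  have Ai: "A v \<bullet> i = (\<Sum>j\<in>Basis. M i j * (v \<bullet> j))" if "i \<in> Basis" for v i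
    using that by (simp add: A_def inner_sum_left inner_Basis if_distrib cong: if_cong)
  have Aw: "A v \<bullet> w = (\<Sum>i\<in>Basis. \<Sum>j\<in>Basis. (w \<bullet> i) * (M i j * (v \<bullet> j)))" for v w
    unfolding euclidean_inner[of "A v" w] by (simp add: Ai sum_distrib_left mult_ac)
  have Asym: "A v \<bullet> w = v \<bullet> A w" for v w
    unfolding inner_commute[of v "A w"] Aw using sym by (subst sum.swap) (intro sum.cong refl, simp add: mult_ac)
  have linA: "linear A"
    by (rule linearI; rule euclidean_eqI) (simp_all add: Ai inner_add_left sum.distrib sum_distrib_left algebra_simps)
  have Ax: "A x = 0" by (rule euclidean_eqI) (simp add: Ai ker)
  have AT: "A v \<in> ?T" for v using Asym[of v x] Ax by (simp add: tangent_space_def)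
  have Ae: "A (e b) = \<mu> b *\<^sub>R e b" if "b \<in> Basis" for b
    by (rule euclidean_eqI) (simp add: Ai ei diagonalized_eigen(1)[OF finite_Basis r D that])
  define E where "E l = {v. A v = l *\<^sub>R v}" for l
  have subE: "subspace (E l)" for l
    unfolding subspace_def E_def using linA by (auto simp: linear_0 linear_add linear_scale scaleR_right_distrib)
  have injE: "inj_on e Basis"
    using ee by (intro inj_onI) (metis zero_neq_one)
  have E: "E l = span (e ` {b\<in>Basis. \<mu> b = l})" for l
  proof
    show "span (e ` {b\<in>Basis. \<mu> b = l}) \<subseteq> E l"
      by (rule span_minimal[OF _ subE]) (auto simp: E_def Ae)
    show "E l \<subseteq> span (e ` {b\<in>Basis. \<mu> b = l})"
    proof
      fix v assume v: "v \<in> E l"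
      have "(v \<bullet> e b) *\<^sub>R e b \<in> span (e ` {b\<in>Basis. \<mu> b = l})" if b: "b \<in> Basis" for b
      proof (cases "\<mu> b = l")
        case False
        have "l * (v \<bullet> e b) = \<mu> b * (v \<bullet> e b)"
          using Asym[of v "e b"] v b by (simp add: E_def Ae)
        then show ?thesis using False by (simp add: span_zero)
      qed (use b in \<open>auto intro: span_scale span_base\<close>)
      then have "(\<Sum>b\<in>Basis. (v \<bullet> e b) *\<^sub>R e b) \<in> span (e ` {b\<in>Basis. \<mu> b = l})" by (rule span_sum)
      then show "v \<in> span (e ` {b\<in>Basis. \<mu> b = l})" using rep[of v] by simp
    qed
  qed
  have dimE: "dim (E l) = card {b\<in>Basis. \<mu> b = l}" for l
  proof -
    have "independent (e ` {b\<in>Basis. \<mu> b = l})"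
    proof (rule pairwise_orthogonal_independent)
      show "pairwise orthogonal (e ` {b\<in>Basis. \<mu> b = l})"
        by (auto simp: pairwise_def orthogonal_def ee)
      show "0 \<notin> e ` {b\<in>Basis. \<mu> b = l}" using ee by (force simp del: inner_eq_zero_iff)
    qed
    then have "dim (E l) = card (e ` {b\<in>Basis. \<mu> b = l})" by (simp add: E dim_eq_card_independent)
    also have "\<dots> = card {b\<in>Basis. \<mu> b = l}" using injE by (intro card_image) (auto simp: inj_on_def)
    finally show ?thesis .
  qed
  have sub: "c *\<^sub>R v - d *\<^sub>R w \<in> ?T" if "v \<in> ?T" "w \<in> ?T" for c d v w
    using that by (simp add: tangent_space_def inner_diff_left)
  have eig: "eigenspace_on ?T W l = E l \<inter> ?T" for l
  proof (intro equalityI subsetI)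
    fix v assume v: "v \<in> eigenspace_on ?T W l"
    then have vT: "v \<in> ?T" by (simp add: eigenspace_on_def)
    \<comment> \<open>The defining equation may be tested on tangent vectors only, and the defect
      \<open>?z\<close> is itself tangent because \<open>A\<close> maps into the tangent
      space.\<close>
    let ?z = "A v - l *\<^sub>R v"
    have zT: "?z \<in> ?T" using sub[OF AT vT, where c = 1 and d = l] by simp
    have "A v \<bullet> ?z = l * (v \<bullet> ?z)"
      using v zT W[OF vT zT] by (simp add: eigenspace_on_def Aw)
    then have "?z \<bullet> ?z = 0" by (simp add: inner_diff_left)
    then show "v \<in> E l \<inter> ?T" using vT by (simp add: E_def)
  next
    fix v assume "v \<in> E l \<inter> ?T"
    then show "v \<in> eigenspace_on ?T W l"
      using W[of v] Aw[of v] by (auto simp: E_def eigenspace_on_def)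
  qed
  let ?n = "\<lambda>l. card {b\<in>Basis. \<mu> b = l}"
  \<comment> \<open>The normal \<open>x\<close> lies in the kernel of \<open>A\<close>, so
    restricting to the tangent space costs exactly one dimension there; eigenvectors for other
    eigenvalues are orthogonal to \<open>x\<close> already.\<close>
  have dim0: "dim (eigenspace_on ?T W 0) + 1 = ?n 0"
  proof -
    have "x \<in> E 0" by (simp add: E_def Ax)
    then have "span {x} \<subseteq> E 0" by (simp add: span_minimal subE)
    from dim_subspace_orthogonal_to_vectors[OF subspace_span subE this]
    have "dim {y \<in> E 0. \<forall>w\<in>span {x}. orthogonal w y} + dim (span {x}) = dim (E 0)" .
    moreover have "{y \<in> E 0. \<forall>w\<in>span {x}. orthogonal w y} = E 0 \<inter> ?T"
      by (auto simp: tangent_space_def orthogonal_def span_singleton inner_commute)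
    moreover have "dim (span {x}) = 1" using xx by (auto simp: dim_insert)
    ultimately show ?thesis by (simp add: eig dimE)
  qed
  have diml: "dim (eigenspace_on ?T W l) = ?n l" if "l \<noteq> 0" for l
  proof -
    have "E l \<subseteq> ?T"
    proof
      fix v assume "v \<in> E l"
      then have "l * (v \<bullet> x) = 0" using Asym[of v x] Ax by (simp add: E_def)
      then show "v \<in> ?T" using that by (simp add: tangent_space_def)
    qed
    then show ?thesis by (simp add: eig dimE[symmetric] Int_absorb2)
  qed
  let ?S = "eigenvalues_on ?T W" and ?S' = "{(l, j). j < ?n l}"
  \<comment> \<open>The surplus element is the last copy of the eigenvalue \<open>0\<close>, copies
    being counted from \<open>0\<close>.\<close>
  have S': "?S' = insert (0, ?n 0 - 1) ?S"
  proof (intro set_eqI)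
    fix p :: "real \<times> nat"
    show "p \<in> ?S' \<longleftrightarrow> p \<in> insert (0, ?n 0 - 1) ?S"
    proof (cases p)
      case (Pair l j)
      show ?thesis
        using dim0 diml[of l] by (cases "l = 0") (auto simp: Pair eigenvalues_on_def)
    qed
  qed
  have notin: "(0, ?n 0 - 1) \<notin> ?S" using dim0 by (auto simp: eigenvalues_on_def)
  obtain h where h: "bij_betw h Basis ?S'" "\<forall>b\<in>Basis. fst (h b) = \<mu> b"
    using bij_betw_multiplicities[OF finite_Basis] by blast
  have finS: "finite ?S" using bij_betw_finite[OF h(1)] S' by simp
  have "esigma Basis M k = esym k Basis \<mu>"
    by (rule newton_tensor_diagonalized(2)[OF finite_Basis r D])
  also have "\<dots> = esym k Basis (fst \<circ> h)" by (rule esym_cong) (use h in simp)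
  also have "\<dots> = esym k ?S' fst"
    using esym_image[of Basis h k fst] h(1) by (simp add: bij_betw_def)
  also have "\<dots> = esym k ?S fst"
    unfolding S' using finS notin by (intro esym_insert_zero) auto
  finally show ?thesis
    unfolding P_on_def dimT by (simp add: esym_def case_prod_unfold)
qed

section \<open>Calculus of continuously differentiable functions\<close>

abbreviation dirderiv :: "'a::euclidean_space \<Rightarrow> ('a \<Rightarrow> real) \<Rightarrow> 'a \<Rightarrow> real" where
  "dirderiv v F \<equiv> (\<lambda>x. frechet_derivative F (at x) v)"

lemma dirderivI: "(F has_derivative D) (at x) \<Longrightarrow> dirderiv v F x = D v"
  using frechet_derivative_at by metis

text \<open>Since \<open>frechet_derivative\<close> is a choice among derivatives, both functions
  are shown to have the same set of derivatives; this also covers points where there is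
  none.\<close>

lemma frechet_derivative_cong_open:
  assumes "open U" "x \<in> U" "\<And>y. y \<in> U \<Longrightarrow> F y = G y"
  shows "frechet_derivative F (at x) = frechet_derivative G (at x)"
proof -
  have "(F has_derivative D) (at x) \<longleftrightarrow> (G has_derivative D) (at x)" for D
    using has_derivative_transform_within_open[of F D x UNIV U G]
      has_derivative_transform_within_open[of G D x UNIV U F] assms by auto
  then show ?thesis by (simp add: frechet_derivative_def)
qed

lemma Ck_on_has_derivative:
  assumes "Ck_on (Suc m) F U" "open U" "x \<in> U"
  shows "(F has_derivative (\<lambda>v. dirderiv v F x)) (at x)"
  using assms by (simp add: differentiable_on_eq_differentiable_at frechet_derivative_works[symmetric])

lemma Ck_on_dirderiv: "Ck_on (Suc m) F U \<Longrightarrow> Ck_on m (dirderiv v F) U"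
  by simp

lemma Ck_on_cong:
  assumes "open U" "\<And>y. y \<in> U \<Longrightarrow> F y = G y"
  shows "Ck_on m F U \<longleftrightarrow> Ck_on m G U"
  using assms(2)
proof (induction m arbitrary: F G)
  case 0
  then show ?case by (auto intro: continuous_on_cong)
next
  case (Suc m)
  have "F differentiable_on U \<longleftrightarrow> G differentiable_on U"
    using Suc.prems by (metis differentiable_transform_within differentiable_on_def zero_less_one)
  moreover have "Ck_on m (dirderiv v F) U \<longleftrightarrow> Ck_on m (dirderiv v G) U" for v
    by (rule Suc.IH) (simp add: frechet_derivative_cong_open[OF assms(1) _ Suc.prems])
  ultimately show ?case by simp
qed

lemma Ck_on_subset: "Ck_on m F U \<Longrightarrow> V \<subseteq> U \<Longrightarrow> Ck_on m F V"
  by (induction m arbitrary: F) (auto intro: continuous_on_subset differentiable_on_subset)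

lemma Ck_on_SucD: "Ck_on (Suc m) F U \<Longrightarrow> Ck_on m F U"
proof (induction m arbitrary: F)
  case 0
  then show ?case by (simp add: differentiable_imp_continuous_on)
next
  case (Suc m)
  then show ?case by (metis Ck_on.simps(2))
qed

lemma Ck_on_mono: "Ck_on n F U \<Longrightarrow> m \<le> n \<Longrightarrow> Ck_on m F U"
  by (induction n) (auto simp: le_Suc_eq dest: Ck_on_SucD simp del: Ck_on.simps(2))

lemma Ck_on_continuous: "Ck_on m F U \<Longrightarrow> continuous_on U F"
  using Ck_on_mono[of m F U 0] by simp

lemma Ck_on_SucI:
  assumes "open U" "\<And>x. x \<in> U \<Longrightarrow> (F has_derivative F' x) (at x)" "\<And>v. Ck_on m (\<lambda>x. F' x v) U"
  shows "Ck_on (Suc m) F U"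
proof -
  have "F differentiable_on U"
    using assms(1,2) by (auto simp: differentiable_on_eq_differentiable_at differentiable_def)
  moreover have "Ck_on m (dirderiv v F) U" for v
    using Ck_on_cong[OF assms(1), of "dirderiv v F" "\<lambda>x. F' x v"] dirderivI[OF assms(2)] assms(3) by simp
  ultimately show ?thesis by simp
qed

lemma Ck_on_local:
  assumes "\<And>x. x \<in> U \<Longrightarrow> \<exists>V. open V \<and> x \<in> V \<and> Ck_on m F V"
  shows "Ck_on m F U"
  using assms
proof (induction m arbitrary: F)
  case 0
  show ?case unfolding Ck_on.simps continuous_on_eq_continuous_within
  proof
    fix x assume "x \<in> U"
    from 0[OF this] obtain V where "open V" "x \<in> V" "continuous_on V F" by auto
    then show "continuous (at x within U) F"
      using continuous_on_eq_continuous_at continuous_at_imp_continuous_at_within by blast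
  qed
next
  case (Suc m)
  have "F differentiable_on U" unfolding differentiable_on_def
  proof
    fix x assume "x \<in> U"
    from Suc.prems[OF this] obtain V where "open V" "x \<in> V" "F differentiable_on V" by auto
    then show "F differentiable (at x within U)"
      by (auto simp: differentiable_on_eq_differentiable_at intro: differentiable_at_withinI)
  qed
  moreover have "Ck_on m (dirderiv v F) U" for v
    by (rule Suc.IH) (use Suc.prems in fastforce)
  ultimately show ?case by simp
qed

lemma Ck_on_const [intro]: "open U \<Longrightarrow> Ck_on m (\<lambda>x. c) U"
proof (induction m arbitrary: c)
  case (Suc m)
  show ?case by (rule Ck_on_SucI[OF Suc.prems, where F' = "\<lambda>x v. 0"]) (use Suc in auto)
qed simp

lemma Ck_on_inner: "open U \<Longrightarrow> Ck_on m (\<lambda>x. x \<bullet> a) U"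
proof (cases m)
  case (Suc n)
  assume "open U"
  then show ?thesis unfolding Suc
    by (intro Ck_on_SucI[where F' = "\<lambda>x v. v \<bullet> a"]) (auto intro!: derivative_eq_intros)
qed (auto intro!: continuous_intros)

lemma Ck_on_add: "open U \<Longrightarrow> Ck_on m F U \<Longrightarrow> Ck_on m G U \<Longrightarrow> Ck_on m (\<lambda>x. F x + G x) U"
proof (induction m arbitrary: F G)
  case (Suc m)
  show ?case
    by (rule Ck_on_SucI[OF Suc.prems(1) has_derivative_add[OF Ck_on_has_derivative[OF Suc.prems(2,1)]
            Ck_on_has_derivative[OF Suc.prems(3,1)]]])
       (use Suc in auto)
qed (auto intro!: continuous_on_add continuous_on_mult)

lemma Ck_on_mult: "open U \<Longrightarrow> Ck_on m F U \<Longrightarrow> Ck_on m G U \<Longrightarrow> Ck_on m (\<lambda>x. F x * G x) U"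
proof (induction m arbitrary: F G)
  case (Suc m)
  show ?case
    by (rule Ck_on_SucI[OF Suc.prems(1) has_derivative_mult[OF Ck_on_has_derivative[OF Suc.prems(2,1)]
            Ck_on_has_derivative[OF Suc.prems(3,1)]]])
       (use Suc in \<open>auto intro!: Ck_on_add Suc.IH dest: Ck_on_SucD simp del: Ck_on.simps(2) simp: Ck_on_dirderiv\<close>)
qed (auto intro!: continuous_on_add continuous_on_mult)

lemma Ck_on_sum:
  assumes "open U" "\<And>i. i \<in> I \<Longrightarrow> Ck_on m (F i) U"
  shows "Ck_on m (\<lambda>x. \<Sum>i\<in>I. F i x) U"
  using assms(2)
  by (induction I rule: infinite_finite_induct) (auto intro: Ck_on_add Ck_on_const assms(1))

lemma Ck_on_diff: "open U \<Longrightarrow> Ck_on m F U \<Longrightarrow> Ck_on m G U \<Longrightarrow> Ck_on m (\<lambda>x. F x - G x) U"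
  using Ck_on_add[of U m F "\<lambda>x. (-1) * G x"] Ck_on_mult[of U m "\<lambda>x. -1" G] by (simp add: Ck_on_const)

text \<open>Differentiation lowers the exponent by two, so the induction on \<open>m\<close> needs
  all real exponents at once.\<close>

lemma Ck_on_norm_powr: "Ck_on m (\<lambda>x :: 'a::euclidean_space. norm x powr p) (- {0})"
proof (induction m arbitrary: p)
  case 0
  show ?case by (auto intro!: continuous_intros)
next
  case (Suc m)
  show ?case
  proof (rule Ck_on_SucI[where F' = "\<lambda>x v. p * norm x powr (p - 2) * (x \<bullet> v)"])
    fix x :: 'a assume x: "x \<in> - {0}"
    have "((\<lambda>x. norm x powr p) has_derivative (\<lambda>v. (v \<bullet> sgn x) * (p * norm x powr (p - 1)))) (at x)"
      using x by (auto intro!: derivative_eq_intros has_derivative_norm simp: fun_eq_iff algebra_simps powr_diff)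
    moreover have "(v \<bullet> sgn x) * (p * norm x powr (p - 1)) = p * norm x powr (p - 2) * (x \<bullet> v)" for v
      using x by (simp add: sgn_div_norm powr_diff inner_commute power2_eq_square divide_inverse mult_ac)
    ultimately show "((\<lambda>x. norm x powr p) has_derivative (\<lambda>v. p * norm x powr (p - 2) * (x \<bullet> v))) (at x)"
      by simp
  qed (auto intro!: Ck_on_mult Suc.IH Ck_on_inner)
qed

lemma Ck_on_compose:
  fixes N :: "'a::euclidean_space \<Rightarrow> 'b::euclidean_space"
  assumes U: "open U" and V: "open V" and NUV: "N ` U \<subseteq> V"
    and N: "\<And>b m. b \<in> Basis \<Longrightarrow> Ck_on m (\<lambda>x. N x \<bullet> b) U" and F: "Ck_on m F V"
  shows "Ck_on m (\<lambda>x. F (N x)) U"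
  using F
proof (induction m arbitrary: F)
  case 0
  have "continuous_on U N"
    by (subst continuous_on_componentwise) (use N[of _ 0] in auto)
  then show ?case using 0 continuous_on_compose2[OF _ _ NUV] by auto
next
  case (Suc m)
  let ?N' = "\<lambda>x v. \<Sum>b\<in>Basis. dirderiv v (\<lambda>x. N x \<bullet> b) x *\<^sub>R b"
  show ?case
  proof (rule Ck_on_SucI[OF U, where F' = "\<lambda>x v. \<Sum>b\<in>Basis. dirderiv v (\<lambda>x. N x \<bullet> b) x * dirderiv b F (N x)"])
    fix x assume x: "x \<in> U"
    have N': "(N has_derivative ?N' x) (at x)"
      unfolding has_derivative_componentwise_within[of N]
    proof
      fix b :: 'b assume b: "b \<in> Basis"
      have "?N' x v \<bullet> b = dirderiv v (\<lambda>x. N x \<bullet> b) x" for v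
        using b by (simp add: inner_sum_left inner_Basis if_distrib cong: if_cong)
      then show "((\<lambda>x. N x \<bullet> b) has_derivative (\<lambda>v. ?N' x v \<bullet> b)) (at x)"
        using Ck_on_has_derivative[OF N[OF b] U x] by simp
    qed
    have FN: "(F has_derivative (\<lambda>v. dirderiv v F (N x))) (at (N x))"
      using Ck_on_has_derivative[OF Suc.prems V] x NUV by blast
    have "linear (\<lambda>v. dirderiv v F (N x))" using FN has_derivative_linear by blast
    then have "(\<Sum>b\<in>Basis. dirderiv v (\<lambda>x. N x \<bullet> b) x * dirderiv b F (N x)) = dirderiv (?N' x v) F (N x)" for v
      by (simp add: linear_sum linear_scale)
    then show "((\<lambda>x. F (N x)) has_derivative (\<lambda>v. \<Sum>b\<in>Basis. dirderiv v (\<lambda>x. N x \<bullet> b) x * dirderiv b F (N x))) (at x)"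
      using has_derivative_compose[OF N' FN] by simp
  next
    show "Ck_on m (\<lambda>x. \<Sum>b\<in>Basis. dirderiv v (\<lambda>x. N x \<bullet> b) x * dirderiv b F (N x)) U" for v
      by (intro Ck_on_sum Ck_on_mult U Suc.IH Ck_on_dirderiv N Suc.prems)
  qed
qed

lemma dirderiv_Basis:
  assumes "Ck_on (Suc m) F U" "open U" "x \<in> U"
  shows "dirderiv v F x = (\<Sum>b\<in>Basis. (v \<bullet> b) * dirderiv b F x)"
proof -
  have "linear (\<lambda>v. dirderiv v F x)"
    using Ck_on_has_derivative[OF assms] has_derivative_linear by blast
  then have "dirderiv (\<Sum>b\<in>Basis. (v \<bullet> b) *\<^sub>R b) F x = (\<Sum>b\<in>Basis. (v \<bullet> b) * dirderiv b F x)"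
    by (simp add: linear_sum linear_scale)
  then show ?thesis by (simp add: euclidean_representation)
qed

section \<open>Derivatives along lines and symmetry of second derivatives\<close>

lemma DERIV_line:
  assumes "(F has_derivative (\<lambda>v. dirderiv v F (y + t *\<^sub>R e))) (at (y + t *\<^sub>R e))"
  shows "((\<lambda>s. F (y + s *\<^sub>R e)) has_real_derivative dirderiv e F (y + t *\<^sub>R e)) (at t)"
proof -
  have "((\<lambda>s. y + s *\<^sub>R e) has_derivative (\<lambda>s. s *\<^sub>R e)) (at t)"
    by (auto intro!: derivative_eq_intros)
  from has_derivative_compose[OF this assms]
  have "((\<lambda>s. F (y + s *\<^sub>R e)) has_derivative (\<lambda>s. dirderiv (s *\<^sub>R e) F (y + t *\<^sub>R e))) (at t)" .
  moreover have "dirderiv (s *\<^sub>R e) F (y + t *\<^sub>R e) = dirderiv e F (y + t *\<^sub>R e) * s" for s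
    using linear_scale[OF has_derivative_linear[OF assms], of s e] by (simp add: mult.commute)
  ultimately show ?thesis by (simp add: has_field_derivative_def)
qed

lemma second_difference_mean_value:
  assumes F: "Ck_on (Suc (Suc m)) F U" and U: "open U" and h: "0 < h"
    and in_U: "\<And>s t. 0 \<le> s \<Longrightarrow> s \<le> h \<Longrightarrow> 0 \<le> t \<Longrightarrow> t \<le> h \<Longrightarrow> x + s *\<^sub>R v + t *\<^sub>R w \<in> U"
  shows "\<exists>s t. 0 < s \<and> s < h \<and> 0 < t \<and> t < h \<and>
    F (x + h *\<^sub>R v + h *\<^sub>R w) - F (x + h *\<^sub>R v) - F (x + h *\<^sub>R w) + F x
      = h * (h * dirderiv w (dirderiv v F) (x + s *\<^sub>R v + t *\<^sub>R w))"
proof -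
  let ?f = "\<lambda>s. F ((x + h *\<^sub>R w) + s *\<^sub>R v) - F (x + s *\<^sub>R v)"
  have "\<exists>s>0. s < h \<and> ?f h - ?f 0 = (h - 0) * (dirderiv v F ((x + h *\<^sub>R w) + s *\<^sub>R v) - dirderiv v F (x + s *\<^sub>R v))"
  proof (rule MVT2[OF h])
    fix s assume s: "0 \<le> s" "s \<le> h"
    show "(?f has_real_derivative (dirderiv v F ((x + h *\<^sub>R w) + s *\<^sub>R v) - dirderiv v F (x + s *\<^sub>R v))) (at s)"
      by (intro DERIV_diff DERIV_line Ck_on_has_derivative[OF F U])
         (use in_U[OF s, of h] in_U[OF s, of 0] h in \<open>simp_all add: algebra_simps\<close>)
  qed
  then obtain s where s: "0 < s" "s < h" "?f h - ?f 0 = h * (dirderiv v F ((x + h *\<^sub>R w) + s *\<^sub>R v) - dirderiv v F (x + s *\<^sub>R v))"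
    by auto
  let ?g = "\<lambda>t. dirderiv v F ((x + s *\<^sub>R v) + t *\<^sub>R w)"
  have "\<exists>t>0. t < h \<and> ?g h - ?g 0 = (h - 0) * dirderiv w (dirderiv v F) ((x + s *\<^sub>R v) + t *\<^sub>R w)"
  proof (rule MVT2[OF h])
    fix t assume t: "0 \<le> t" "t \<le> h"
    show "(?g has_real_derivative dirderiv w (dirderiv v F) ((x + s *\<^sub>R v) + t *\<^sub>R w)) (at t)"
      by (intro DERIV_line Ck_on_has_derivative[OF Ck_on_dirderiv[OF F] U] in_U) (use s t in auto)
  qed
  then obtain t where t: "0 < t" "t < h" "?g h - ?g 0 = h * dirderiv w (dirderiv v F) (x + s *\<^sub>R v + t *\<^sub>R w)"
    by auto
  have "?f h - ?f 0 = h * (?g h - ?g 0)" unfolding s(3) by (simp add: algebra_simps)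
  then show ?thesis unfolding t(3) using s t by (intro exI[of _ s] exI[of _ t]) (simp add: algebra_simps)
qed

text \<open>The second difference over a parallelogram is symmetric in \<open>v\<close> and
  \<open>w\<close>, and by the mean value theorem it is \<open>h * h\<close> times either mixed
  derivative at some nearby point. Continuity then identifies the two at \<open>x\<close>.\<close>

lemma dirderiv_commute:
  assumes F: "Ck_on (Suc (Suc m)) F U" and U: "open U" and x: "x \<in> U"
  shows "dirderiv w (dirderiv v F) x = dirderiv v (dirderiv w F) x"
proof (rule ccontr)
  let ?A = "dirderiv w (dirderiv v F)" and ?B = "dirderiv v (dirderiv w F)"
  assume ne: "?A x \<noteq> ?B x"
  define e where "e = dist (?A x) (?B x) / 2"
  have e: "e > 0" using ne by (simp add: e_def)
  have "continuous_on U ?A" "continuous_on U ?B"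
    by (rule Ck_on_continuous[OF Ck_on_dirderiv[OF Ck_on_dirderiv[OF F]]])+
  then have "continuous (at x) ?A" "continuous (at x) ?B"
    using U x continuous_on_eq_continuous_at by blast+
  then obtain d1 d2 where d1: "d1 > 0" "\<And>y. dist y x < d1 \<Longrightarrow> dist (?A y) (?A x) < e"
    and d2: "d2 > 0" "\<And>y. dist y x < d2 \<Longrightarrow> dist (?B y) (?B x) < e"
    unfolding continuous_at_eps_delta using e by (metis dist_norm)
  obtain d3 where d3: "d3 > 0" "ball x d3 \<subseteq> U" using U x openE by blast
  define d where "d = min d1 (min d2 d3)"
  have d: "d > 0" "d \<le> d1" "d \<le> d2" "d \<le> d3" using d1 d2 d3 by (auto simp: d_def)
  \<comment> \<open>Small enough to keep the whole parallelogram within distance \<open>d\<close> of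
    \<open>x\<close>; the added \<open>1\<close> keeps the denominator positive when both vectors
    vanish.\<close>
  define h where "h = d / (2 * (norm v + norm w + 1))"
  have nz: "norm v + norm w + 1 > 0" by (simp add: add_nonneg_pos)
  have "z < 2 * (z + 1)" if "z + 1 > 0" for z :: real using that by argo
  from this[OF nz] have less: "norm v + norm w < 2 * (norm v + norm w + 1)" .
  have h: "h > 0" using d nz by (simp add: h_def)
  have near: "dist (x + s *\<^sub>R a + t *\<^sub>R b) x < d"
    if "0 \<le> s" "s \<le> h" "0 \<le> t" "t \<le> h" "norm a + norm b = norm v + norm w" for s t a b
  proof -
    have "dist (x + s *\<^sub>R a + t *\<^sub>R b) x = norm (s *\<^sub>R a + t *\<^sub>R b)" by (simp add: dist_norm algebra_simps)
    also have "\<dots> \<le> s * norm a + t * norm b" using that norm_triangle_ineq[of "s *\<^sub>R a" "t *\<^sub>R b"] by simp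
    also have "\<dots> \<le> h * norm a + h * norm b" using that by (intro add_mono mult_right_mono) auto
    also have "\<dots> = h * (norm v + norm w)" using that by (simp add: distrib_left[symmetric])
    also have "\<dots> < h * (2 * (norm v + norm w + 1))"
      by (rule mult_strict_left_mono[OF less h])
    also have "\<dots> = d" using nz by (simp add: h_def)
    finally show ?thesis .
  qed
  have in_U: "x + s *\<^sub>R a + t *\<^sub>R b \<in> U"
    if "0 \<le> s" "s \<le> h" "0 \<le> t" "t \<le> h" "norm a + norm b = norm v + norm w" for s t a b
    using near[OF that] d d3 by (auto simp: dist_commute)
  obtain s t where st: "0 < s" "s < h" "0 < t" "t < h"
    "F (x + h *\<^sub>R v + h *\<^sub>R w) - F (x + h *\<^sub>R v) - F (x + h *\<^sub>R w) + F x = h * (h * ?A (x + s *\<^sub>R v + t *\<^sub>R w))"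
    using second_difference_mean_value[OF F U h, of x v w] in_U by blast
  obtain s' t' where st': "0 < s'" "s' < h" "0 < t'" "t' < h"
    "F (x + h *\<^sub>R w + h *\<^sub>R v) - F (x + h *\<^sub>R w) - F (x + h *\<^sub>R v) + F x = h * (h * ?B (x + s' *\<^sub>R w + t' *\<^sub>R v))"
    using second_difference_mean_value[OF F U h, of x w v] in_U[of _ _ w v] by (metis add.commute)
  have "h * (h * ?A (x + s *\<^sub>R v + t *\<^sub>R w)) = h * (h * ?B (x + s' *\<^sub>R w + t' *\<^sub>R v))"
    using st(5) st'(5) by (simp add: algebra_simps)
  then have "?A (x + s *\<^sub>R v + t *\<^sub>R w) = ?B (x + s' *\<^sub>R w + t' *\<^sub>R v)" using h by simp
  moreover have "dist (?A (x + s *\<^sub>R v + t *\<^sub>R w)) (?A x) < e"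
    by (rule d1) (use near[of s t v w] st d in auto)
  moreover have "dist (?B (x + s' *\<^sub>R w + t' *\<^sub>R v)) (?B x) < e"
    by (rule d2) (use near[of s' t' w v] st' d in auto)
  moreover have False if "p = r" "dist p a < dist a b / 2" "dist r b < dist a b / 2" for p r a b :: real
    using that dist_triangle_half_r[of p a "dist a b" b] by simp
  ultimately show False unfolding e_def by blast
qed

section \<open>Homogeneous extension from the sphere\<close>

definition hom_ext :: "('a::euclidean_space \<Rightarrow> real) \<Rightarrow> 'a \<Rightarrow> real" where
  "hom_ext u y = norm y * u (y /\<^sub>R norm y)"

lemma hom_ext_sphere: "x \<in> sphere 0 1 \<Longrightarrow> hom_ext u x = u x"
  by (simp add: hom_ext_def)

lemma hom_ext_scale: "r > 0 \<Longrightarrow> hom_ext u (r *\<^sub>R y) = r * hom_ext u y"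
  by (simp add: hom_ext_def field_simps)

lemma Ck_on_hom_ext:
  assumes "smooth_on_sphere u"
  shows "Ck_on m (hom_ext u) (- {0})"
proof (rule Ck_on_local)
  fix y :: 'a assume "y \<in> - {0}"
  then have y: "y \<noteq> 0" by simp
  let ?N = "\<lambda>y :: 'a. y /\<^sub>R norm y"
  have "?N y \<in> sphere 0 1" using y by simp
  then obtain U F where U: "open U" "?N y \<in> U" and F: "\<And>m. Ck_on m F U"
    and Fu: "\<And>z. z \<in> U \<inter> sphere 0 1 \<Longrightarrow> F z = u z"
    using assms unfolding smooth_on_sphere_def by meson
  define V where "V = (- {0}) \<inter> ?N -` U"
  have "continuous_on (- {0}) ?N" by (auto intro!: continuous_intros)
  then have V: "open V" unfolding V_def by (intro continuous_open_preimage U) auto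
  have nV: "Ck_on m (\<lambda>y. norm y powr p) V" for m p
    by (rule Ck_on_subset[OF Ck_on_norm_powr]) (auto simp: V_def)
  have "Ck_on m (\<lambda>y. ?N y \<bullet> b) V" for m b
  proof -
    have "Ck_on m (\<lambda>y. norm y powr (-1) * (y \<bullet> b)) V" by (intro Ck_on_mult V nV Ck_on_inner)
    moreover have "norm y powr (-1) * (y \<bullet> b) = ?N y \<bullet> b" for y by (simp add: powr_minus)
    ultimately show ?thesis by simp
  qed
  then have "Ck_on m (\<lambda>y. F (?N y)) V"
    by (intro Ck_on_compose[OF V U(1) _ _ F]) (auto simp: V_def)
  then have "Ck_on m (\<lambda>y. norm y powr 1 * F (?N y)) V" by (intro Ck_on_mult V nV)
  moreover have "norm y powr 1 * F (?N y) = hom_ext u y" if "y \<in> V" for y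
    using that Fu[of "?N y"] by (simp add: V_def hom_ext_def)
  ultimately have "Ck_on m (hom_ext u) V"
    using Ck_on_cong[OF V, of "\<lambda>y. norm y powr 1 * F (?N y)" "hom_ext u" m] by simp
  then show "\<exists>V. open V \<and> y \<in> V \<and> Ck_on m (hom_ext u) V" using V U y by (auto simp: V_def)
qed

lemma open_punctured: "open (- {0 :: 'a::euclidean_space})" by auto

section \<open>Euler relations for homogeneous functions\<close>

lemma dirderiv_homogeneous:
  assumes F: "Ck_on (Suc m) F (- {0})" and hom: "\<And>y. y \<noteq> 0 \<Longrightarrow> F (r *\<^sub>R y) = c * F y"
    and r: "r > 0" and y: "y \<noteq> 0"
  shows "r * dirderiv v F (r *\<^sub>R y) = c * dirderiv v F y"
proof -
  have "(F has_derivative (\<lambda>v. dirderiv v F (r *\<^sub>R y))) (at (r *\<^sub>R y))"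
    using r y by (intro Ck_on_has_derivative[OF F open_punctured]) auto
  moreover have "((\<lambda>y. r *\<^sub>R y) has_derivative (\<lambda>v. r *\<^sub>R v)) (at y)" by (auto intro!: derivative_eq_intros)
  ultimately have D: "((\<lambda>y. F (r *\<^sub>R y)) has_derivative (\<lambda>v. dirderiv (r *\<^sub>R v) F (r *\<^sub>R y))) (at y)"
    using has_derivative_compose by blast
  have "((\<lambda>y. c * F y) has_derivative (\<lambda>v. c * dirderiv v F y)) (at y)"
    using y by (intro has_derivative_mult_right Ck_on_has_derivative[OF F open_punctured]) auto
  then have "((\<lambda>y. F (r *\<^sub>R y)) has_derivative (\<lambda>v. c * dirderiv v F y)) (at y)"
    by (rule has_derivative_transform_within_open[OF _ open_punctured]) (use y hom in auto)
  from has_derivative_unique[OF D this] have "dirderiv (r *\<^sub>R v) F (r *\<^sub>R y) = c * dirderiv v F y"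
    by metis
  moreover have "linear (\<lambda>v. dirderiv v F (r *\<^sub>R y))"
    using r y by (intro has_derivative_linear[OF Ck_on_has_derivative[OF F open_punctured]]) auto
  ultimately show ?thesis by (simp add: linear_scale)
qed

text \<open>Both sides are the derivative at \<open>1\<close> along the ray through
  \<open>y\<close>. The general factor \<open>g\<close> serves degree one (the extension itself) and
  degree zero (its first derivatives).\<close>

lemma dirderiv_radial:
  assumes F: "Ck_on (Suc m) F (- {0})" and hom: "\<And>r. r > 0 \<Longrightarrow> F (r *\<^sub>R y) = g r * F y"
    and g: "(g has_real_derivative g') (at 1)" and y: "y \<noteq> 0"
  shows "dirderiv y F y = g' * F y"
proof -
  have "((\<lambda>s. F (0 + s *\<^sub>R y)) has_real_derivative dirderiv y F (0 + 1 *\<^sub>R y)) (at 1)"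
    by (rule DERIV_line, rule Ck_on_has_derivative[OF F open_punctured]) (use y in auto)
  then have "((\<lambda>s. g s * F y) has_real_derivative dirderiv y F y) (at 1)"
    by (rule DERIV_cong_ev[THEN iffD1, rotated 3])
       (auto simp: hom intro!: eventually_mono[OF eventually_gt_at_top] eventually_nhds_in_open exI[of _ "{0<..}"]
         intro: eventually_mono[OF eventually_nhds_in_open[of "{0<..}" 1]])
  moreover have "((\<lambda>s. g s * F y) has_real_derivative g' * F y) (at 1)" by (rule DERIV_cmult_right[OF g])
  ultimately show ?thesis by (rule DERIV_unique)
qed

definition hess :: "('a::euclidean_space \<Rightarrow> real) \<Rightarrow> 'a \<Rightarrow> 'a \<Rightarrow> 'a \<Rightarrow> real" where
  "hess F y i j = dirderiv j (dirderiv i F) y"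

lemma hom_ext_euler:
  assumes "smooth_on_sphere u" "y \<noteq> 0"
  shows "(\<Sum>b\<in>Basis. (y \<bullet> b) * dirderiv b (hom_ext u) y) = hom_ext u y"
proof -
  have "dirderiv y (hom_ext u) y = 1 * hom_ext u y"
    by (rule dirderiv_radial[OF Ck_on_hom_ext[OF assms(1), of "Suc 0"], where g = "\<lambda>r. r"])
       (use assms in \<open>auto simp: hom_ext_scale\<close>)
  then show ?thesis
    using dirderiv_Basis[OF Ck_on_hom_ext[OF assms(1), of "Suc 0"] open_punctured, of y y] assms(2) by simp
qed

lemma dirderiv_hom_ext_scale:
  assumes "smooth_on_sphere u" "r > 0" "y \<noteq> 0"
  shows "dirderiv v (hom_ext u) (r *\<^sub>R y) = dirderiv v (hom_ext u) y"
  using dirderiv_homogeneous[OF Ck_on_hom_ext[OF assms(1), of "Suc 0"], of r r y v] assms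
  by (simp add: hom_ext_scale)

lemma hess_hom_ext_scale:
  assumes "smooth_on_sphere u" "r > 0" "y \<noteq> 0"
  shows "hess (hom_ext u) (r *\<^sub>R y) i j = (1 / r) * hess (hom_ext u) y i j"
proof -
  have "Ck_on (Suc 0) (dirderiv i (hom_ext u)) (- {0})"
    by (rule Ck_on_dirderiv[OF Ck_on_hom_ext[OF assms(1)]])
  from dirderiv_homogeneous[OF this, of r 1 y j] show ?thesis
    using assms dirderiv_hom_ext_scale[OF assms(1,2)] by (simp add: hess_def field_simps)
qed

lemma hess_sym: "Ck_on (Suc (Suc m)) F U \<Longrightarrow> open U \<Longrightarrow> x \<in> U \<Longrightarrow> hess F x i j = hess F x j i"
  unfolding hess_def by (rule dirderiv_commute)

text \<open>First derivatives of a function homogeneous of degree one are constant along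
  rays.\<close>

lemma hess_hom_ext_kernel:
  assumes u: "smooth_on_sphere u" and y: "y \<noteq> 0"
  shows "(\<Sum>j\<in>Basis. hess (hom_ext u) y i j * (y \<bullet> j)) = 0"
proof -
  have C: "Ck_on (Suc 0) (dirderiv i (hom_ext u)) (- {0})"
    by (rule Ck_on_dirderiv[OF Ck_on_hom_ext[OF u]])
  have "dirderiv y (dirderiv i (hom_ext u)) y = 0 * dirderiv i (hom_ext u) y"
    by (rule dirderiv_radial[OF C, where g = "\<lambda>_. 1"]) (use u y in \<open>auto simp: dirderiv_hom_ext_scale\<close>)
  then show ?thesis
    using dirderiv_Basis[OF C open_punctured, of y y] y by (simp add: hess_def mult.commute)
qed

text \<open>Derivatives within the sphere are not unique in the normal direction, but composition
  with the great circle through \<open>x\<close> with velocity \<open>w\<close> yields a derivative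
  on the real line, which is.\<close>

lemma has_derivative_within_sphere_unique:
  fixes f :: "'a::euclidean_space \<Rightarrow> 'b::real_normed_vector"
  assumes D1: "(f has_derivative D1) (at x within sphere 0 1)"
    and D2: "(f has_derivative D2) (at x within sphere 0 1)"
    and x: "x \<in> sphere 0 1" and v: "v \<in> tangent_space x"
  shows "D1 v = D2 v"
proof (cases "v = 0")
  case True
  then show ?thesis using D1 D2 by (simp add: has_derivative_linear linear_0)
next
  case False
  define w where "w = v /\<^sub>R norm v"
  have w: "norm w = 1" "w \<bullet> x = 0" using False v by (auto simp: w_def tangent_space_def)
  let ?\<gamma> = "\<lambda>t. cos t *\<^sub>R x + sin t *\<^sub>R w"
  have g: "(?\<gamma> has_derivative (\<lambda>t. t *\<^sub>R w)) (at 0)"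
    by (auto intro!: derivative_eq_intros)
  have S: "range ?\<gamma> \<subseteq> sphere 0 1"
  proof clarsimp
    fix t :: real
    have "?\<gamma> t \<bullet> ?\<gamma> t = (cos t)\<^sup>2 + (sin t)\<^sup>2"
      using w x by (simp add: inner_add_left inner_add_right inner_commute[of x w] power2_eq_square norm_eq_1)
    then show "norm (?\<gamma> t) = 1" by (simp add: norm_eq_1)
  qed
  have *: "((\<lambda>t. f (?\<gamma> t)) has_derivative (\<lambda>t. D (t *\<^sub>R w))) (at 0)"
    if "(f has_derivative D) (at x within sphere 0 1)" for D
    by (rule has_derivative_in_compose[OF g]) (use has_derivative_subset[OF that S] in simp)
  have "D1 (norm v *\<^sub>R w) = D2 (norm v *\<^sub>R w)"
    using has_derivative_unique[OF *[OF D1] *[OF D2]] by metis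
  then show ?thesis using False by (simp add: w_def)
qed

text \<open>An extension of the tangential gradient to the ambient space: by Euler's relation the
  subtracted term is the radial part of the Euclidean gradient at points of the unit sphere.\<close>

definition hom_grad :: "('a::euclidean_space \<Rightarrow> real) \<Rightarrow> 'a \<Rightarrow> 'a" where
  "hom_grad u y = (\<Sum>b\<in>Basis. dirderiv b (hom_ext u) y *\<^sub>R b) - hom_ext u y *\<^sub>R y"

lemma sphere_grad_eq:
  assumes u: "smooth_on_sphere u" and x: "x \<in> sphere 0 1"
  shows "sphere_grad u x = hom_grad u x"
  unfolding sphere_grad_def
proof (rule the_equality)
  let ?G = "hom_ext u"
  have x0: "x \<noteq> 0" and xx: "x \<bullet> x = 1" using x by (auto simp: norm_eq_1)
  note C = Ck_on_hom_ext[OF u, of "Suc 0"]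
  have inner_g: "hom_grad u x \<bullet> v = dirderiv v ?G x - u x * (v \<bullet> sgn x)" for v
  proof -
    have "hom_grad u x \<bullet> v = (\<Sum>b\<in>Basis. dirderiv b ?G x * (b \<bullet> v)) - ?G x * (x \<bullet> v)"
      by (simp add: hom_grad_def inner_diff_left inner_sum_left)
    moreover have "dirderiv v ?G x = (\<Sum>b\<in>Basis. (v \<bullet> b) * dirderiv b ?G x)"
      by (rule dirderiv_Basis[OF C open_punctured]) (use x0 in simp)
    moreover have "\<dots> = (\<Sum>b\<in>Basis. dirderiv b ?G x * (b \<bullet> v))"
      by (rule sum.cong) (simp_all add: inner_commute)
    ultimately show ?thesis
      using x by (simp add: hom_ext_sphere sgn_div_norm inner_commute[of v x])
  qed
  show 1: "hom_grad u x \<in> tangent_space x \<and> (u has_derivative (\<lambda>v. hom_grad u x \<bullet> v)) (at x within sphere 0 1)"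
  proof
    have "dirderiv x ?G x = ?G x"
      using hom_ext_euler[OF u x0] dirderiv_Basis[OF C open_punctured, of x x] x0 by simp
    then show "hom_grad u x \<in> tangent_space x"
      using inner_g[of x] x xx by (simp add: tangent_space_def sgn_div_norm hom_ext_sphere)
    \<comment> \<open>This function agrees with \<open>u\<close> on the sphere, and the correction
      removes the normal derivative, so its full derivative at \<open>x\<close> is given by the
      tangential gradient.\<close>
    have "((\<lambda>y. ?G y - u x * (norm y - 1)) has_derivative (\<lambda>v. dirderiv v ?G x - u x * (v \<bullet> sgn x - 0))) (at x)"
      by (intro has_derivative_diff has_derivative_mult_right has_derivative_const has_derivative_norm
            Ck_on_has_derivative[OF C open_punctured]) (use x0 in auto)
    moreover have "(\<lambda>v. dirderiv v ?G x - u x * (v \<bullet> sgn x - 0)) = (\<lambda>v. hom_grad u x \<bullet> v)"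
      by (simp only: inner_g diff_zero)
    ultimately have "((\<lambda>y. ?G y - u x * (norm y - 1)) has_derivative (\<lambda>v. hom_grad u x \<bullet> v)) (at x within sphere 0 1)"
      by (simp only: has_derivative_at_withinI)
    then show "(u has_derivative (\<lambda>v. hom_grad u x \<bullet> v)) (at x within sphere 0 1)"
      by (rule has_derivative_transform[OF x, rotated]) (simp add: hom_ext_sphere)
  qed
  fix g assume g: "g \<in> tangent_space x \<and> (u has_derivative (\<lambda>v. g \<bullet> v)) (at x within sphere 0 1)"
  let ?d = "g - hom_grad u x"
  have "?d \<in> tangent_space x" using g 1 by (simp add: tangent_space_def inner_diff_left)
  then have "g \<bullet> ?d = hom_grad u x \<bullet> ?d"
    using has_derivative_within_sphere_unique[OF conjunct2[OF g] conjunct2[OF 1] x] by blast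
  then have "?d \<bullet> ?d = 0" by (simp add: inner_diff_left)
  then show "g = hom_grad u x" by simp
qed

text \<open>Differentiating the radial correction in \<open>hom_grad\<close> along a tangent vector
  \<open>v\<close> gives \<open>- u x\<close> times \<open>v\<close> plus a normal vector. The
  metric term of \<open>W_tensor\<close> cancels the former and the tangent vector \<open>w\<close>
  ignores the latter.\<close>

lemma W_tensor_eq:
  assumes u: "smooth_on_sphere u" and x: "x \<in> sphere 0 1"
    and v: "v \<in> tangent_space x" and w: "w \<in> tangent_space x"
  shows "W_tensor u x v w = (\<Sum>i\<in>Basis. \<Sum>j\<in>Basis. (w \<bullet> i) * (hess (hom_ext u) x i j * (v \<bullet> j)))"
proof -
  let ?G = "hom_ext u"
  have x0: "x \<noteq> 0" using x by auto
  note C = Ck_on_hom_ext[OF u]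
  let ?D = "\<lambda>v. (\<Sum>b\<in>Basis. dirderiv v (dirderiv b ?G) x *\<^sub>R b) - (?G x *\<^sub>R v + dirderiv v ?G x *\<^sub>R x)"
  have C1: "Ck_on (Suc 0) (dirderiv b ?G) (- {0})" for b by (rule Ck_on_dirderiv[OF C])
  have "(hom_grad u has_derivative ?D) (at x)"
    unfolding hom_grad_def
    by (intro has_derivative_diff has_derivative_sum has_derivative_scaleR_left has_derivative_scaleR has_derivative_ident
          Ck_on_has_derivative[OF C1 open_punctured] Ck_on_has_derivative[OF C[of "Suc 0"] open_punctured])
       (use x0 in auto)
  then have "(hom_grad u has_derivative ?D) (at x within sphere 0 1)" by (rule has_derivative_at_withinI)
  then have D: "(sphere_grad u has_derivative ?D) (at x within sphere 0 1)"
    by (rule has_derivative_transform[OF x, rotated]) (simp add: sphere_grad_eq[OF u])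
  then have "sphere_grad u differentiable (at x within sphere 0 1)" by (auto simp: differentiable_def)
  then have "(sphere_grad u has_derivative frechet_derivative (sphere_grad u) (at x within sphere 0 1)) (at x within sphere 0 1)"
    by (simp add: frechet_derivative_works)
  from has_derivative_within_sphere_unique[OF this D x v]
  have eq: "frechet_derivative (sphere_grad u) (at x within sphere 0 1) v = ?D v" .
  have xw: "x \<bullet> w = 0" using w by (simp add: tangent_space_def inner_commute)
  have "sphere_hessian u x v w = ?D v \<bullet> w"
    unfolding sphere_hessian_def sphere_connection_def eq Let_def by (simp only: inner_diff_left inner_scaleR_left xw mult_zero_right diff_zero)
  also have "\<dots> = (\<Sum>b\<in>Basis. dirderiv v (dirderiv b ?G) x * (b \<bullet> w)) - u x * (v \<bullet> w)"
    by (simp add: inner_diff_left inner_add_left inner_sum_left xw hom_ext_sphere[OF x])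
  also have "(\<Sum>b\<in>Basis. dirderiv v (dirderiv b ?G) x * (b \<bullet> w))
     = (\<Sum>i\<in>Basis. \<Sum>j\<in>Basis. (w \<bullet> i) * (hess ?G x i j * (v \<bullet> j)))"
  proof (rule sum.cong[OF refl])
    fix i :: 'a
    have "dirderiv v (dirderiv i ?G) x = (\<Sum>j\<in>Basis. (v \<bullet> j) * dirderiv j (dirderiv i ?G) x)"
      by (rule dirderiv_Basis[OF C1 open_punctured]) (use x0 in simp)
    then show "dirderiv v (dirderiv i ?G) x * (i \<bullet> w) = (\<Sum>j\<in>Basis. (w \<bullet> i) * (hess ?G x i j * (v \<bullet> j)))"
      by (simp add: hess_def sum_distrib_left inner_commute[of i w] mult_ac)
  qed
  finally show ?thesis by (simp add: W_tensor_def)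
qed

section \<open>Integrals of directional derivatives\<close>

lemma lborel_integral_translate:
  fixes g :: "'a::euclidean_space \<Rightarrow> real"
  assumes "integrable lborel g"
  shows "integrable lborel (\<lambda>x. g (a + x))" "integral\<^sup>L lborel (\<lambda>x. g (a + x)) = integral\<^sup>L lborel g"
proof -
  have m: "(+) a \<in> measurable lborel borel" "g \<in> borel_measurable borel"
    using assms by auto
  have d: "distr lborel borel ((+) a) = lborel" by (rule lborel_distr_plus)
  show "integrable lborel (\<lambda>x. g (a + x))"
    using integrable_distr_eq[OF m] assms unfolding d by simp
  show "integral\<^sup>L lborel (\<lambda>x. g (a + x)) = integral\<^sup>L lborel g"
    using integral_distr[OF m] unfolding d by simp
qed

text \<open>By translation invariance the difference quotients have integral \<open>0\<close>.\<close>

lemma has_bochner_integral_dirderiv_0: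
  fixes g :: "'a::euclidean_space \<Rightarrow> real"
  assumes g: "Ck_on (Suc 0) g UNIV" and supp: "\<And>x. R < norm x \<Longrightarrow> g x = 0"
  shows "has_bochner_integral lborel (dirderiv e g) 0"
proof -
  \<comment> \<open>The steps \<open>h n\<close> are at most \<open>1\<close>, so all difference
    quotients vanish outside this ball and share one integrable bound.\<close>
  let ?K = "cball (0::'a) (R + norm e)"
  have cg: "continuous_on UNIV g" by (rule Ck_on_continuous[OF g])
  have cd: "continuous_on UNIV (dirderiv e g)" by (rule Ck_on_continuous[OF Ck_on_dirderiv[OF g]])
  have D: "((\<lambda>s. g (x + s *\<^sub>R e)) has_real_derivative dirderiv e g (x + t *\<^sub>R e)) (at t)" for x t
    by (rule DERIV_line[OF Ck_on_has_derivative[OF g]]) auto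
  have open_out: "open {x :: 'a. R < norm x}" by (intro open_Collect_less continuous_intros)
  have d0: "dirderiv e g x = 0" if "R < norm x" for x
    using frechet_derivative_cong_open[OF open_out, of x g "\<lambda>_. 0"] that supp by simp
  have "compact (dirderiv e g ` cball 0 R)"
    by (intro compact_continuous_image continuous_on_subset[OF cd]) auto
  then have "bounded (dirderiv e g ` cball 0 R)" by (rule compact_imp_bounded)
  then obtain C where "\<forall>z\<in>dirderiv e g ` cball 0 R. norm z \<le> C" unfolding bounded_iff by blast
  then have C: "\<bar>dirderiv e g x\<bar> \<le> C" if "norm x \<le> R" for x using that by simp
  \<comment> \<open>The bound \<open>C\<close> speaks of the ball only and could be negative if that
    is empty; the maximum also covers the exterior, where the derivative is zero.\<close>
  define B where "B = max C 0"
  have B: "\<bar>dirderiv e g x\<bar> \<le> B" for x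
    using C[of x] d0[of x] by (cases "norm x \<le> R") (auto simp: B_def)
  have intg: "integrable lborel g"
  proof -
    have "integrable lborel (\<lambda>x. indicator (cball 0 R) x *\<^sub>R g x)"
      by (intro borel_integrable_compact continuous_on_subset[OF cg]) auto
    moreover have "indicator (cball 0 R) x *\<^sub>R g x = g x" for x
      using supp[of x] by (auto simp: indicator_def not_le)
    ultimately show ?thesis by (simp only:)
  qed
  define h where "h n = inverse (real (Suc n))" for n
  have h: "h n > 0" "h n \<le> 1" for n by (auto simp: h_def inverse_le_1_iff)
  define s where "s n x = (g (h n *\<^sub>R e + x) - g x) / h n" for n x
  have int_s: "integral\<^sup>L lborel (s n) = 0" for n
    unfolding s_def using lborel_integral_translate[OF intg, of "h n *\<^sub>R e"] intg by simp
  have meas: "f \<in> borel_measurable lborel" if "continuous_on UNIV f" for f :: "'a \<Rightarrow> real"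
    using borel_measurable_continuous_onI[OF that] by simp
  have lim: "(\<lambda>n. s n x) \<longlonglongrightarrow> dirderiv e g x" for x
  proof -
    have "((\<lambda>t. (g (x + t *\<^sub>R e) - g x) / t) \<longlongrightarrow> dirderiv e g x) (at 0)"
      using D[of x 0] by (simp add: DERIV_def)
    moreover have "filterlim h (at 0) sequentially"
      unfolding filterlim_at h_def using LIMSEQ_inverse_real_of_nat by simp
    ultimately have "(\<lambda>n. (g (x + h n *\<^sub>R e) - g x) / h n) \<longlonglongrightarrow> dirderiv e g x"
      by (rule filterlim_compose)
    then show ?thesis by (simp add: s_def add.commute)
  qed
  have bound: "norm (s n x) \<le> B * indicator ?K x" for n x
  proof (cases "x \<in> ?K")
    case True
    obtain t where "g (x + h n *\<^sub>R e) - g (x + 0 *\<^sub>R e) = (h n - 0) * dirderiv e g (x + t *\<^sub>R e)"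
      using MVT2[of 0 "h n" "\<lambda>s. g (x + s *\<^sub>R e)" "\<lambda>t. dirderiv e g (x + t *\<^sub>R e)", OF h(1) D] by blast
    then have "s n x = dirderiv e g (x + t *\<^sub>R e)" using h(1)[of n] by (simp add: s_def add.commute)
    then show ?thesis using B[of "x + t *\<^sub>R e"] True by simp
  next
    case False
    have "norm x \<le> norm (h n *\<^sub>R e + x) + norm (h n *\<^sub>R e)"
      using norm_triangle_ineq4[of "h n *\<^sub>R e + x" "h n *\<^sub>R e"] by simp
    moreover have "norm (h n *\<^sub>R e) \<le> norm e" using h[of n] by (simp add: mult_left_le_one_le)
    moreover have "R + norm e < norm x" using False by simp
    moreover have "0 \<le> norm e" by simp
    ultimately have "R < norm (h n *\<^sub>R e + x)" "R < norm x" by linarith+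
    then show ?thesis using supp False by (simp add: s_def)
  qed
  have intB: "integrable lborel (\<lambda>x. B * indicator ?K x :: real)"
    by (intro integrable_mult_right integrable_real_indicator) (use emeasure_bounded_finite[OF bounded_cball] in auto)
  have ms: "s n \<in> borel_measurable lborel" for n
    unfolding s_def using h(1)[of n] by (intro meas continuous_intros continuous_on_compose2[OF cg]) auto
  have AEl: "AE x in lborel. (\<lambda>n. s n x) \<longlonglongrightarrow> dirderiv e g x"
    and AEb: "\<And>n. AE x in lborel. norm (s n x) \<le> B * indicator ?K x"
    using lim bound by auto
  have "integrable lborel (dirderiv e g)"
    by (rule integrable_dominated_convergence[OF meas[OF cd] ms intB AEl AEb])
  moreover have "(\<lambda>n. integral\<^sup>L lborel (s n)) \<longlonglongrightarrow> integral\<^sup>L lborel (dirderiv e g)"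
    by (rule integral_dominated_convergence[OF meas[OF cd] ms intB AEl AEb])
  then have "integral\<^sup>L lborel (dirderiv e g) = 0"
    unfolding int_s using LIMSEQ_const_iff by metis
  ultimately show ?thesis by (simp add: has_bochner_integral_iff)
qed

text \<open>The set where \<open>f\<close> is nonzero is open and null, hence empty.\<close>

lemma continuous_nonpos_integral_0:
  fixes f :: "'a::euclidean_space \<Rightarrow> real"
  assumes f: "continuous_on UNIV f" and neg: "\<And>x. f x \<le> 0" and int: "has_bochner_integral lborel f 0"
  shows "f x = 0"
proof (rule ccontr)
  assume "f x \<noteq> 0"
  let ?S = "{x. f x \<noteq> 0}"
  have oS: "open ?S" using open_Collect_neq[OF f continuous_on_const] .
  have "integrable lborel (\<lambda>x. - f x)" "integral\<^sup>L lborel (\<lambda>x. - f x) = 0"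
    using int by (auto simp: has_bochner_integral_iff)
  then have "AE x in lborel. - f x = 0"
    using integral_nonneg_eq_0_iff_AE[of lborel "\<lambda>x. - f x"] neg by simp
  then have "AE x in lborel. x \<notin> ?S" by simp
  then have "?S \<in> null_sets lborel"
    using AE_iff_null_sets[of ?S lborel] oS by simp
  then have "negligible ?S"
    by (simp add: negligible_iff_null_sets null_sets_completionI)
  then show False using open_not_negligible[OF oS] \<open>f x \<noteq> 0\<close> by blast
qed

section \<open>The flux and uniqueness\<close>

lemma DERIV_max_square: "((\<lambda>r. (max 0 r)\<^sup>2) has_real_derivative 2 * max 0 r) (at (r::real))"
proof -
  consider "r > 0" | "r < 0" | "r = 0" by linarith
  then show ?thesis
  proof cases
    case 1
    have "((\<lambda>r. r\<^sup>2) has_real_derivative 2 * max 0 r) (at r)"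
      using 1 by (auto intro!: derivative_eq_intros)
    then show ?thesis
      by (rule has_field_derivative_transform_within_open[of _ _ _ "{0<..}"]) (use 1 in auto)
  next
    case 2
    have "((\<lambda>r. 0) has_real_derivative 2 * max 0 r) (at r)"
      using 2 by (auto intro!: derivative_eq_intros)
    then show ?thesis
      by (rule has_field_derivative_transform_within_open[of _ _ _ "{..<0}"]) (use 2 in auto)
  next
    case 3
    \<comment> \<open>At \<open>0\<close> the square of \<open>max 0 r\<close> factors as
      \<open>max 0 r * r\<close>, with a continuous first factor.\<close>
    show ?thesis unfolding CARAT_DERIV
      by (rule exI[of _ "max 0"]) (auto simp: 3 power2_eq_square max_def intro!: continuous_intros)
  qed
qed

text \<open>A cutoff supported in the shell \<open>1 \<le> norm y \<le> 2\<close>. Being radial, it does not see the flux,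
  which is tangential.\<close>

definition cutoff :: "'a::euclidean_space \<Rightarrow> real" where
  "cutoff y = (max 0 ((y \<bullet> y - 1) * (4 - y \<bullet> y)))\<^sup>2"

definition cutoff_slope :: "'a::euclidean_space \<Rightarrow> real" where
  "cutoff_slope y = 2 * max 0 ((y \<bullet> y - 1) * (4 - y \<bullet> y)) * (2 * (4 - y \<bullet> y) - 2 * (y \<bullet> y - 1))"

lemma cutoff_has_derivative: "(cutoff has_derivative (\<lambda>v. cutoff_slope y * (y \<bullet> v))) (at y)"
proof -
  let ?q = "\<lambda>y :: 'a. (y \<bullet> y - 1) * (4 - y \<bullet> y)"
  have "(?q has_derivative (\<lambda>v. (2 * (4 - y \<bullet> y) - 2 * (y \<bullet> y - 1)) * (y \<bullet> v))) (at y)"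
    by (auto intro!: derivative_eq_intros simp: inner_commute algebra_simps)
  from has_derivative_compose[OF this DERIV_max_square[unfolded has_field_derivative_def]]
  show ?thesis unfolding cutoff_def cutoff_slope_def by (simp add: mult.assoc)
qed

text \<open>The divergence differentiates the cutoff once, and squaring the positive part provides
  one continuous derivative.\<close>

lemma Ck_on_cutoff: "Ck_on (Suc 0) cutoff U" if "open U"
  by (rule Ck_on_SucI[OF that cutoff_has_derivative])
     (auto simp: cutoff_slope_def intro!: continuous_intros)

lemma dirderiv_cutoff: "dirderiv v cutoff y = cutoff_slope y * (y \<bullet> v)"
  by (rule dirderivI[OF cutoff_has_derivative])

lemma cutoff_nonneg: "cutoff y \<ge> 0"
  by (simp add: cutoff_def)

lemma cutoff_outside: "norm y \<le> 1 \<or> 2 \<le> norm y \<Longrightarrow> cutoff y = 0"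
proof -
  assume "norm y \<le> 1 \<or> 2 \<le> norm y"
  then have "y \<bullet> y \<le> 1 \<or> 4 \<le> y \<bullet> y"
    unfolding power2_norm_eq_inner[symmetric]
    using power_mono[of "norm y" 1 2] power_mono[of 2 "norm y" 2] by auto
  then have "(y \<bullet> y - 1) * (4 - y \<bullet> y) \<le> 0" by (auto simp: mult_le_0_iff)
  then show ?thesis by (simp add: cutoff_def)
qed

lemma Ck_on_newton_tensor:
  assumes U: "open U" and M: "\<And>i j. i \<in> I \<Longrightarrow> j \<in> I \<Longrightarrow> Ck_on n (\<lambda>y. M y i j) U"
    and "i \<in> I" "j \<in> I"
  shows "Ck_on n (\<lambda>y. newton_tensor I (M y) m i j) U"
  using assms(3,4)
proof (induction m arbitrary: i j)
  case 0
  then show ?case using U by (auto intro: Ck_on_const)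
next
  case (Suc m)
  have s: "Ck_on n (\<lambda>y. \<Sum>a\<in>I. \<Sum>l\<in>I. newton_tensor I (M y) m a l * M y l a) U"
    by (intro Ck_on_sum Ck_on_mult U Suc.IH M)
  have "Ck_on n (\<lambda>y. (if i = j then (1 / real (Suc m)) else 0) * (\<Sum>a\<in>I. \<Sum>l\<in>I. newton_tensor I (M y) m a l * M y l a)
      - (\<Sum>l\<in>I. newton_tensor I (M y) m i l * M y l j)) U"
    by (intro Ck_on_diff Ck_on_mult[OF U Ck_on_const[OF U] s] Ck_on_sum Ck_on_mult U Suc.IH M Suc.prems)
  moreover have "newton_tensor I (M y) (Suc m) i j = (if i = j then (1 / real (Suc m)) else 0) * (\<Sum>a\<in>I. \<Sum>l\<in>I. newton_tensor I (M y) m a l * M y l a)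
      - (\<Sum>l\<in>I. newton_tensor I (M y) m i l * M y l j)" for y
    by (simp add: newton_tensor.simps(2))
  ultimately show ?case by (simp only:)
qed

lemma Ck_on_hess:
  assumes "smooth_on_sphere u"
  shows "Ck_on m (\<lambda>y. hess (hom_ext u) y i j) (- {0})"
  unfolding hess_def by (intro Ck_on_dirderiv Ck_on_hom_ext assms)

text \<open>For \<open>m = k - 1\<close> this is \<open>k\<close> times the polarization of the
  \<open>k\<close>-th symmetric function, with one slot taken by the Hessian of the extension of
  \<open>w\<close>.\<close>

definition mixed_trace :: "nat \<Rightarrow> ('a::euclidean_space \<Rightarrow> real) \<Rightarrow> ('a \<Rightarrow> real) \<Rightarrow> 'a \<Rightarrow> real" where
  "mixed_trace m u w y = (\<Sum>i\<in>Basis. \<Sum>j\<in>Basis.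
     newton_tensor Basis (hess (hom_ext u) y) m i j * hess (hom_ext w) y j i)"

text \<open>The divergence of the flux
  \<open>V i = cutoff * (\<Sum>j. T i j * (w * \<partial>\<^sub>j u - u * \<partial>\<^sub>j w))\<close>, where \<open>u\<close>, \<open>w\<close> stand for their homogeneous
  extensions and \<open>T\<close> for the Newton tensor of the Hessian of \<open>u\<close>.\<close>

lemma flux_divergence:
  fixes u w :: "'a::euclidean_space \<Rightarrow> real" and m :: nat
  assumes u: "smooth_on_sphere u" and w: "smooth_on_sphere w"
  defines "X \<equiv> \<lambda>y. cutoff y * (hom_ext w y * mixed_trace m u u y - hom_ext u y * mixed_trace m u w y)"
  shows "has_bochner_integral lborel X 0" and "continuous_on UNIV X"
proof -
  let ?G = "hom_ext u" and ?H = "hom_ext w"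
  let ?U = "- {0 :: 'a}"
  note op = open_punctured
  define T where "T y i j = newton_tensor Basis (hess ?G y) m i j" for y i j
  define Z where "Z j y = ?H y * dirderiv j ?G y - ?G y * dirderiv j ?H y" for j y
  define V where "V i y = cutoff y * (\<Sum>j\<in>Basis. T y i j * Z j y)" for i y
  have CG: "Ck_on n ?G ?U" and CH: "Ck_on n ?H ?U" for n using Ck_on_hom_ext u w by auto
  have CG1: "Ck_on n (dirderiv j ?G) ?U" and CH1: "Ck_on n (dirderiv j ?H) ?U" for n j
    by (rule Ck_on_dirderiv[OF CG], rule Ck_on_dirderiv[OF CH])
  have CT: "Ck_on n (\<lambda>y. T y i j) ?U" if "i \<in> Basis" "j \<in> Basis" for n i j
    unfolding T_def by (rule Ck_on_newton_tensor[OF op _ that]) (rule Ck_on_hess[OF u])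
  have CZ: "Ck_on n (Z j) ?U" for n j
    unfolding Z_def by (intro Ck_on_diff Ck_on_mult op CG CH CG1 CH1)
  have V0: "V i y = 0" if "norm y \<le> 1 \<or> 2 \<le> norm y" for i y
    using cutoff_outside[OF that] by (simp add: V_def)
  have CV': "Ck_on (Suc 0) (V i) ?U" if "i \<in> Basis" for i
    unfolding V_def using that by (intro Ck_on_mult[OF op Ck_on_cutoff[OF op]] Ck_on_sum op Ck_on_mult CT CZ)
  have CV: "Ck_on (Suc 0) (V i) UNIV" if i: "i \<in> Basis" for i
  proof (rule Ck_on_local)
    fix y :: 'a
    show "\<exists>S. open S \<and> y \<in> S \<and> Ck_on (Suc 0) (V i) S"
    proof (cases "y = 0")
      case True
      \<comment> \<open>The extensions are singular at the origin, but the cutoff makes the flux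
        vanish identically around it.\<close>
      have "Ck_on (Suc 0) (V i) (ball 0 1) \<longleftrightarrow> Ck_on (Suc 0) (\<lambda>_. 0) (ball (0::'a) 1)"
        by (rule Ck_on_cong) (auto intro: V0)
      then have "Ck_on (Suc 0) (V i) (ball 0 1)" using Ck_on_const[OF open_ball] by blast
      then show ?thesis using True by (intro exI[of _ "ball 0 1"]) auto
    next
      case False
      then show ?thesis using CV'[OF i] op by (intro exI[of _ ?U]) auto
    qed
  qed
  have div: "(\<Sum>i\<in>Basis. dirderiv i (V i) y) = X y" for y
  proof (cases "y = 0")
    case True
    have "dirderiv i (V i) y = 0" for i
      using frechet_derivative_cong_open[of "ball 0 1" y "V i" "\<lambda>_. 0"] True V0 by simp
    then show ?thesis using True by (simp add: X_def cutoff_outside)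
  next
    case False
    then have y: "y \<in> ?U" by simp
    have sym: "hess ?G y i j = hess ?G y j i" for i j by (rule hess_sym[OF CG op y])
    obtain q \<mu> where q: "orthonormal_frame Basis q" and D: "diagonalized Basis q \<mu> (hess ?G y)"
    proof -
      have "\<forall>i\<in>Basis. \<forall>j\<in>Basis. hess ?G y i j = hess ?G y j i" by (intro ballI sym)
      from exists_diagonalizing_frame[OF this orthonormal_frame_Basis, where c = "\<lambda>_. 0"] that
      show thesis by blast
    qed
    have Tsym: "T y i j = T y j i" if "i \<in> Basis" "j \<in> Basis" for i j
      unfolding T_def by (rule newton_tensor_sym[OF finite_Basis q D that])
    have line: "((\<lambda>s. F (y + s *\<^sub>R e)) has_real_derivative dirderiv e F y) (at 0)" if "Ck_on (Suc 0) F ?U" for F e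
      using DERIV_line[of F y 0 e] Ck_on_has_derivative[OF that op y] by simp
    have "\<exists>DT. (\<forall>e\<in>Basis. \<forall>i\<in>Basis. \<forall>j\<in>Basis.
        ((\<lambda>s. newton_tensor Basis (hess ?G (y + s *\<^sub>R e)) m i j) has_real_derivative DT e i j) (at 0)) \<and>
        (\<forall>j\<in>Basis. (\<Sum>e\<in>Basis. DT e e j) = 0)"
    proof (rule newton_tensor_divergence_free[OF finite_Basis q D])
      show "hess ?G (y + 0 *\<^sub>R e) = hess ?G y" for e by simp
      show "((\<lambda>s. hess ?G (y + s *\<^sub>R e) i j) has_real_derivative dirderiv e (\<lambda>z. hess ?G z i j) y) (at 0)" for e i j
        by (rule line[OF Ck_on_hess[OF u]])
      show "dirderiv e (\<lambda>z. hess ?G z i j) y = dirderiv j (\<lambda>z. hess ?G z i e) y" for e i j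
        unfolding hess_def by (rule dirderiv_commute[OF CG1 op y])
    qed
    then obtain DT where DT: "\<And>e i j. e \<in> Basis \<Longrightarrow> i \<in> Basis \<Longrightarrow> j \<in> Basis \<Longrightarrow>
        ((\<lambda>s. T (y + s *\<^sub>R e) i j) has_real_derivative DT e i j) (at 0)"
      and DT0: "\<And>j. j \<in> Basis \<Longrightarrow> (\<Sum>e\<in>Basis. DT e e j) = 0"
      unfolding T_def by blast
    \<comment> \<open>The derivative of \<open>Z\<close> splits into \<open>A\<close>, made of first
      derivatives and antisymmetric, and \<open>C\<close>, made of second derivatives. The former
      drops out against the symmetric Newton tensor; the latter produces the mixed traces.\<close>
    define A where "A i j = dirderiv i ?H y * dirderiv j ?G y - dirderiv i ?G y * dirderiv j ?H y" for i j
    define C where "C i j = ?H y * hess ?G y j i - ?G y * hess ?H y j i" for i j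
    have DZ: "((\<lambda>s. Z j (y + s *\<^sub>R i)) has_real_derivative A i j + C i j) (at 0)" for i j
    proof -
      have "((\<lambda>s. Z j (y + s *\<^sub>R i)) has_real_derivative
          ((dirderiv i ?H y * dirderiv j ?G (y + 0 *\<^sub>R i) + dirderiv i (dirderiv j ?G) y * ?H (y + 0 *\<^sub>R i)) -
           (dirderiv i ?G y * dirderiv j ?H (y + 0 *\<^sub>R i) + dirderiv i (dirderiv j ?H) y * ?G (y + 0 *\<^sub>R i)))) (at 0)"
        unfolding Z_def by (intro DERIV_diff DERIV_mult line CG CH CG1 CH1)
      then show ?thesis by (simp add: A_def C_def hess_def algebra_simps)
    qed
    have DV: "dirderiv i (V i) y = cutoff_slope y * (y \<bullet> i) * (\<Sum>j\<in>Basis. T y i j * Z j y)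
        + (\<Sum>j\<in>Basis. DT i i j * Z j y + (A i j + C i j) * T y i j) * cutoff y" if i: "i \<in> Basis" for i
    proof (rule DERIV_unique)
      show "((\<lambda>s. V i (y + s *\<^sub>R i)) has_real_derivative dirderiv i (V i) y) (at 0)"
        by (rule line[OF CV'[OF i]])
      have "((\<lambda>s. V i (y + s *\<^sub>R i)) has_real_derivative
          dirderiv i cutoff y * (\<Sum>j\<in>Basis. T (y + 0 *\<^sub>R i) i j * Z j (y + 0 *\<^sub>R i))
        + (\<Sum>j\<in>Basis. DT i i j * Z j (y + 0 *\<^sub>R i) + (A i j + C i j) * T (y + 0 *\<^sub>R i) i j) * cutoff (y + 0 *\<^sub>R i)) (at 0)"
        unfolding V_def by (intro DERIV_mult DERIV_sum line Ck_on_cutoff op DT DZ i)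
      then show "((\<lambda>s. V i (y + s *\<^sub>R i)) has_real_derivative
          cutoff_slope y * (y \<bullet> i) * (\<Sum>j\<in>Basis. T y i j * Z j y)
        + (\<Sum>j\<in>Basis. DT i i j * Z j y + (A i j + C i j) * T y i j) * cutoff y) (at 0)"
        by (simp add: dirderiv_cutoff)
    qed
    \<comment> \<open>The gradient of the cutoff is radial. The Newton tensor maps \<open>y\<close>
      to a multiple of itself, and the radial component of \<open>Z\<close> is zero because both
      extensions satisfy Euler's relation of degree one.\<close>
    have s1: "(\<Sum>i\<in>Basis. (y \<bullet> i) * (\<Sum>j\<in>Basis. T y i j * Z j y)) = 0"
    proof -
      have ker: "(\<Sum>i\<in>Basis. (y \<bullet> i) * hess ?G y i j) = 0" for j
      proof -
        have "(\<Sum>i\<in>Basis. (y \<bullet> i) * hess ?G y i j) = (\<Sum>i\<in>Basis. hess ?G y j i * (y \<bullet> i))"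
          by (rule sum.cong) (simp_all only: sym[of _ j] mult.commute)
        then show ?thesis using hess_hom_ext_kernel[OF u False, of j] by simp
      qed
      have "(\<Sum>i\<in>Basis. (y \<bullet> i) * (\<Sum>j\<in>Basis. T y i j * Z j y))
          = (\<Sum>j\<in>Basis. (\<Sum>i\<in>Basis. (y \<bullet> i) * T y i j) * Z j y)"
        unfolding sum_distrib_left sum_distrib_right mult.assoc by (rule sum.swap)
      also have "\<dots> = (\<Sum>j\<in>Basis. esigma Basis (hess ?G y) m * (y \<bullet> j) * Z j y)"
        unfolding T_def
        by (intro sum.cong refl) (simp only: newton_tensor_kernel[OF finite_Basis ker])
      also have "\<dots> = esigma Basis (hess ?G y) m *
          (?H y * (\<Sum>j\<in>Basis. (y \<bullet> j) * dirderiv j ?G y) - ?G y * (\<Sum>j\<in>Basis. (y \<bullet> j) * dirderiv j ?H y))"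
        by (simp add: Z_def sum_distrib_left sum_subtractf[symmetric] algebra_simps)
      also have "\<dots> = 0" using hom_ext_euler[OF u False] hom_ext_euler[OF w False] by simp
      finally show ?thesis .
    qed
    have s2: "(\<Sum>i\<in>Basis. \<Sum>j\<in>Basis. DT i i j * Z j y) = 0"
    proof -
      have "(\<Sum>i\<in>Basis. \<Sum>j\<in>Basis. DT i i j * Z j y) = (\<Sum>j\<in>Basis. (\<Sum>i\<in>Basis. DT i i j) * Z j y)"
        unfolding sum_distrib_right by (rule sum.swap)
      also have "\<dots> = 0" using DT0 by simp
      finally show ?thesis .
    qed
    have s3: "(\<Sum>i\<in>Basis. \<Sum>j\<in>Basis. A i j * T y i j) = 0"
    proof -
      have "(\<Sum>i\<in>Basis. \<Sum>j\<in>Basis. A i j * T y i j) = (\<Sum>j\<in>Basis. \<Sum>i\<in>Basis. A i j * T y i j)"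
        by (rule sum.swap)
      also have "\<dots> = (\<Sum>j\<in>Basis. \<Sum>i\<in>Basis. - (A j i * T y j i))"
        by (intro sum.cong refl) (simp add: Tsym A_def algebra_simps)
      finally show ?thesis by (simp add: sum_negf)
    qed
    have s4: "(\<Sum>i\<in>Basis. \<Sum>j\<in>Basis. C i j * T y i j) = ?H y * mixed_trace m u u y - ?G y * mixed_trace m u w y"
      by (simp add: C_def T_def mixed_trace_def sum_distrib_left sum_subtractf[symmetric] algebra_simps)
    have "(\<Sum>i\<in>Basis. dirderiv i (V i) y) = cutoff_slope y * (\<Sum>i\<in>Basis. (y \<bullet> i) * (\<Sum>j\<in>Basis. T y i j * Z j y))
       + ((\<Sum>i\<in>Basis. \<Sum>j\<in>Basis. DT i i j * Z j y) + ((\<Sum>i\<in>Basis. \<Sum>j\<in>Basis. A i j * T y i j)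
         + (\<Sum>i\<in>Basis. \<Sum>j\<in>Basis. C i j * T y i j))) * cutoff y"
      by (simp add: DV sum.distrib distrib_right sum_distrib_left sum_distrib_right mult.assoc)
    then show ?thesis unfolding s1 s2 s3 s4 by (simp add: X_def mult.commute)
  qed
  have "has_bochner_integral lborel (\<lambda>y. \<Sum>i\<in>Basis. dirderiv i (V i) y) (\<Sum>i\<in>(Basis :: 'a set). 0)"
    by (intro has_bochner_integral_sum has_bochner_integral_dirderiv_0[OF CV, where R = 2]) (auto intro: V0)
  then show "has_bochner_integral lborel X 0" by (simp add: div)
  have "continuous_on UNIV (\<lambda>y. \<Sum>i\<in>Basis. dirderiv i (V i) y)"
    by (intro continuous_on_sum Ck_on_continuous[OF Ck_on_dirderiv[OF CV]])
  then show "continuous_on UNIV X" by (simp add: div)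
qed

lemma mixed_trace_self:
  "mixed_trace m u u y = real (Suc m) * esigma Basis (hess (hom_ext u) y) (Suc m)"
  by (simp add: mixed_trace_def esigma.simps)

text \<open>Hessians have degree \<open>-1\<close>, and the trace is a form of degree
  \<open>Suc m\<close> in them.\<close>

lemma mixed_trace_scale:
  assumes "smooth_on_sphere u" "smooth_on_sphere w" "r > 0" "y \<noteq> 0"
  shows "mixed_trace m u w (r *\<^sub>R y) = (1 / r) ^ Suc m * mixed_trace m u w y"
proof -
  have "hess (hom_ext u) (r *\<^sub>R y) = (\<lambda>i j. 1 / r * hess (hom_ext u) y i j)"
    by (intro ext) (rule hess_hom_ext_scale[OF assms(1,3,4)])
  then have "newton_tensor Basis (hess (hom_ext u) (r *\<^sub>R y)) m i j
      = (1 / r) ^ m * newton_tensor Basis (hess (hom_ext u) y) m i j" for i j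
    by (simp only: newton_tensor_scale)
  then show ?thesis
    unfolding mixed_trace_def hess_hom_ext_scale[OF assms(2,3,4)] sum_distrib_left
    by (intro sum.cong refl) simp
qed

text \<open>Carries cone condition and equation from the tangent space to the ambient Hessian; the
  normalizing binomials are positive since the order does not exceed the dimension of the
  sphere.\<close>

lemma admissible_esigma:
  fixes u :: "'a::euclidean_space \<Rightarrow> real"
  assumes sol: "smooth_admissible_solution k \<phi> f u" and x: "x \<in> sphere 0 1"
    and k: "1 \<le> k" "k \<le> DIM('a) - 1"
  shows "\<And>j. j \<in> {1..k} \<Longrightarrow> esigma Basis (hess (hom_ext u) x) j > 0"
    and "\<phi> (u x) * esigma Basis (hess (hom_ext u) x) k = real ((DIM('a) - 1) choose k) * f x"
proof -
  have u: "smooth_on_sphere u" and G: "W_tensor u x \<in> Gamma_on (tangent_space x) k"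
    and eq: "\<phi> (u x) * P_on (tangent_space x) k (W_tensor u x) = f x"
    using sol x by (auto simp: smooth_admissible_solution_def)
  have x0: "x \<noteq> 0" using x by auto
  have P: "P_on (tangent_space x) j (W_tensor u x)
      = esigma Basis (hess (hom_ext u) x) j / real ((DIM('a) - 1) choose j)" for j
  proof (rule P_on_tangent_space)
    show "\<forall>i\<in>Basis. \<forall>j\<in>Basis. hess (hom_ext u) x i j = hess (hom_ext u) x j i"
      by (intro ballI hess_sym[OF Ck_on_hom_ext[OF u] open_punctured]) (use x0 in simp)
    show "norm x = 1" using x by simp
    show "(\<Sum>j\<in>Basis. hess (hom_ext u) x i j * (x \<bullet> j)) = 0" for i
      by (rule hess_hom_ext_kernel[OF u x0])
  qed (rule W_tensor_eq[OF u x])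
  have pos: "real ((DIM('a) - 1) choose j) > 0" if "j \<le> k" for j using k that by simp
  show "esigma Basis (hess (hom_ext u) x) j > 0" if j: "j \<in> {1..k}" for j
  proof -
    have "P_on (tangent_space x) j (W_tensor u x) > 0" using G j by (auto simp: Gamma_on_def)
    then show ?thesis unfolding P using pos[of j] j by (simp add: zero_less_divide_iff)
  qed
  show "\<phi> (u x) * esigma Basis (hess (hom_ext u) x) k = real ((DIM('a) - 1) choose k) * f x"
    using eq pos[of k] unfolding P by (simp add: field_simps)
qed

text \<open>Here \<open>s\<close>, \<open>t\<close> are the two solutions at a point,
  \<open>a\<close>, \<open>b\<close> the values of \<open>\<phi>\<close> there, and
  \<open>c / a\<close>, \<open>c / b\<close> the symmetric functions prescribed by the equation.
  Splitting each base into its two powers turns the claim into an identity of rational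
  functions.\<close>

lemma flux_identity:
  fixes a b c s t :: real
  assumes "a > 0" "b > 0" "c > 0" "\<alpha> + \<beta> = 1"
  shows "t * (c / a) - s * ((c / a) powr \<alpha> * (c / b) powr \<beta>)
      + (s * (c / b) - t * ((c / b) powr \<alpha> * (c / a) powr \<beta>))
    = c / (a * b) * ((s * a powr \<beta> - t * b powr \<beta>) * (a powr \<alpha> - b powr \<alpha>))"
proof -
  define p q p' q' c' c'' where "p = a powr \<beta>" and "q = b powr \<beta>" and "p' = a powr \<alpha>" and "q' = b powr \<alpha>"
    and "c' = c powr \<alpha>" and "c'' = c powr \<beta>"
  have pos: "p > 0" "q > 0" "p' > 0" "q' > 0" using assms by (auto simp: p_def q_def p'_def q'_def)
  have split: "z powr \<alpha> * z powr \<beta> = z" if "z > 0" for z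
    using that assms(4) by (simp add: powr_add[symmetric])
  have e: "a = p' * p" "b = q' * q" "c = c' * c''"
    using split assms by (simp_all add: p_def q_def p'_def q'_def c'_def c''_def)
  have pw: "(c / a) powr \<alpha> = c' / p'" "(c / a) powr \<beta> = c'' / p" "(c / b) powr \<alpha> = c' / q'" "(c / b) powr \<beta> = c'' / q"
    using assms by (simp_all add: powr_divide p_def q_def p'_def q'_def c'_def c''_def)
  show ?thesis
    unfolding pw unfolding p_def[symmetric] q_def[symmetric] p'_def[symmetric] q'_def[symmetric]
    unfolding e using pos by (simp add: field_simps)
qed

theorem theorem1p1:
  fixes n k :: nat
    and \<phi> :: "real \<Rightarrow> real"
    and f u\<^sub>1 u\<^sub>2 :: "'a::euclidean_space \<Rightarrow> real"
  assumes "DIM('a) = n + 1"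
    and "2 \<le> k" and "k \<le> n"
    and "continuous_on {0<..} \<phi>"
    and "\<And>s. s > 0 \<Longrightarrow> \<phi> s > 0"
    and "\<And>s t. 0 < s \<Longrightarrow> s < t \<Longrightarrow>
           (s * \<phi> s powr (1 / real k) - t * \<phi> t powr (1 / real k)) *
           (\<phi> s powr ((real k - 1) / real k) - \<phi> t powr ((real k - 1) / real k)) < 0"
    and "continuous_on (sphere 0 1) f"
    and "\<And>x. x \<in> sphere 0 1 \<Longrightarrow> f x > 0"
    and "smooth_admissible_solution k \<phi> f u\<^sub>1"
    and "smooth_admissible_solution k \<phi> f u\<^sub>2"
  shows "\<forall>x\<in>sphere 0 1. u\<^sub>1 x = u\<^sub>2 x"
proof -
  let ?\<alpha> = "(real k - 1) / real k" and ?\<beta> = "1 / real k"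
  have k: "1 \<le> k" "k \<le> DIM('a) - 1" "Suc (k - 1) = k" using assms(1-3) by auto
  have \<alpha>\<beta>: "?\<alpha> + ?\<beta> = 1" using k(1) by (simp add: add_divide_distrib[symmetric])
  \<comment> \<open>The product in the hypothesis on \<open>\<phi>\<close>; it is symmetric in
    \<open>s\<close> and \<open>t\<close>, so it is negative for either order of unequal
    arguments.\<close>
  define Q where "Q s t = (s * \<phi> s powr ?\<beta> - t * \<phi> t powr ?\<beta>) * (\<phi> s powr ?\<alpha> - \<phi> t powr ?\<alpha>)" for s t
  have Q_neg: "Q s t < 0" if "s > 0" "t > 0" "s \<noteq> t" for s t
  proof (cases "s < t")
    case True
    then show ?thesis using assms(6)[of s t] that by (simp add: Q_def)
  next
    case False
    then have "Q t s < 0" using assms(6)[of t s] that by (simp add: Q_def)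
    then show ?thesis by (simp add: Q_def algebra_simps)
  qed
  have u: "smooth_on_sphere u\<^sub>1" "smooth_on_sphere u\<^sub>2"
    using assms(9,10) by (auto simp: smooth_admissible_solution_def)
  define Y where "Y v w y = hom_ext w y * mixed_trace (k - 1) v v y - hom_ext v y * mixed_trace (k - 1) v w y"
    for v w :: "'a \<Rightarrow> real" and y
  \<comment> \<open>The mixed trace enters \<open>Y\<close> with the negative factor
    \<open>- v x\<close>, so Garding's lower bound becomes an upper bound.\<close>
  have Y_le: "Y v w x \<le> real k * (w x * esigma Basis (hess (hom_ext v) x) k
      - v x * (esigma Basis (hess (hom_ext v) x) k powr ?\<alpha> * esigma Basis (hess (hom_ext w) x) k powr ?\<beta>))"
    if x: "x \<in> sphere 0 1" and v: "smooth_admissible_solution k \<phi> f v"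
      and w: "smooth_admissible_solution k \<phi> f w" for v w x
  proof -
    have s: "smooth_on_sphere v" "smooth_on_sphere w" and vx: "v x > 0"
      using v w x by (auto simp: smooth_admissible_solution_def)
    have sym: "\<forall>i\<in>Basis. \<forall>j\<in>Basis. hess (hom_ext z) x i j = hess (hom_ext z) x j i"
      if "smooth_on_sphere z" for z
      by (intro ballI hess_sym[OF Ck_on_hom_ext[OF that] open_punctured]) (use x in auto)
    have "v x * (real k * (esigma Basis (hess (hom_ext v) x) k powr ?\<alpha> * esigma Basis (hess (hom_ext w) x) k powr ?\<beta>))
        \<le> v x * mixed_trace (k - 1) v w x"
      unfolding mixed_trace_def using vx k(1)
      by (intro mult_left_mono garding_newton_tensor sym s admissible_esigma(1)[OF v x k(1,2)]
            admissible_esigma(1)[OF w x k(1,2)]) auto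
    moreover have "mixed_trace (k - 1) v v x = real k * esigma Basis (hess (hom_ext v) x) k"
      using mixed_trace_self[of "k - 1" v x] k(3) by simp
    ultimately show ?thesis by (simp add: Y_def hom_ext_sphere[OF x] algebra_simps)
  qed
  have key: "\<exists>c>0. Y u\<^sub>1 u\<^sub>2 x + Y u\<^sub>2 u\<^sub>1 x \<le> c * Q (u\<^sub>1 x) (u\<^sub>2 x)" if x: "x \<in> sphere 0 1" for x
  proof -
    define C where "C = real ((DIM('a) - 1) choose k) * f x"
    have pos: "u\<^sub>1 x > 0" "u\<^sub>2 x > 0" "C > 0"
      using assms(8-10) x k(2) by (auto simp: smooth_admissible_solution_def C_def)
    note \<phi> = assms(5)[OF pos(1)] assms(5)[OF pos(2)]
    have S: "esigma Basis (hess (hom_ext u\<^sub>1) x) k = C / \<phi> (u\<^sub>1 x)" "esigma Basis (hess (hom_ext u\<^sub>2) x) k = C / \<phi> (u\<^sub>2 x)"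
      using admissible_esigma(2)[OF assms(9) x k(1,2)] admissible_esigma(2)[OF assms(10) x k(1,2)] \<phi>
      by (simp_all add: C_def field_simps)
    have "Y u\<^sub>1 u\<^sub>2 x + Y u\<^sub>2 u\<^sub>1 x \<le> real k * (C / (\<phi> (u\<^sub>1 x) * \<phi> (u\<^sub>2 x)) * Q (u\<^sub>1 x) (u\<^sub>2 x))"
      unfolding Q_def flux_identity[OF \<phi> pos(3) \<alpha>\<beta>, symmetric] distrib_left
      using add_mono[OF Y_le[OF x assms(9,10)] Y_le[OF x assms(10,9)]] unfolding S by simp
    moreover have "real k * (C / (\<phi> (u\<^sub>1 x) * \<phi> (u\<^sub>2 x))) > 0" using \<phi> pos k(1) by simp
    ultimately show ?thesis by (metis mult.assoc)
  qed
  \<comment> \<open>Degree \<open>1\<close> from the extension and degree \<open>-k\<close> from the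
    trace: the factor is positive, so signs are constant along rays.\<close>
  have Y_scale: "Y v w (r *\<^sub>R x) = r * (1 / r) ^ k * Y v w x"
    if "smooth_on_sphere v" "smooth_on_sphere w" "r > 0" "x \<noteq> 0" for v w r x
    using mixed_trace_scale[OF that(1,2,3,4), of "k - 1"] mixed_trace_scale[OF that(1,1,3,4), of "k - 1"] k(3)
    by (simp add: Y_def hom_ext_scale[OF that(3)] algebra_simps)
  define H where "H y = cutoff y * (Y u\<^sub>1 u\<^sub>2 y + Y u\<^sub>2 u\<^sub>1 y)" for y
  have H: "H = (\<lambda>y. cutoff y * Y u\<^sub>1 u\<^sub>2 y + cutoff y * Y u\<^sub>2 u\<^sub>1 y)"
    by (simp add: H_def fun_eq_iff distrib_left)
  \<comment> \<open>The facts are the integral and the continuity for one order of the solutions,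
    then the same two for the other order.\<close>
  note flux = flux_divergence[OF u, where m = "k - 1", folded Y_def]
    flux_divergence[OF u(2,1), where m = "k - 1", folded Y_def]
  have H_scale: "H (r *\<^sub>R x) = cutoff (r *\<^sub>R x) * (r * (1 / r) ^ k) * (Y u\<^sub>1 u\<^sub>2 x + Y u\<^sub>2 u\<^sub>1 x)"
    if "r > 0" "x \<noteq> 0" for r x
    using that by (simp add: H_def Y_scale u algebra_simps)
  have Y_nonpos: "Y u\<^sub>1 u\<^sub>2 x + Y u\<^sub>2 u\<^sub>1 x \<le> 0" if x: "x \<in> sphere 0 1" for x
  proof -
    obtain c where c: "c > 0" "Y u\<^sub>1 u\<^sub>2 x + Y u\<^sub>2 u\<^sub>1 x \<le> c * Q (u\<^sub>1 x) (u\<^sub>2 x)" using key[OF x] by blast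
    have "Q (u\<^sub>1 x) (u\<^sub>2 x) \<le> 0"
      using Q_neg[of "u\<^sub>1 x" "u\<^sub>2 x"] assms(9,10) x
      by (cases "u\<^sub>1 x = u\<^sub>2 x") (auto simp: smooth_admissible_solution_def Q_def less_imp_le)
    then show ?thesis using c mult_nonneg_nonpos[of c "Q (u\<^sub>1 x) (u\<^sub>2 x)"] by linarith
  qed
  have "H y \<le> 0" for y
  proof (cases "y = 0")
    case True
    then show ?thesis by (simp add: H_def cutoff_outside)
  next
    case False
    have "H (norm y *\<^sub>R sgn y) \<le> 0"
      using False H_scale[of "norm y" "sgn y"] Y_nonpos[of "sgn y"] cutoff_nonneg[of y]
      by (simp add: norm_sgn sgn_div_norm mult_nonneg_nonpos)
    then show ?thesis using False by (simp add: sgn_div_norm)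
  qed
  moreover have "continuous_on UNIV H" unfolding H by (intro continuous_on_add flux)
  moreover have "has_bochner_integral lborel H 0"
    using has_bochner_integral_add[OF flux(1) flux(3)] unfolding H by simp
  ultimately have H0: "H y = 0" for y using continuous_nonpos_integral_0 by blast
  show ?thesis
  proof (intro ballI, rule ccontr)
    fix x :: 'a assume x: "x \<in> sphere 0 1" and ne: "u\<^sub>1 x \<noteq> u\<^sub>2 x"
    have "x \<noteq> 0" and "x \<bullet> x = 1" using x by (auto simp: norm_eq_1)
    \<comment> \<open>The radius \<open>3 / 2\<close> lies inside the shell, whereas the cutoff
      vanishes on the unit sphere itself.\<close>
    have "cutoff ((3 / 2) *\<^sub>R x) > 0" using \<open>x \<bullet> x = 1\<close> by (simp add: cutoff_def)
    then have "Y u\<^sub>1 u\<^sub>2 x + Y u\<^sub>2 u\<^sub>1 x = 0"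
      using H_scale[of "3 / 2" x] H0 \<open>x \<noteq> 0\<close> by simp
    moreover have "Q (u\<^sub>1 x) (u\<^sub>2 x) < 0"
      using Q_neg ne assms(9,10) x by (simp add: smooth_admissible_solution_def)
    ultimately show False using key[OF x] by (metis mult_pos_neg not_less)
  qed
qed

end
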